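(* Let $p$ be a prime and let $G$ be a finite group. Suppose that every cyclic subgroup of $G$ of order $p$ is a strong $p$-$CAP$-subgroup of $G$ and, if $p=2$, every cyclic subgroup of $G$ of order $4$ is also a strong $p$-$CAP$-subgroup of $G$. Then $G$ is $p$-supersolvable.
   Context: All groups are finite. For a subgroup $A$ of a group $G$ and a chief factor $H/K$ of $G$, $A$ covers $H/K$ if $HA=KA$, and avoids $H/K$ if $H\cap A=K\cap A$. For a prime $p$, $A$ is a $p$-$CAP$-subgroup of $G$ if $A$ covers or avoids every chief factor of $G$ whose order is divisible by $p$. $A$ is a strong $p$-$CAP$-subgroup of $G$ if $A$ is a $p$-$CAP$-subgroup of $H$ for every subgroup $H$ of $G$ with $A\leq H$. A finite group is $p$-supersolvable if each of its chief factors of order divisible by $p$ has order exactly $p$. *)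

theory Defs
  imports "HOL-Algebra.Algebra"
begin

text \<open>A subgroup \<open>H\<close> of \<open>G\<close>, regarded as a group in its own right, is
  \<open>G\<lparr>carrier := H\<rparr>\<close>. A chief factor \<open>H/K\<close> is represented by the pair \<open>H\<close>, \<open>K\<close>
  of normal subgroups of \<open>G\<close>.\<close>

definition chief_factor :: "('a, 'b) monoid_scheme \<Rightarrow> 'a set \<Rightarrow> 'a set \<Rightarrow> bool" where
  "chief_factor G H K \<longleftrightarrow> H \<lhd> G \<and> K \<lhd> G \<and> K \<subset> H \<and>
     (\<forall>N. N \<lhd> G \<and> K \<subseteq> N \<and> N \<subseteq> H \<longrightarrow> N = K \<or> N = H)"

definition factor_order :: "('a, 'b) monoid_scheme \<Rightarrow> 'a set \<Rightarrow> 'a set \<Rightarrow> nat" where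
  "factor_order G H K = order (G\<lparr>carrier := H\<rparr> Mod K)"

definition covers :: "('a, 'b) monoid_scheme \<Rightarrow> 'a set \<Rightarrow> 'a set \<Rightarrow> 'a set \<Rightarrow> bool" where
  "covers G A H K \<longleftrightarrow> H <#>\<^bsub>G\<^esub> A = K <#>\<^bsub>G\<^esub> A"

definition avoids :: "'a set \<Rightarrow> 'a set \<Rightarrow> 'a set \<Rightarrow> bool" where
  "avoids A H K \<longleftrightarrow> H \<inter> A = K \<inter> A"

definition p_CAP_subgroup :: "nat \<Rightarrow> ('a, 'b) monoid_scheme \<Rightarrow> 'a set \<Rightarrow> bool" where
  "p_CAP_subgroup p G A \<longleftrightarrow> subgroup A G \<and>
     (\<forall>H K. chief_factor G H K \<and> p dvd factor_order G H K \<longrightarrow>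
        covers G A H K \<or> avoids A H K)"

definition strong_p_CAP_subgroup :: "nat \<Rightarrow> ('a, 'b) monoid_scheme \<Rightarrow> 'a set \<Rightarrow> bool" where
  "strong_p_CAP_subgroup p G A \<longleftrightarrow> subgroup A G \<and>
     (\<forall>H. subgroup H G \<and> A \<subseteq> H \<longrightarrow> p_CAP_subgroup p (G\<lparr>carrier := H\<rparr>) A)"

definition p_supersolvable :: "nat \<Rightarrow> ('a, 'b) monoid_scheme \<Rightarrow> bool" where
  "p_supersolvable p G \<longleftrightarrow> group G \<and> finite (carrier G) \<and>
     (\<forall>H K. chief_factor G H K \<and> p dvd factor_order G H K \<longrightarrow> factor_order G H K = p)"

end

theory Submission
  imports "HOL-Computational_Algebra.Polynomial" "HOL-Number_Theory.Residues" Defs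
begin

text \<open>Let \<open>G\<close> be a counterexample of least order, so that its proper subgroups are \<open>p\<close>-supersolvable.
  Covering by elements of order \<open>p\<close> (and \<open>4\<close> if \<open>p = 2\<close>) forces the chief factors of \<open>G\<close> below a
  normal \<open>p\<close>-subgroup to have order \<open>p\<close>: a \<open>p\<close>-regular element centralizing the elements of small
  order of a \<open>p\<close>-group centralizes the whole group, so on a chief factor without elements of small
  order outside its bottom, \<open>G\<close> acts as an abelian group of exponent dividing \<open>p - 1\<close>, which has an
  eigenvector. If \<open>M\<close> is normal and proper, then a Sylow \<open>p\<close>-subgroup \<open>P\<close> of \<open>M\<close> is normal in \<open>G\<close>, by a
  Frattini argument modulo the \<open>p'\<close>-core; hence \<open>G\<close> is \<open>p\<close>-supersolvable as soon as the chief factors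
  above \<open>M\<close> cause no problem, for instance if \<open>M\<close> has index \<open>p\<close> or prime to \<open>p\<close>. For \<open>M\<close> maximal normal
  the remaining case is that all elements of small order lie in \<open>P\<close>. Then the \<open>p\<close>-regular elements
  of \<open>G\<close> centralize \<open>P\<close>, hence act trivially on every \<open>p\<close>-subgroup they normalize, and Frobenius'
  theorem (via control of fusion and transfer) yields a normal subgroup of index \<open>p\<close>.\<close>

section \<open>Conjugation and subgroups\<close>

text \<open>The obstacle is that an element of order \<open>p\<close> in a quotient of
  \<open>G\<close> need not lift to an element of order \<open>p\<close> in \<open>G\<close>. The
  hypothesis is inherited by subgroups, which is what the word strong provides, but it gives no
  direct induction on quotients, so the arguments keep to chief factors of \<open>G\<close> itself.
  An element of small order in \<open>H\<close> but not in \<open>K\<close> cannot avoid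
  \<open>H/K\<close>, hence generates \<open>H\<close> modulo \<open>K\<close>; a factor without
  such an element has to be controlled from the factors beneath it, and coprime action is the means.
  Order 4 enters for \<open>p = 2\<close> because of SL(2,3): its only involution is central, yet it
  has a chief factor of order 4. Elements of order prime to \<open>p\<close> do the work of Hall
  subgroups: "acts as a \<open>p\<close>-group" always takes the form "the \<open>p\<close>-regular
  elements act trivially", and a subgroup that contains all \<open>p\<close>-regular elements and
  has index prime to \<open>p\<close> is the whole group.\<close>

definition conj_by :: "('a, 'b) monoid_scheme \<Rightarrow> 'a \<Rightarrow> 'a \<Rightarrow> 'a" where
  "conj_by G g x = g \<otimes>\<^bsub>G\<^esub> x \<otimes>\<^bsub>G\<^esub> inv\<^bsub>G\<^esub> g"

text \<open>Some exponent prime to \<open>p\<close> is asked for, rather than a condition on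
  \<open>ord\<close>, so that the notion passes to conjugates and subgroups at once. For a prime
  \<open>p\<close>, \<open>coprime n p\<close> excludes \<open>n = 0\<close>.\<close>

definition p_regular :: "nat \<Rightarrow> ('a, 'b) monoid_scheme \<Rightarrow> 'a \<Rightarrow> bool" where
  "p_regular p G x \<longleftrightarrow> x \<in> carrier G \<and> (\<exists>n. coprime n p \<and> x [^]\<^bsub>G\<^esub> (n::nat) = \<one>\<^bsub>G\<^esub>)"

definition p_subgroup :: "nat \<Rightarrow> ('a, 'b) monoid_scheme \<Rightarrow> 'a set \<Rightarrow> bool" where
  "p_subgroup p G D \<longleftrightarrow> subgroup D G \<and> (\<exists>k. card D = p ^ k)"

text \<open>An index prime to \<open>p\<close> is the form that counting fixed cosets and
  multiplying indices can use directly.\<close>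

definition sylow_subgroup :: "nat \<Rightarrow> ('a, 'b) monoid_scheme \<Rightarrow> 'a set \<Rightarrow> bool" where
  "sylow_subgroup p G S \<longleftrightarrow> p_subgroup p G S \<and> \<not> p dvd card (rcosets\<^bsub>G\<^esub> S)"

locale fin_grp = group G for G (structure) +
  fixes p :: nat
  assumes fin [simp]: "finite (carrier G)" and prime_p: "Factorial_Ring.prime p"
begin

lemma p_gt_1: "1 < p" using prime_p prime_gt_1_nat by blast

lemma mult_inv_cancel:
  "a \<in> carrier G \<Longrightarrow> b \<in> carrier G \<Longrightarrow> a \<otimes> (inv a \<otimes> b) = b"
  "a \<in> carrier G \<Longrightarrow> b \<in> carrier G \<Longrightarrow> inv a \<otimes> (a \<otimes> b) = b"
  by (simp_all add: m_assoc[symmetric])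

lemmas grp_simps = m_assoc inv_mult_group mult_inv_cancel

lemma conj_by_closed [simp]:
  "g \<in> carrier G \<Longrightarrow> x \<in> carrier G \<Longrightarrow> conj_by G g x \<in> carrier G"
  by (simp add: conj_by_def)

lemma conj_by_mult:
  "g \<in> carrier G \<Longrightarrow> x \<in> carrier G \<Longrightarrow> y \<in> carrier G \<Longrightarrow>
    conj_by G g (x \<otimes> y) = conj_by G g x \<otimes> conj_by G g y"
  by (simp add: conj_by_def grp_simps)

lemma conj_by_comp:
  "g \<in> carrier G \<Longrightarrow> h \<in> carrier G \<Longrightarrow> x \<in> carrier G \<Longrightarrow>
    conj_by G (g \<otimes> h) x = conj_by G g (conj_by G h x)"
  by (simp add: conj_by_def grp_simps)

lemma conj_by_one [simp]:
  "x \<in> carrier G \<Longrightarrow> conj_by G \<one> x = x" "g \<in> carrier G \<Longrightarrow> conj_by G g \<one> = \<one>"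
  by (simp_all add: conj_by_def)

lemma conj_by_inv:
  "g \<in> carrier G \<Longrightarrow> x \<in> carrier G \<Longrightarrow> conj_by G g (inv x) = inv (conj_by G g x)"
  by (simp add: conj_by_def grp_simps)

lemma conj_by_inverse [simp]:
  "g \<in> carrier G \<Longrightarrow> x \<in> carrier G \<Longrightarrow> conj_by G (inv g) (conj_by G g x) = x"
  "g \<in> carrier G \<Longrightarrow> x \<in> carrier G \<Longrightarrow> conj_by G g (conj_by G (inv g) x) = x"
  by (simp_all add: conj_by_def grp_simps)

lemma conj_by_pow:
  assumes "g \<in> carrier G" "x \<in> carrier G"
  shows "conj_by G g (x [^] (n::nat)) = conj_by G g x [^] n"
  using assms by (induction n) (simp_all add: conj_by_mult)

lemma conj_by_hom: "g \<in> carrier G \<Longrightarrow> conj_by G g \<in> hom G G"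
  by (rule homI) (simp_all add: conj_by_mult)

lemma conj_by_inj: "g \<in> carrier G \<Longrightarrow> inj_on (conj_by G g) (carrier G)"
  by (rule inj_on_inverseI[of _ "conj_by G (inv g)"]) simp

lemma conj_by_eq_iff:
  "g \<in> carrier G \<Longrightarrow> x \<in> carrier G \<Longrightarrow> conj_by G g x = x \<longleftrightarrow> g \<otimes> x = x \<otimes> g"
  by (metis conj_by_def inv_solve_right' m_closed)

lemma group_hom_conj_by: "g \<in> carrier G \<Longrightarrow> group_hom G G (conj_by G g)"
  by (simp add: group_hom_def group_hom_axioms_def conj_by_hom)

lemma subgroup_finite [simp]: "subgroup H G \<Longrightarrow> finite H"
  by (meson fin finite_subset subgroup.subset)

lemma subgroup_card_pos: "subgroup H G \<Longrightarrow> 0 < card H"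
  by (metis card_gt_0_iff empty_iff subgroup.one_closed subgroup_finite)

lemma subgroup_conj_by_image:
  assumes "g \<in> carrier G" "subgroup H G"
  shows "subgroup (conj_by G g ` H) G" "card (conj_by G g ` H) = card H"
proof -
  interpret group_hom G G "conj_by G g" using assms(1) by (rule group_hom_conj_by)
  show "subgroup (conj_by G g ` H) G" by (rule subgroup_img_is_subgroup[OF assms(2)])
  show "card (conj_by G g ` H) = card H"
    by (meson assms card_image conj_by_inj inj_on_subset subgroup.subset)
qed

lemma subgroup_nat_pow: "subgroup H G \<Longrightarrow> x \<in> H \<Longrightarrow> x [^] (n::nat) \<in> H"
  by (metis int_pow_int subgroup_int_pow_closed)

lemma conj_by_subgroup:
  "subgroup H G \<Longrightarrow> g \<in> H \<Longrightarrow> x \<in> H \<Longrightarrow> conj_by G g x \<in> H"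
  by (simp add: conj_by_def subgroup.m_closed subgroup.m_inv_closed)

lemma conj_by_conj_by:
  "x \<in> carrier G \<Longrightarrow> y \<in> carrier G \<Longrightarrow> k \<in> carrier G \<Longrightarrow>
    conj_by G (conj_by G x y) (conj_by G x k) = conj_by G x (conj_by G y k)"
  by (simp add: conj_by_def grp_simps)

lemma conj_by_set_comp:
  assumes "g \<in> carrier G" "h \<in> carrier G" "Y \<subseteq> carrier G"
  shows "conj_by G (g \<otimes> h) ` Y = conj_by G g ` conj_by G h ` Y"
  unfolding image_image by (rule image_cong) (use assms in \<open>auto simp: conj_by_comp\<close>)

lemma conj_by_self_image:
  assumes "subgroup H G" "h \<in> H" shows "conj_by G h ` H = H"
proof (rule card_subset_eq)
  show "conj_by G h ` H \<subseteq> H" using conj_by_subgroup assms by blast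
  show "card (conj_by G h ` H) = card H"
    using subgroup_conj_by_image(2)[OF _ assms(1)] subgroup.mem_carrier[OF assms] by blast
qed (use assms in simp)

lemma subgroup_normalizer:
  assumes "H \<subseteq> carrier G"
  shows "subgroup {g \<in> carrier G. conj_by G g ` H = H} G"
proof (rule subgroupI)
  let ?N = "{g \<in> carrier G. conj_by G g ` H = H}"
  show "?N \<subseteq> carrier G" by blast
  have "conj_by G \<one> ` H = id ` H" by (rule image_cong) (use assms in auto)
  then show "?N \<noteq> {}" by auto
  show "inv a \<in> ?N" if "a \<in> ?N" for a
  proof -
    have a: "a \<in> carrier G" "conj_by G a ` H = H" using that by auto
    have "conj_by G (inv a) ` H = conj_by G (inv a) ` conj_by G a ` H" using a by simp
    also have "\<dots> = id ` H"
      unfolding image_image by (rule image_cong) (use a assms in auto)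
    finally show ?thesis using a(1) by simp
  qed
  show "a \<otimes> b \<in> ?N" if "a \<in> ?N" "b \<in> ?N" for a b
  proof -
    have "conj_by G (a \<otimes> b) ` H = conj_by G a ` conj_by G b ` H"
      unfolding image_image by (rule image_cong) (use that assms in \<open>auto simp: conj_by_comp\<close>)
    then show ?thesis using that by simp
  qed
qed

lemma subgroup_fixing:
  assumes L: "subgroup L G" and D: "D \<subseteq> carrier G"
  shows "subgroup {g \<in> L. \<forall>d\<in>D. conj_by G g d = d} G"
proof (rule subgroupI)
  let ?C = "{g \<in> L. \<forall>d\<in>D. conj_by G g d = d}"
  have LG: "g \<in> L \<Longrightarrow> g \<in> carrier G" for g using L subgroup.mem_carrier by metis
  show "?C \<subseteq> carrier G" using LG by blast
  have "\<one> \<in> ?C" using subgroup.one_closed[OF L] D by auto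
  then show "?C \<noteq> {}" by blast
  show "inv a \<in> ?C" if "a \<in> ?C" for a
  proof -
    have "conj_by G (inv a) d = d" if "d \<in> D" for d
    proof -
      have a: "a \<in> carrier G" "conj_by G a d = d" and "d \<in> carrier G"
        using \<open>a \<in> ?C\<close> LG D that by auto
      then show ?thesis using conj_by_inverse(1)[of a d] by metis
    qed
    then show ?thesis using that L by (simp add: subgroup.m_inv_closed)
  qed
  show "a \<otimes> b \<in> ?C" if "a \<in> ?C" "b \<in> ?C" for a b
    using that L LG D by (simp add: subgroup.m_closed conj_by_comp subset_iff)
qed

lemma subgroup_of_subgroup_iff:
  assumes "subgroup L G"
  shows "subgroup D (G\<lparr>carrier := L\<rparr>) \<longleftrightarrow> subgroup D G \<and> D \<subseteq> L"
  using assms incl_subgroup[of L D] subgroup_incl[of D L] subgroup.subset[of D "G\<lparr>carrier := L\<rparr>"]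
  by auto

lemma conj_by_of_subgroup:
  assumes "subgroup L G" "g \<in> L"
  shows "conj_by (G\<lparr>carrier := L\<rparr>) g x = conj_by G g x"
  using assms by (simp add: conj_by_def)

lemma fin_grp_subgroup:
  assumes "subgroup L G" shows "fin_grp (G\<lparr>carrier := L\<rparr>) p"
proof -
  interpret L: group "G\<lparr>carrier := L\<rparr>" by (rule subgroup_imp_group[OF assms])
  show ?thesis by unfold_locales (use assms prime_p in auto)
qed

lemma p_regular_of_subgroup:
  assumes "subgroup L G"
  shows "p_regular p (G\<lparr>carrier := L\<rparr>) x \<longleftrightarrow> p_regular p G x \<and> x \<in> L"
  using assms by (auto simp: p_regular_def nat_pow_consistent[symmetric] subgroup.mem_carrier)

lemma p_subgroup_of_subgroup:
  assumes "subgroup L G"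
  shows "p_subgroup p (G\<lparr>carrier := L\<rparr>) D \<longleftrightarrow> p_subgroup p G D \<and> D \<subseteq> L"
  using subgroup_of_subgroup_iff[OF assms] by (auto simp: p_subgroup_def)

lemma normal_iff_conj_by:
  "N \<lhd> G \<longleftrightarrow> subgroup N G \<and> (\<forall>g\<in>carrier G. \<forall>x\<in>N. conj_by G g x \<in> N)"
  by (auto simp: normal_inv_iff conj_by_def)

lemma normal_of_subgroup_iff:
  assumes "subgroup L G"
  shows "N \<lhd> G\<lparr>carrier := L\<rparr> \<longleftrightarrow> subgroup N G \<and> N \<subseteq> L \<and> (\<forall>g\<in>L. \<forall>x\<in>N. conj_by G g x \<in> N)"
proof -
  interpret L: fin_grp "G\<lparr>carrier := L\<rparr>" p by (rule fin_grp_subgroup[OF assms])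
  show ?thesis
    using conj_by_of_subgroup[OF assms] subgroup_of_subgroup_iff[OF assms]
    by (auto simp: L.normal_iff_conj_by)
qed

text \<open>Conjugation by \<open>g\<close> carries the centralizer of \<open>D\<close> to the
  centralizer of the conjugate of \<open>D\<close>, which is \<open>D\<close> again.\<close>

lemma normal_fixing:
  assumes L: "subgroup L G" and V: "V \<lhd> G\<lparr>carrier := L\<rparr>" and D: "D \<subseteq> carrier G"
    and inv: "\<And>g. g \<in> L \<Longrightarrow> conj_by G g ` D = D"
  shows "{g \<in> V. \<forall>d\<in>D. conj_by G g d = d} \<lhd> G\<lparr>carrier := L\<rparr>"
  unfolding normal_of_subgroup_iff[OF L]
proof (intro conjI ballI)
  have V': "subgroup V G" "V \<subseteq> L" "\<And>g x. g \<in> L \<Longrightarrow> x \<in> V \<Longrightarrow> conj_by G g x \<in> V"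
    using V by (auto simp: normal_of_subgroup_iff[OF L])
  show "subgroup {g \<in> V. \<forall>d\<in>D. conj_by G g d = d} G" by (rule subgroup_fixing[OF V'(1) D])
  show "{g \<in> V. \<forall>d\<in>D. conj_by G g d = d} \<subseteq> L" using V'(2) by blast
  fix g x assume g: "g \<in> L" and "x \<in> {g \<in> V. \<forall>d\<in>D. conj_by G g d = d}"
  then have x: "x \<in> V" "\<forall>d\<in>D. conj_by G x d = d" by auto
  have G: "g \<in> carrier G" "x \<in> carrier G"
    using subgroup.mem_carrier[OF L g] subgroup.mem_carrier[OF V'(1) x(1)] .
  have "conj_by G (conj_by G g x) d = d" if "d \<in> D" for d
  proof -
    have "d \<in> conj_by G g ` D" using inv[OF g] that by simp
    then obtain d' where d': "d' \<in> D" "d = conj_by G g d'" by blast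
    then show ?thesis using conj_by_conj_by[OF G, of d'] x(2) D by (metis subsetD)
  qed
  then show "conj_by G g x \<in> {g \<in> V. \<forall>d\<in>D. conj_by G g d = d}" using V'(3)[OF g x(1)] by simp
qed

lemma p_regular_conj_by:
  "p_regular p G x \<Longrightarrow> g \<in> carrier G \<Longrightarrow> p_regular p G (conj_by G g x)"
  unfolding p_regular_def using conj_by_pow conj_by_one(2) conj_by_closed by metis

lemma pow_card_subgroup:
  assumes "subgroup H G" "x \<in> H" shows "x [^] card H = \<one>"
proof -
  interpret H: group "G\<lparr>carrier := H\<rparr>" by (rule subgroup_imp_group[OF assms(1)])
  have "x [^]\<^bsub>G\<lparr>carrier := H\<rparr>\<^esub> order (G\<lparr>carrier := H\<rparr>) = \<one>\<^bsub>G\<lparr>carrier := H\<rparr>\<^esub>"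
    by (rule H.pow_order_eq_1) (simp_all add: assms)
  then show ?thesis by (simp add: order_def nat_pow_consistent[symmetric])
qed

lemma pow_coprime_eq_one:
  assumes "x \<in> carrier G" "x [^] (m::nat) = \<one>" "x [^] (n::nat) = \<one>" "coprime m n"
  shows "x = \<one>"
proof -
  have "ord x dvd m" "ord x dvd n" using assms pow_eq_id by auto
  then have "ord x dvd 1" using assms(4) coprime_common_divisor by blast
  then show ?thesis using assms(1) pow_ord_eq_1[of x] by simp
qed

text \<open>By Bezout \<open>x\<close> is a product of powers of \<open>x [^] m\<close> and
  \<open>x [^] n\<close>. In the applications one exponent is a power of \<open>p\<close>: this
  places \<open>p\<close>-elements in subgroups that contain their powers prime to \<open>p\<close>,
  and \<open>p\<close>-regular elements in normal subgroups of index \<open>p\<close>.\<close>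

lemma pow_coprime_mem:
  assumes H: "subgroup H G" and x: "x \<in> carrier G"
    and "x [^] (m::nat) \<in> H" "x [^] (n::nat) \<in> H" "coprime m n"
  shows "x \<in> H"
proof -
  obtain u v :: int where "u * int m + v * int n = 1"
    using assms(5) bezout_int[of "int m" "int n"] coprime_iff_gcd_eq_1 coprime_int_iff by metis
  then have "x = x [^] (int m * u + int n * v)"
    using x by (simp add: mult.commute)
  also have "\<dots> = (x [^] m) [^] u \<otimes> (x [^] n) [^] v"
    using x by (simp add: int_pow_mult int_pow_pow int_pow_int[symmetric])
  also have "\<dots> \<in> H"
    using assms(3,4) H by (meson subgroup_int_pow_closed subgroup.m_closed)
  finally show ?thesis .
qed

section \<open>Lagrange's theorem for indices and orders of factors\<close>

lemma lagrange': "subgroup H G \<Longrightarrow> card (rcosets H) * card H = card (carrier G)"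
  using lagrange by (simp add: order_def)

lemma factor_order_mult_card:
  assumes "subgroup H G" "subgroup K G" "K \<subseteq> H"
  shows "factor_order G H K * card K = card H"
proof -
  interpret L: fin_grp "G\<lparr>carrier := H\<rparr>" p by (rule fin_grp_subgroup[OF assms(1)])
  show ?thesis
    using L.lagrange'[of K] assms subgroup_of_subgroup_iff[OF assms(1)]
    by (simp add: factor_order_def order_def FactGroup_def)
qed

lemma factor_order_unique:
  assumes "subgroup H G" "subgroup K G" "K \<subseteq> H" "n * card K = card H"
  shows "factor_order G H K = n"
  using factor_order_mult_card[OF assms(1-3)] assms(4) subgroup_card_pos[OF assms(2)]
  by (metis mult_cancel2 less_irrefl)

lemma factor_order_dvd:
  assumes "subgroup H G" "subgroup K G" "K \<subseteq> H" shows "factor_order G H K dvd card H"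
  using factor_order_mult_card[OF assms] by (metis dvd_triv_left)

lemma lagrange_subgroups:
  assumes "subgroup H G" "subgroup L G" "H \<subseteq> L"
  shows "card H dvd card L"
  using factor_order_mult_card[OF assms(2,1,3)] by (metis dvd_triv_right)

lemma index_factor_order:
  assumes H: "subgroup H G" and K: "subgroup K G" "K \<subseteq> H"
  shows "card (rcosets K) = card (rcosets H) * factor_order G H K"
proof -
  have "card (rcosets K) * card K = card (rcosets H) * factor_order G H K * card K"
    using lagrange'[OF H] lagrange'[OF K(1)] factor_order_mult_card[OF H K] by (simp add: mult.assoc)
  then show ?thesis using subgroup_card_pos[OF K(1)] by simp
qed

lemma index_dvd_index:
  assumes "subgroup H G" "subgroup K G" "K \<subseteq> H"
  shows "card (rcosets H) dvd card (rcosets K)"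
  using index_factor_order[OF assms] by simp

lemma set_mult_subgroup:
  assumes "N \<lhd> G" "subgroup H G" shows "subgroup (N <#> H) G"
proof -
  interpret second_isomorphism_grp N G H
    using assms by (simp add: second_isomorphism_grp_def second_isomorphism_grp_axioms_def)
  show ?thesis by (rule normal_set_mult_subgroup)
qed

lemma subset_set_mult_left:
  "subgroup H G \<Longrightarrow> N \<subseteq> carrier G \<Longrightarrow> N \<subseteq> N <#> H"
  using subgroup.one_closed by (force simp: set_mult_def)

lemma subset_set_mult_right:
  "subgroup N G \<Longrightarrow> H \<subseteq> carrier G \<Longrightarrow> H \<subseteq> N <#> H"
  using subgroup.one_closed by (force simp: set_mult_def)

lemma set_mult_in_subgroup:
  "subgroup L G \<Longrightarrow> A \<subseteq> L \<Longrightarrow> B \<subseteq> L \<Longrightarrow> A <#> B \<subseteq> L"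
  by (auto simp: set_mult_def subgroup.m_closed subset_iff)

lemma p_dvd_factor_order:
  assumes S: "p_subgroup p G S" and U: "subgroup U G" "U \<subset> S"
  shows "p dvd factor_order G S U"
proof -
  have S': "subgroup S G" using S by (simp add: p_subgroup_def)
  obtain k where k: "card S = p ^ k" using S by (auto simp: p_subgroup_def)
  have m: "factor_order G S U * card U = card S" using factor_order_mult_card[OF S' U(1)] U(2) by blast
  then have "factor_order G S U dvd p ^ k" using k by (metis dvd_triv_left)
  then obtain j where j: "factor_order G S U = p ^ j" using divides_primepow_nat[OF prime_p] by blast
  have "card U < card S" using U(2) S' by (simp add: psubset_card_mono)
  then have "j \<noteq> 0" using m j by (cases j) auto
  then show ?thesis using j by simp
qed

text \<open>As \<open>x [^] p\<close> lies in \<open>K\<close>, every element of \<open>H\<close>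
  has the form \<open>k \<otimes> x [^] r\<close> with \<open>k\<close> in \<open>K\<close> and
  \<open>r < p\<close>. So the factor has order at most \<open>p\<close>, and it is a multiple of
  \<open>p\<close>.\<close>

lemma factor_order_cyclic:
  assumes sH: "subgroup H G" and sK: "subgroup K G" and KH: "K \<subseteq> H"
    and x: "x \<in> H" and xp: "x [^] p \<in> K" and gen: "H = K <#> generate G {x}"
    and dv: "p dvd factor_order G H K"
  shows "factor_order G H K = p"
proof -
  have xG: "x \<in> carrier G" using x sH subgroup.mem_carrier by metis
  have KG: "k \<in> K \<Longrightarrow> k \<in> carrier G" for k using sK subgroup.mem_carrier by metis
  have "H \<subseteq> (\<lambda>(k, r). k \<otimes> x [^] r) ` (K \<times> {..<p})"
  proof
    fix h assume "h \<in> H"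
    then obtain k y where ky: "k \<in> K" "y \<in> generate G {x}" "h = k \<otimes> y" using gen by (auto simp: set_mult_def)
    then obtain i where i: "y = x [^] (i::nat)"
      using generate_pow_on_finite_carrier[OF fin xG] by auto
    have "y = (x [^] p) [^] (i div p) \<otimes> x [^] (i mod p)"
      using xG by (simp add: i nat_pow_pow nat_pow_mult)
    then have "h = (k \<otimes> (x [^] p) [^] (i div p)) \<otimes> x [^] (i mod p)"
      using ky KG xG by (simp add: m_assoc)
    moreover have "k \<otimes> (x [^] p) [^] (i div p) \<in> K"
      using ky subgroup_nat_pow[OF sK xp] sK by (simp add: subgroup.m_closed)
    moreover have "i mod p \<in> {..<p}" using p_gt_1 by simp
    ultimately show "h \<in> (\<lambda>(k, r). k \<otimes> x [^] r) ` (K \<times> {..<p})" by (force intro: rev_image_eqI)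
  qed
  then have "card H \<le> card ((\<lambda>(k, r). k \<otimes> x [^] r) ` (K \<times> {..<p}))"
    using sK by (intro card_mono) auto
  also have "\<dots> \<le> card (K \<times> {..<p})" using sK by (intro card_image_le) simp
  finally have "card H \<le> p * card K" by (simp add: card_cartesian_product mult.commute)
  moreover have fo: "factor_order G H K * card K = card H" by (rule factor_order_mult_card[OF sH sK KH])
  ultimately have "factor_order G H K \<le> p" using subgroup_card_pos[OF sK] by (metis mult_le_cancel2)
  moreover have "0 < factor_order G H K" using fo subgroup_card_pos[OF sH] by (metis mult_0 not_gr0)
  ultimately show ?thesis using dv by (meson dvd_imp_le le_antisym)
qed

lemma p_subgroup_pow:
  assumes "p_subgroup p G D" "x \<in> D" shows "\<exists>k. x [^] (p ^ k) = \<one>"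
  using assms pow_card_subgroup by (metis p_subgroup_def)

lemma p_subgroup_p_regular:
  assumes "p_subgroup p G D" "x \<in> D" "p_regular p G x" shows "x = \<one>"
proof -
  obtain k where k: "x [^] (p ^ k) = \<one>" using p_subgroup_pow assms by blast
  obtain n where n: "x [^] (n::nat) = \<one>" "coprime n p" using assms by (auto simp: p_regular_def)
  show ?thesis
    using pow_coprime_eq_one[OF _ n(1) k] n(2) assms(3) by (simp add: p_regular_def)
qed

lemma p_subgroup_subset:
  assumes "p_subgroup p G D" "subgroup E G" "E \<subseteq> D" shows "p_subgroup p G E"
  using assms lagrange_subgroups[of E D] divides_primepow_nat[OF prime_p]
  by (auto simp: p_subgroup_def)

lemma p_subgroup_conj_by:
  "p_subgroup p G D \<Longrightarrow> g \<in> carrier G \<Longrightarrow> p_subgroup p G (conj_by G g ` D)"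
  by (auto simp: p_subgroup_def subgroup_conj_by_image)

lemma p_regular_of_order:
  assumes "subgroup H G" "coprime (card H) p" "x \<in> H" shows "p_regular p G x"
  using assms pow_card_subgroup by (auto simp: p_regular_def subgroup.mem_carrier)

lemma sylow_subgroup_exists: "\<exists>S. sylow_subgroup p G S"
proof -
  have "0 < order G" using order_gt_0_iff_finite by simp
  moreover have "\<not> is_unit p" using p_gt_1 by simp
  ultimately obtain m where m: "order G = p ^ multiplicity p (order G) * m" "\<not> p dvd m"
    using multiplicity_decompose'[of "order G" p] by blast
  obtain S where S: "subgroup S G" "card S = p ^ multiplicity p (order G)"
    using sylow_thm[OF prime_p group_axioms m(1) fin] by blast
  have "card (rcosets S) = m"
    using lagrange[OF S(1)] S(2) m(1) p_gt_1
    by (metis mult.commute mult_cancel2 not_one_less_zero power_not_zero)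
  then show ?thesis using S m(2) by (auto simp: sylow_subgroup_def p_subgroup_def)
qed

text \<open>For a prime \<open>q \<noteq> p\<close> the Sylow \<open>q\<close>-subgroups consist of \<open>p\<close>-regular elements.\<close>

lemma subgroup_contains_p_regular_imp_full:
  assumes T: "subgroup T G" and reg: "\<And>x. p_regular p G x \<Longrightarrow> x \<in> T"
    and idx: "\<not> p dvd card (rcosets T)"
  shows "T = carrier G"
proof -
  have "card (rcosets T) = 1"
  proof (rule ccontr)
    assume "card (rcosets T) \<noteq> 1"
    then obtain q where q: "Factorial_Ring.prime q" "q dvd card (rcosets T)"
      using prime_factor_nat by blast
    then have "q \<noteq> p" using idx by blast
    interpret Q: fin_grp G q by unfold_locales (use q in auto)
    obtain S where S: "sylow_subgroup q G S" using Q.sylow_subgroup_exists by blast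
    then have S': "subgroup S G" "\<not> q dvd card (rcosets S)" and "\<exists>k. card S = q ^ k"
      by (auto simp: sylow_subgroup_def p_subgroup_def)
    then have "coprime (card S) p"
      using \<open>q \<noteq> p\<close> q(1) prime_p by (metis coprime_power_left_iff primes_coprime)
    then have "S \<subseteq> T" using reg p_regular_of_order S' by blast
    then have "card (rcosets T) dvd card (rcosets S)" by (rule index_dvd_index[OF T S'(1)])
    then show False using q(2) S'(2) dvd_trans by blast
  qed
  then have "card T = card (carrier G)" using lagrange'[OF T] by simp
  then show ?thesis by (simp add: T card_subset_eq subgroup.subset)
qed

end

section \<open>Orbit counting and Sylow subgroups\<close>

context fin_grp
begin

text \<open>As in \<open>subgroup_contains_p_regular_imp_full\<close>, an orbit of length prime to \<open>p\<close> is a point.\<close>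

lemma card_cong_card_fixed_points:
  assumes Y: "finite Y"
    and cl: "\<And>g x. g \<in> carrier G \<Longrightarrow> x \<in> Y \<Longrightarrow> act g x \<in> Y"
    and one: "\<And>x. x \<in> Y \<Longrightarrow> act \<one> x = x"
    and comp: "\<And>g h x. g \<in> carrier G \<Longrightarrow> h \<in> carrier G \<Longrightarrow> x \<in> Y \<Longrightarrow> act (g \<otimes> h) x = act g (act h x)"
    and reg: "\<And>g x. p_regular p G g \<Longrightarrow> x \<in> Y \<Longrightarrow> act g x = x"
  shows "[card Y = card {x \<in> Y. \<forall>g\<in>carrier G. act g x = x}] (mod p)"
proof -
  \<comment> \<open>The library's \<open>group_action\<close> wants bijections in
    \<open>Bij Y\<close>, which are extensional; hence the restriction to \<open>Y\<close>.\<close>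
  define \<phi> where "\<phi> = (\<lambda>g. restrict (act g) Y)"
  have bij: "bij_betw (act g) Y Y" if g: "g \<in> carrier G" for g
  proof (rule bij_betw_byWitness[where f' = "act (inv g)"])
    have ig: "inv g \<in> carrier G" using g by simp
    show "\<forall>a\<in>Y. act (inv g) (act g a) = a"
    proof
      fix a assume "a \<in> Y"
      then show "act (inv g) (act g a) = a" using comp[OF ig g, of a] one[of a] l_inv[OF g] by metis
    qed
    show "\<forall>a\<in>Y. act g (act (inv g) a) = a"
    proof
      fix a assume "a \<in> Y"
      then show "act g (act (inv g) a) = a" using comp[OF g ig, of a] one[of a] r_inv[OF g] by metis
    qed
    show "act g ` Y \<subseteq> Y" "act (inv g) ` Y \<subseteq> Y" using cl[OF g] cl[OF ig] by blast+
  qed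
  have "group_action G Y \<phi>"
  proof -
    have "\<phi> g \<in> Bij Y" if "g \<in> carrier G" for g
    proof -
      have "bij_betw (\<phi> g) Y Y = bij_betw (act g) Y Y"
        by (rule bij_betw_cong) (simp add: \<phi>_def)
      then show ?thesis using bij[OF that] by (simp add: Bij_def \<phi>_def)
    qed
    moreover have "\<phi> (g \<otimes> h) = compose Y (\<phi> g) (\<phi> h)" if "g \<in> carrier G" "h \<in> carrier G" for g h
      using that cl comp by (auto simp: \<phi>_def compose_def)
    ultimately have "\<phi> \<in> hom G (BijGroup Y)"
      by (auto simp: hom_def BijGroup_def)
    then show ?thesis
      by (simp add: group_action_def group_hom_def group_hom_axioms_def group_BijGroup)
  qed
  then interpret group_action G Y \<phi> .
  define F where "F = {x \<in> Y. \<forall>g\<in>carrier G. act g x = x}"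
  have orb: "[card W = card (W \<inter> F)] (mod p)" if W: "W \<in> orbits G Y \<phi>" for W
  proof -
    obtain x where x: "x \<in> Y" "W = orbit G \<phi> x" using W by (auto simp: orbits_def)
    then have Oeq: "W = (\<lambda>g. act g x) ` carrier G" by (auto simp: orbit_def \<phi>_def)
    have Osub: "W \<subseteq> Y" using Oeq x(1) cl by auto
    have stab: "subgroup (stabilizer G \<phi> x) G" by (rule stabilizer_subgroup[OF x(1)])
    have os: "card W * card (stabilizer G \<phi> x) = card (carrier G)"
      using orbit_stabilizer_theorem[OF x(1)] x(2) by (simp add: order_def)
    then have idx: "card W = card (rcosets (stabilizer G \<phi> x))"
      using lagrange'[OF stab] subgroup_card_pos[OF stab] by (metis mult_cancel2 less_irrefl)
    show ?thesis
    proof (cases "p dvd card W")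
      case True
      have "W \<inter> F = {}"
      proof (rule ccontr)
        assume "W \<inter> F \<noteq> {}"
        then obtain y where y: "y \<in> W" "y \<in> F" by blast
        then obtain g where g: "g \<in> carrier G" "y = act g x" using Oeq by blast
        then have "x = act (inv g) y" using x(1) one comp[of "inv g" g x] by simp
        then have "x = y" using y g by (auto simp: F_def)
        then have "W = {x}" using Oeq y(2) x(1) by (auto simp: F_def image_iff)
        then show False using True p_gt_1 by simp
      qed
      then show ?thesis using True by (simp add: cong_def)
    next
      case False
      have "stabilizer G \<phi> x = carrier G"
      proof (rule subgroup_contains_p_regular_imp_full[OF stab])
        show "g \<in> stabilizer G \<phi> x" if "p_regular p G g" for g
          using that reg x(1) by (simp add: stabilizer_def \<phi>_def p_regular_def)
      qed (use False idx in simp)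
      then have fixed: "\<forall>g\<in>carrier G. act g x = x"
        using x(1) by (force simp: stabilizer_def \<phi>_def)
      then have "W = {x}" using Oeq by (auto simp: image_iff)
      then show ?thesis using fixed x(1) by (simp add: F_def)
    qed
  qed
  have fin': "finite (orbits G Y \<phi>)"
    using Y by (simp add: orbits_def orbit_def \<phi>_def setcompr_eq_image)
  have fW: "finite W" "W \<subseteq> Y" if "W \<in> orbits G Y \<phi>" for W
    using that orbits_coverture Y by (auto intro: finite_subset)
  have "card Y = (\<Sum>W\<in>orbits G Y \<phi>. card W)"
    using disjoint_sum[OF Y, of "\<lambda>_. 1::nat"] by simp
  also have "[\<dots> = (\<Sum>W\<in>orbits G Y \<phi>. card (W \<inter> F))] (mod p)"
    by (rule cong_sum) (rule orb)
  also have "(\<Sum>W\<in>orbits G Y \<phi>. card (W \<inter> F)) = (\<Sum>W\<in>orbits G Y \<phi>. \<Sum>x\<in>W. if x \<in> F then 1 else 0)"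
    using fW by (intro sum.cong) (simp_all add: sum.If_cases)
  also have "\<dots> = (\<Sum>x\<in>Y. if x \<in> F then 1 else 0)"
    by (rule disjoint_sum[OF Y])
  also have "\<dots> = card F"
    using Y by (simp add: sum.If_cases F_def Int_def)
  finally show ?thesis by (simp add: F_def)
qed

section \<open>Translation of cosets and Sylow's theorems\<close>

lemma rcosets_act:
  assumes T: "subgroup T G" and t: "t \<in> carrier G" and g: "g \<in> carrier G"
  shows "(T #> g) #> t = T #> (g \<otimes> t)"
  by (rule coset_mult_assoc[OF subgroup.subset[OF T] g t])

text \<open>Only the identity of a \<open>p\<close>-group is \<open>p\<close>-regular, so the
  fixed-point congruence applies to \<open>Q\<close> acting on the cosets of \<open>T\<close>. Both
  the conjugacy of Sylow subgroups and the growth of normalizers come from it.\<close>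

lemma p_subgroup_fixes_coset:
  assumes Q: "p_subgroup p G Q" and T: "subgroup T G"
  shows "[card (rcosets T) = card {C \<in> rcosets T. \<forall>q\<in>Q. C #> q = C}] (mod p)"
proof -
  have Q': "subgroup Q G" using Q by (simp add: p_subgroup_def)
  interpret Q: fin_grp "G\<lparr>carrier := Q\<rparr>" p by (rule fin_grp_subgroup[OF Q'])
  have Qc: "q \<in> Q \<Longrightarrow> q \<in> carrier G" for q using Q' subgroup.mem_carrier by metis
  have cs: "C \<in> rcosets T \<Longrightarrow> C \<subseteq> carrier G" for C using T subgroup.rcosets_carrier[OF T is_group] by blast
  have *: "C #> inv q \<in> rcosets T" if "q \<in> Q" "C \<in> rcosets T" for q C
    using that Qc T by (auto simp: RCOSETS_def rcosets_act)
  have iv: "inv\<^bsub>G\<lparr>carrier := Q\<rparr>\<^esub> q = inv q" if "q \<in> Q" for q using that Q' by simp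
  \<comment> \<open>Right translation is a right action; translating by \<open>inv q\<close> turns
    it into the left action that the counting lemma expects, with the same fixed cosets.\<close>
  have "[card (rcosets T) = card {C \<in> rcosets T. \<forall>q\<in>carrier (G\<lparr>carrier := Q\<rparr>). C #> inv q = C}] (mod p)"
  proof (rule Q.card_cong_card_fixed_points[where act = "\<lambda>q C. C #> inv q"])
    show "finite (rcosets T)" by (simp add: RCOSETS_def)
    show "C #> inv q = C" if "p_regular p (G\<lparr>carrier := Q\<rparr>) q" "C \<in> rcosets T" for q C
    proof -
      have "q = \<one>" using that(1) p_subgroup_p_regular[OF Q] p_regular_of_subgroup[OF Q'] by blast
      then show ?thesis using cs[OF that(2)] by simp
    qed
    show "C #> inv (g \<otimes>\<^bsub>G\<lparr>carrier := Q\<rparr>\<^esub> h) = C #> inv h #> inv g"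
      if "g \<in> carrier (G\<lparr>carrier := Q\<rparr>)" "h \<in> carrier (G\<lparr>carrier := Q\<rparr>)" "C \<in> rcosets T" for g h C
      using that Qc cs[OF that(3)] by (simp add: coset_mult_assoc inv_mult_group)
  qed (use * cs in auto)
  moreover have "(\<forall>q\<in>Q. C #> inv q = C) \<longleftrightarrow> (\<forall>q\<in>Q. C #> q = C)" for C
    using Q' subgroup.m_inv_closed[OF Q'] Qc inv_inv by metis
  ultimately show ?thesis by simp
qed

lemma coset_fixed_iff:
  assumes T: "subgroup T G" and g: "g \<in> carrier G" and q: "q \<in> carrier G"
  shows "(T #> g) #> q = T #> g \<longleftrightarrow> conj_by G g q \<in> T"
proof -
  have "(T #> g) #> q = T #> g \<longleftrightarrow> g \<otimes> q \<in> T #> g"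
    using assms by (metis m_closed rcosets_act repr_independence rcos_self)
  also have "\<dots> \<longleftrightarrow> conj_by G g q \<in> T"
    using subgroup.rcos_module[OF T is_group g, of "g \<otimes> q"] g q by (simp add: conj_by_def)
  finally show ?thesis .
qed

text \<open>The number of cosets of \<open>S\<close> is prime to \<open>p\<close>, so
  \<open>Q\<close> fixes one of them, and a fixed coset \<open>S #> g\<close> is one for which the
  conjugate of \<open>Q\<close> by \<open>g\<close> lies in \<open>S\<close>.\<close>

lemma p_subgroup_conj_in_sylow:
  assumes Q: "p_subgroup p G Q" and S: "sylow_subgroup p G S"
  shows "\<exists>g\<in>carrier G. conj_by G g ` Q \<subseteq> S"
proof -
  have S': "subgroup S G" "\<not> p dvd card (rcosets S)"
    using S by (auto simp: sylow_subgroup_def p_subgroup_def)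
  have Q': "subgroup Q G" using Q by (simp add: p_subgroup_def)
  have "\<not> p dvd card {C \<in> rcosets S. \<forall>q\<in>Q. C #> q = C}"
    using p_subgroup_fixes_coset[OF Q S'(1)] S'(2) cong_dvd_iff by blast
  then have "{C \<in> rcosets S. \<forall>q\<in>Q. C #> q = C} \<noteq> {}" by (metis card.empty dvd_0_right)
  then obtain g where g: "g \<in> carrier G" "\<forall>q\<in>Q. (S #> g) #> q = S #> g"
    by (auto simp: RCOSETS_def)
  have "conj_by G g q \<in> S" if "q \<in> Q" for q
    using coset_fixed_iff[OF S'(1) g(1) subgroup.mem_carrier[OF Q' that]] g(2) that by blast
  then show ?thesis using g(1) by blast
qed

lemma sylow_subgroup_card_eq:
  assumes "sylow_subgroup p G S" "sylow_subgroup p G T"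
  shows "card S = card T"
proof -
  have le: "card A \<le> card B" if A: "sylow_subgroup p G A" and B: "sylow_subgroup p G B" for A B
  proof -
    have A': "p_subgroup p G A" "subgroup A G" and B': "subgroup B G"
      using A B by (auto simp: sylow_subgroup_def p_subgroup_def)
    obtain g where g: "g \<in> carrier G" "conj_by G g ` A \<subseteq> B"
      using p_subgroup_conj_in_sylow[OF A'(1) B] by blast
    then show ?thesis using card_mono[OF subgroup_finite[OF B'] g(2)] subgroup_conj_by_image[OF g(1) A'(2)] by simp
  qed
  show ?thesis using le assms by (meson le_antisym)
qed

lemma sylow_subgroups_conj:
  assumes "sylow_subgroup p G S" "sylow_subgroup p G T"
  shows "\<exists>g\<in>carrier G. T = conj_by G g ` S"
proof -
  have S': "p_subgroup p G S" "subgroup S G" and T': "subgroup T G"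
    using assms by (auto simp: sylow_subgroup_def p_subgroup_def)
  obtain g where g: "g \<in> carrier G" "conj_by G g ` S \<subseteq> T"
    using p_subgroup_conj_in_sylow[OF S'(1) assms(2)] by blast
  then show ?thesis
    using card_subset_eq[OF subgroup_finite[OF T'] g(2)] sylow_subgroup_card_eq[OF assms]
      subgroup_conj_by_image[OF g(1) S'(2)] by auto
qed

lemma sylow_subgroup_conj_by:
  assumes "sylow_subgroup p G S" "g \<in> carrier G"
  shows "sylow_subgroup p G (conj_by G g ` S)"
proof -
  have S: "subgroup S G" using assms by (auto simp: sylow_subgroup_def p_subgroup_def)
  have "card (rcosets (conj_by G g ` S)) = card (rcosets S)"
    using lagrange'[OF S] lagrange'[OF subgroup_conj_by_image(1)[OF assms(2) S]]
      subgroup_card_pos[OF S] subgroup_conj_by_image(2)[OF assms(2) S]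
    by (metis less_irrefl mult_cancel2)
  then show ?thesis using assms by (simp add: sylow_subgroup_def p_subgroup_conj_by)
qed

lemma p_subgroup_in_sylow:
  assumes Q: "p_subgroup p G Q"
  shows "\<exists>S. sylow_subgroup p G S \<and> Q \<subseteq> S"
proof -
  obtain S where S: "sylow_subgroup p G S" using sylow_subgroup_exists by blast
  obtain g where g: "g \<in> carrier G" "conj_by G g ` Q \<subseteq> S"
    using p_subgroup_conj_in_sylow[OF Q S] by blast
  have Qs: "Q \<subseteq> carrier G" using Q by (simp add: p_subgroup_def subgroup.subset)
  have "Q \<subseteq> conj_by G (inv g) ` S"
  proof
    fix q assume "q \<in> Q"
    then have "q = conj_by G (inv g) (conj_by G g q)" "conj_by G g q \<in> S" using g Qs by auto
    then show "q \<in> conj_by G (inv g) ` S" by blast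
  qed
  then show ?thesis using sylow_subgroup_conj_by[OF S, of "inv g"] g(1) by blast
qed

text \<open>Let \<open>T\<close> act on its own cosets in \<open>S\<close>. Their number is
  divisible by \<open>p\<close>, and so is the number of fixed ones; \<open>T\<close> is fixed,
  hence another coset \<open>T #> x\<close> is fixed too, and this means that \<open>x\<close>
  normalizes \<open>T\<close>.\<close>

lemma p_subgroup_normalizer_grows:
  assumes S: "p_subgroup p G S" and T: "subgroup T G" "T \<subset> S"
  shows "\<exists>x\<in>S - T. conj_by G x ` T = T"
proof -
  have S': "subgroup S G" using S by (simp add: p_subgroup_def)
  interpret L: fin_grp "G\<lparr>carrier := S\<rparr>" p by (rule fin_grp_subgroup[OF S'])
  let ?L = "G\<lparr>carrier := S\<rparr>"
  have TL: "subgroup T ?L" using T S' by (simp add: subgroup_of_subgroup_iff)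
  have TpL: "p_subgroup p ?L T" using S T p_subgroup_subset p_subgroup_of_subgroup[OF S'] by blast
  let ?I = "rcosets\<^bsub>?L\<^esub> T"
  have "p dvd card ?I"
    using p_dvd_factor_order[OF S T] by (simp add: factor_order_def order_def FactGroup_def)
  then have dv: "p dvd card {C \<in> ?I. \<forall>q\<in>T. C #>\<^bsub>?L\<^esub> q = C}"
    using L.p_subgroup_fixes_coset[OF TpL TL] cong_dvd_iff by blast
  have mem: "T \<in> {C \<in> ?I. \<forall>q\<in>T. C #>\<^bsub>?L\<^esub> q = C}"
    using L.coset_join2[of _ T] TL T(2) subgroup.subgroup_in_rcosets[OF TL L.is_group]
    by (auto simp: subgroup.mem_carrier[OF TL])
  have "\<not> {C \<in> ?I. \<forall>q\<in>T. C #>\<^bsub>?L\<^esub> q = C} \<subseteq> {T}"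
  proof
    assume "{C \<in> ?I. \<forall>q\<in>T. C #>\<^bsub>?L\<^esub> q = C} \<subseteq> {T}"
    then have "{C \<in> ?I. \<forall>q\<in>T. C #>\<^bsub>?L\<^esub> q = C} = {T}" using mem by blast
    then show False using dv p_gt_1 by simp
  qed
  then obtain C where C: "C \<in> ?I" "\<forall>q\<in>T. C #>\<^bsub>?L\<^esub> q = C" "C \<noteq> T" by blast
  then obtain x where x: "x \<in> S" "C = T #>\<^bsub>?L\<^esub> x" by (auto simp: RCOSETS_def)
  have "x \<notin> T" using C(3) x L.coset_join2[OF _ TL] by auto
  moreover have "conj_by G x ` T \<subseteq> T"
  proof
    fix y assume "y \<in> conj_by G x ` T"
    then obtain q where q: "q \<in> T" "y = conj_by G x q" by blast
    then have "conj_by ?L x q \<in> T"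
      using L.coset_fixed_iff[OF TL, of x q] C(2) x T(2) by auto
    then show "y \<in> T" using q x conj_by_of_subgroup[OF S'] by simp
  qed
  then have "conj_by G x ` T = T"
    using subgroup_conj_by_image(2)[OF _ T(1), of x] x(1) S' T(1)
    by (simp add: card_subset_eq subgroup.mem_carrier)
  ultimately show ?thesis using x(1) by blast
qed

end

section \<open>Coprime action on \<open>p\<close>-groups\<close>

text \<open>Exponent 2 would be too small: an automorphism of order 3 of the quaternion group of
  order 8 fixes the only involution without being trivial. \<open>p_dvd_triangular\<close> shows
  where the value 4 enters the proof.\<close>

definition p_exponent :: "nat \<Rightarrow> nat" where
  "p_exponent p = (if p = 2 then 4 else p)"

lemma (in group) prime_order_imp_comm_group:
  assumes "Factorial_Ring.prime (order G)"
  shows "comm_group G"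
proof -
  have "1 < order G" using assms prime_gt_1_nat by blast
  then have fin: "finite (carrier G)" and "carrier G \<noteq> {\<one>}"
    by (auto simp: order_def intro: card_ge_0_finite)
  then obtain x where x: "x \<in> carrier G" "x \<noteq> \<one>" using one_closed by blast
  have "ord x \<noteq> 1" using x ord_eq_1 by blast
  then have "ord x = order G"
    using assms ord_dvd_group_order[OF x(1)] prime_nat_iff by blast
  then have "card (generate G {x}) = card (carrier G)"
    using generate_pow_card[OF x(1)] by (simp add: order_def)
  then have "generate G {x} = carrier G"
    using fin x(1) by (intro card_subset_eq) (simp_all add: generate_incl)
  then have "\<exists>i::int. y = x [^] i" if "y \<in> carrier G" for y
    using that generate_pow[OF x(1)] by auto
  then show ?thesis
    by (intro group_comm_groupI) (metis add.commute int_pow_mult x(1))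
qed

context fin_grp
begin

lemma normal_index_p:
  assumes U: "U \<lhd> G" and idx: "card (carrier G) = p * card U"
  shows "order (G Mod U) = p" "comm_group (G Mod U)" "x \<in> carrier G \<Longrightarrow> x [^] p \<in> U"
    and "x \<in> carrier G \<Longrightarrow> y \<in> carrier G \<Longrightarrow> conj_by G x y \<otimes> inv y \<in> U"
proof -
  interpret U: normal U G by (rule U)
  have Us: "subgroup U G" by (rule U.is_subgroup)
  interpret Q: group "G Mod U" by (rule U.factorgroup_is_group)
  have "card (rcosets U) * card U = p * card U" using lagrange'[OF Us] idx by simp
  then show o: "order (G Mod U) = p"
    using subgroup_card_pos[OF Us] by (simp add: order_def FactGroup_def)
  then show cm: "comm_group (G Mod U)" using Q.prime_order_imp_comm_group prime_p by simp
  then interpret Q: comm_group "G Mod U" .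
  have mem: "U #> x \<in> carrier (G Mod U)" if "x \<in> carrier G" for x
    using that by (simp add: carrier_FactGroup)
  show "x [^] p \<in> U" if x: "x \<in> carrier G"
  proof -
    have "(U #> x) [^]\<^bsub>G Mod U\<^esub> p = U" using Q.pow_order_eq_1[OF mem[OF x]] o by simp
    then have "U #> (x [^] p) = U" using x by (simp add: U.FactGroup_pow)
    then show ?thesis using x Us by (metis coset_join1 nat_pow_closed subgroup.subset)
  qed
  show "conj_by G x y \<otimes> inv y \<in> U" if x: "x \<in> carrier G" and y: "y \<in> carrier G"
  proof -
    have "U #> (x \<otimes> y) = U #> (y \<otimes> x)"
      using Q.m_comm[OF mem[OF x] mem[OF y]] x y by (simp add: U.rcos_sum)
    then have "x \<otimes> y \<in> U #> (y \<otimes> x)" using x y Us by (metis m_closed rcos_self)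
    then have "x \<otimes> y \<otimes> inv (y \<otimes> x) \<in> U"
      using subgroup.rcos_module[OF Us is_group, of "y \<otimes> x" "x \<otimes> y"] x y by simp
    then show ?thesis using x y by (simp add: conj_by_def grp_simps)
  qed
qed

text \<open>Take \<open>U\<close> maximal among the proper subgroups of \<open>S\<close> above
  \<open>T\<close>. Its normalizer in \<open>S\<close> is strictly larger, hence is
  \<open>S\<close>. An element \<open>y\<close> outside \<open>U\<close> with \<open>y [^] p\<close>
  in \<open>U\<close> generates \<open>S\<close> together with \<open>U\<close>, so the index is
  \<open>p\<close>.\<close>

lemma p_subgroup_maximal:
  assumes S: "p_subgroup p G S" and T: "subgroup T G" "T \<subset> S"
  shows "\<exists>U. U \<lhd> G\<lparr>carrier := S\<rparr> \<and> T \<subseteq> U \<and> card S = p * card U"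
proof -
  have S': "subgroup S G" using S by (simp add: p_subgroup_def)
  define F where "F = {U. subgroup U G \<and> T \<subseteq> U \<and> U \<subset> S}"
  have "F \<subseteq> Pow S" by (auto simp: F_def)
  then have "finite F" using subgroup_finite[OF S'] finite_subset by (metis finite_Pow_iff)
  moreover have "T \<in> F" using T by (simp add: F_def)
  ultimately have "\<exists>U\<in>F. T \<subseteq> U \<and> (\<forall>V\<in>F. U \<subseteq> V \<longrightarrow> U = V)"
    by (rule finite_has_maximal2)
  then obtain U where U: "U \<in> F" and max: "\<forall>V\<in>F. U \<subseteq> V \<longrightarrow> U = V" by blast
  have U': "subgroup U G" "T \<subseteq> U" "U \<subset> S" using U by (auto simp: F_def)
  have Uc: "U \<subseteq> carrier G" using U' subgroup.subset by blast
  have SG: "s \<in> S \<Longrightarrow> s \<in> carrier G" for s using S' subgroup.mem_carrier by metis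
  have full: "V = S" if "subgroup V G" "U \<subset> V" "V \<subseteq> S" for V
  proof (rule ccontr)
    assume "V \<noteq> S"
    then have "V \<in> F" using that U' by (auto simp: F_def)
    then show False using max that by blast
  qed
  obtain x where x: "x \<in> S - U" "conj_by G x ` U = U"
    using p_subgroup_normalizer_grows[OF S U'(1,3)] by blast
  define N where "N = S \<inter> {g \<in> carrier G. conj_by G g ` U = U}"
  have "subgroup N G"
    unfolding N_def by (rule subgroups_Inter_pair[OF S' subgroup_normalizer[OF Uc]])
  moreover have "U \<subset> N"
  proof -
    have "U \<subseteq> N" unfolding N_def using U'(3) Uc conj_by_self_image[OF U'(1)] by blast
    moreover have "x \<in> N - U" using x SG by (simp add: N_def)
    ultimately show ?thesis by blast
  qed
  ultimately have "N = S" using full by (auto simp: N_def)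
  then have inv: "conj_by G s u \<in> U" if "s \<in> S" "u \<in> U" for s u
    using that by (auto simp: N_def)
  then have normU: "U \<lhd> G\<lparr>carrier := S\<rparr>"
    using normal_of_subgroup_iff[OF S'] U' by auto
  interpret L: fin_grp "G\<lparr>carrier := S\<rparr>" p by (rule fin_grp_subgroup[OF S'])
  \<comment> \<open>Taking \<open>p\<close>-th powers repeatedly leads from \<open>x\<close> to the
    identity, so the sequence enters \<open>U\<close> at some point; the last element before that is
    the required \<open>y\<close>.\<close>
  have "\<exists>y\<in>S - U. y [^] p \<in> U"
  proof (rule ccontr)
    assume "\<not> ?thesis"
    then have step: "y [^] p \<in> S - U" if "y \<in> S - U" for y
      using that subgroup_nat_pow[OF S'] by blast
    have "x [^] (p ^ n) \<in> S - U" for n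
    proof (induction n)
      case (Suc n)
      then show ?case using step[OF Suc] x(1) SG by (simp add: nat_pow_pow mult.commute)
    qed (use x(1) SG in simp)
    moreover obtain k where "x [^] (p ^ k) = \<one>" using p_subgroup_pow[OF S] x(1) by blast
    ultimately show False using subgroup.one_closed[OF U'(1)] by (metis DiffD2)
  qed
  then obtain y where y: "y \<in> S" "y \<notin> U" "y [^] p \<in> U" by blast
  have gen: "subgroup (generate G {y}) G" "generate G {y} \<subseteq> S" "y \<in> generate G {y}"
    using generate_is_subgroup[of "{y}"] generate_subgroup_incl[of "{y}" S] S' y(1) SG
    by (auto intro: generate.incl)
  have "subgroup (U <#>\<^bsub>G\<lparr>carrier := S\<rparr>\<^esub> generate G {y}) (G\<lparr>carrier := S\<rparr>)"
    by (rule L.set_mult_subgroup[OF normU]) (use gen in \<open>simp add: subgroup_of_subgroup_iff[OF S']\<close>)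
  then have V: "subgroup (U <#> generate G {y}) G" "U <#> generate G {y} \<subseteq> S"
    by (simp_all add: subgroup_of_subgroup_iff[OF S'])
  have "U \<subseteq> U <#> generate G {y}" by (rule subset_set_mult_left[OF gen(1) Uc])
  moreover have "y \<in> U <#> generate G {y}"
    using subset_set_mult_right[OF U'(1) subgroup.subset[OF gen(1)]] gen(3) by blast
  ultimately have "U <#> generate G {y} = S" using full[OF V(1) _ V(2)] y(2) by blast
  then have "factor_order G S U = p"
    using factor_order_cyclic[OF S' U'(1) _ y(1,3) _ p_dvd_factor_order[OF S U'(1,3)]] U'(3) by blast
  then have "card S = p * card U" using factor_order_mult_card[OF S' U'(1)] U'(3) by auto
  then show ?thesis using normU U'(2) by blast
qed

text \<open>Since \<open>x\<close> fixes \<open>c\<close>, conjugating \<open>d\<close> by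
  \<open>x [^] m\<close> gives \<open>d \<otimes> c [^] m\<close>. Taking \<open>m\<close> prime to
  \<open>p\<close> with \<open>x [^] m = \<one>\<close> gives \<open>c [^] m = \<one>\<close>, and
  \<open>c\<close> is a \<open>p\<close>-element. Thus a \<open>p\<close>-regular element that acts
  trivially on a factor and fixes the resulting commutators acts trivially.\<close>

lemma p_regular_shift_trivial:
  assumes x: "p_regular p G x" and d: "d \<in> carrier G" and c: "c \<in> carrier G"
    and dc: "conj_by G x d = d \<otimes> c" and cc: "conj_by G x c = c" and pc: "c [^] (p ^ k) = \<one>"
  shows "c = \<one>"
proof -
  obtain n where xG: "x \<in> carrier G" and n: "coprime n p" "x [^] (n::nat) = \<one>"
    using x by (auto simp: p_regular_def)
  have cn: "conj_by G (x [^] m) c = c" for m :: nat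
    by (induction m) (simp_all add: conj_by_comp xG c cc)
  have "conj_by G (x [^] m) d = d \<otimes> c [^] m" for m :: nat
  proof (induction m)
    case (Suc m)
    have "conj_by G (x [^] Suc m) d = conj_by G (x [^] m) (d \<otimes> c)"
      using xG d dc by (simp add: conj_by_comp)
    also have "\<dots> = d \<otimes> c [^] m \<otimes> c" using Suc cn[of m] xG d c by (simp add: conj_by_mult)
    finally show ?case using d c by (simp add: m_assoc)
  qed (use d in simp)
  from this[of n] have "d = d \<otimes> c [^] n" using n(2) d by simp
  then have "c [^] n = \<one>" using d c by simp
  then show ?thesis using pow_coprime_eq_one[OF c _ pc] n(1) by simp
qed

text \<open>Here \<open>t\<close> is the commutator of \<open>b\<close> and \<open>a\<close>. In the
  power of \<open>a \<otimes> b\<close>, the \<open>a\<close> with number \<open>i\<close>, counted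
  from 0, moves left past \<open>i\<close> copies of \<open>b\<close> at the price of one
  \<open>t\<close> each; this makes the exponent of \<open>t\<close> the binomial coefficient of
  \<open>n\<close> over 2.\<close>

lemma class_two_pow:
  assumes a: "a \<in> carrier G" and b: "b \<in> carrier G" and t: "t \<in> carrier G"
    and ba: "b \<otimes> a = a \<otimes> b \<otimes> t" and ta: "t \<otimes> a = a \<otimes> t" and tb: "t \<otimes> b = b \<otimes> t"
  shows "b [^] (n::nat) \<otimes> a = a \<otimes> b [^] n \<otimes> t [^] n"
    and "(a \<otimes> b) [^] n = a [^] n \<otimes> b [^] n \<otimes> t [^] (\<Sum>i<n. i)"
proof -
  have tna: "t [^] m \<otimes> a = a \<otimes> t [^] m" and tnb: "t [^] m \<otimes> b = b \<otimes> t [^] m" for m :: nat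
    using group_commutes_pow[OF ta t a] group_commutes_pow[OF tb t b] by auto
  have ba': "b \<otimes> (a \<otimes> y) = a \<otimes> (b \<otimes> (t \<otimes> y))" if "y \<in> carrier G" for y
    using ba a b t that by (metis m_assoc m_closed)
  have tnb': "t [^] m \<otimes> (b \<otimes> y) = b \<otimes> (t [^] m \<otimes> y)" if "y \<in> carrier G" for y and m :: nat
    using tnb[of m] b t that by (metis m_assoc nat_pow_closed)
  have tna': "t [^] m \<otimes> (a \<otimes> y) = a \<otimes> (t [^] m \<otimes> y)" if "y \<in> carrier G" for y and m :: nat
    using tna[of m] a t that by (metis m_assoc nat_pow_closed)
  have 1: "b [^] (n::nat) \<otimes> a = a \<otimes> b [^] n \<otimes> t [^] n" for n
  proof (induction n)
    case (Suc n)
    have "b [^] Suc n \<otimes> a = b [^] n \<otimes> a \<otimes> (b \<otimes> t)" using a b t ba by (simp add: m_assoc)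
    also have "\<dots> = a \<otimes> b [^] n \<otimes> t [^] n \<otimes> (b \<otimes> t)" using Suc by simp
    also have "\<dots> = a \<otimes> b [^] Suc n \<otimes> t [^] Suc n"
      using a b t tnb' by (simp add: m_assoc)
    finally show ?case .
  qed (use a in simp)
  then show "b [^] n \<otimes> a = a \<otimes> b [^] n \<otimes> t [^] n" .
  have swap: "b [^] n \<otimes> (a \<otimes> y) = a \<otimes> (b [^] n \<otimes> (t [^] n \<otimes> y))" if "y \<in> carrier G" for y and n :: nat
    using 1[of n] a b t that by (metis m_assoc m_closed nat_pow_closed)
  show "(a \<otimes> b) [^] n = a [^] n \<otimes> b [^] n \<otimes> t [^] (\<Sum>i<n. i)"
  proof (induction n)
    case (Suc n)
    let ?T = "\<Sum>i<n. i"
    have "(a \<otimes> b) [^] Suc n = a [^] n \<otimes> (b [^] n \<otimes> (t [^] ?T \<otimes> (a \<otimes> b)))"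
      using a b t Suc by (simp add: m_assoc)
    also have "\<dots> = a [^] n \<otimes> (a \<otimes> (b [^] n \<otimes> (b \<otimes> (t [^] n \<otimes> t [^] ?T))))"
      using a b t by (simp add: tna' tnb' tnb swap)
    also have "\<dots> = a [^] Suc n \<otimes> b [^] Suc n \<otimes> t [^] (n + ?T)"
      using a b t by (simp add: m_assoc nat_pow_mult)
    finally show ?case by (simp add: add.commute)
  qed simp
qed

text \<open>This is the source of \<open>p_exponent\<close>: the exponent of \<open>t\<close> in
  \<open>class_two_pow\<close> has to be a multiple of \<open>p\<close>. For \<open>p = 2\<close>
  the sum up to 2 is 1, while the sum up to 4 is 6.\<close>

lemma p_dvd_triangular: "p dvd (\<Sum>i<p_exponent p. i)"
proof (cases "p = 2")
  case True
  have "(\<Sum>i<4::nat. i) = 6" by (simp add: numeral_eq_Suc)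
  then show ?thesis using True by (simp add: p_exponent_def)
next
  case False
  have "2 * (\<Sum>i<n. i) + n = n * n" for n :: nat by (induction n) auto
  then have "p dvd 2 * (\<Sum>i<p. i)" by (metis dvd_add_left_iff dvd_refl dvd_triv_left)
  moreover have "\<not> p dvd 2"
    using False p_gt_1 by (metis One_nat_def Suc_lessI dvd_imp_le less_le_not_le numeral_2_eq_2 zero_less_numeral)
  ultimately show ?thesis
    using False prime_dvd_mult_nat[OF prime_p] by (auto simp: p_exponent_def)
qed

lemma p_dvd_p_exponent: "p dvd p_exponent p"
  by (auto simp: p_exponent_def)

text \<open>\<open>K\<close> is the join of \<open>T\<close> with the Frattini subgroup of
  \<open>D\<close>, generated by \<open>T\<close>, the \<open>p\<close>-th powers and the
  commutators. It is proper because all generators lie in one subgroup of index \<open>p\<close>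
  above \<open>T\<close>. The last clause stands in for "characteristic": a conjugation preserving
  \<open>D\<close> and \<open>T\<close> permutes the three kinds of generators among
  themselves.\<close>

lemma p_subgroup_frattini:
  assumes D: "p_subgroup p G D" and T: "subgroup T G" "T \<subset> D"
  obtains K where "subgroup K G" "T \<subseteq> K" "K \<subset> D" "\<And>y. y \<in> D \<Longrightarrow> y [^] p \<in> K"
    and "\<And>y z. y \<in> D \<Longrightarrow> z \<in> D \<Longrightarrow> conj_by G y z \<otimes> inv z \<in> K"
    and "\<And>g. g \<in> carrier G \<Longrightarrow> conj_by G g ` D \<subseteq> D \<Longrightarrow> conj_by G g ` T \<subseteq> T \<Longrightarrow> conj_by G g ` K \<subseteq> K"
proof -
  have D': "subgroup D G" using D by (simp add: p_subgroup_def)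
  have DG: "y \<in> D \<Longrightarrow> y \<in> carrier G" for y using D' subgroup.mem_carrier by metis
  obtain U where U: "U \<lhd> G\<lparr>carrier := D\<rparr>" "T \<subseteq> U" "card D = p * card U"
    using p_subgroup_maximal[OF D T] by blast
  interpret L: fin_grp "G\<lparr>carrier := D\<rparr>" p by (rule fin_grp_subgroup[OF D'])
  have U': "subgroup U G" "U \<subseteq> D" using U normal_of_subgroup_iff[OF D'] by blast+
  have "U \<noteq> D" using U(3) subgroup_card_pos[OF U'(1)] p_gt_1 by auto
  define gens where "gens = T \<union> {y [^] p |y. y \<in> D} \<union> {conj_by G y z \<otimes> inv z |y z. y \<in> D \<and> z \<in> D}"
  have gens_cases: thesis
    if "w \<in> gens" "w \<in> T \<Longrightarrow> thesis" "\<And>y. y \<in> D \<Longrightarrow> w = y [^] p \<Longrightarrow> thesis"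
      "\<And>y z. y \<in> D \<Longrightarrow> z \<in> D \<Longrightarrow> w = conj_by G y z \<otimes> inv z \<Longrightarrow> thesis" for w thesis
    using that unfolding gens_def by blast
  define K where "K = generate G gens"
  have gU: "gens \<subseteq> U"
  proof
    fix w assume "w \<in> gens"
    then show "w \<in> U"
    proof (rule gens_cases)
      fix y assume "y \<in> D" "w = y [^] p"
      then show ?thesis using L.normal_index_p(3)[OF U(1), of y] U(3) by (simp add: nat_pow_consistent[symmetric])
    next
      fix y z assume "y \<in> D" "z \<in> D" "w = conj_by G y z \<otimes> inv z"
      then show ?thesis using L.normal_index_p(4)[OF U(1), of y z] U(3) D' by (simp add: conj_by_of_subgroup)
    qed (use U(2) in blast)
  qed
  then have gG: "gens \<subseteq> carrier G" using U' subgroup.subset by blast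
  have gK: "gens \<subseteq> K" unfolding K_def by (auto intro: generate.incl)
  have "K \<subseteq> U" unfolding K_def by (rule generate_subgroup_incl[OF gU U'(1)])
  then have KD: "K \<subset> D" using U'(2) \<open>U \<noteq> D\<close> by blast
  show thesis
  proof (rule that[OF _ _ KD])
    show "subgroup K G" unfolding K_def by (rule generate_is_subgroup[OF gG])
    show "T \<subseteq> K" using gK unfolding gens_def by blast
    show "y [^] p \<in> K" if "y \<in> D" for y using that gK unfolding gens_def by blast
    show "conj_by G y z \<otimes> inv z \<in> K" if "y \<in> D" "z \<in> D" for y z
      using that gK unfolding gens_def by blast
    fix g assume g: "g \<in> carrier G" and gD: "conj_by G g ` D \<subseteq> D" and gT: "conj_by G g ` T \<subseteq> T"
    interpret cg: group_hom G G "conj_by G g" by (rule group_hom_conj_by[OF g])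
    have "conj_by G g w \<in> gens" if "w \<in> gens" for w
      using that
    proof (rule gens_cases)
      assume "w \<in> T"
      then show ?thesis using gT by (auto simp: gens_def)
    next
      fix y assume y: "y \<in> D" "w = y [^] p"
      then have "conj_by G g w = conj_by G g y [^] p" using g DG by (simp add: conj_by_pow)
      then show ?thesis using gD y(1) unfolding gens_def by blast
    next
      fix y z assume yz: "y \<in> D" "z \<in> D" "w = conj_by G y z \<otimes> inv z"
      then have "conj_by G g w = conj_by G (conj_by G g y) (conj_by G g z) \<otimes> inv (conj_by G g z)"
        using g DG by (simp add: conj_by_conj_by conj_by_mult conj_by_inv)
      then show ?thesis using gD yz(1,2) unfolding gens_def by blast
    qed
    then have "generate G (conj_by G g ` gens) \<subseteq> K"
      unfolding K_def by (intro mono_generate) blast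
    then show "conj_by G g ` K \<subseteq> K" using cg.generate_img[OF gG] by (simp add: K_def)
  qed
qed

text \<open>In a minimal counterexample \<open>D\<close> the subgroup \<open>K\<close> of \<open>p\<close>-th powers and commutators is centralized by
  \<open>x\<close>; its centralizer in \<open>D\<close> contains all \<open>inv y \<otimes> conj_by G x y\<close>, hence is \<open>D\<close>. So \<open>D\<close> has class at
  most two, and these elements have order dividing \<open>p_exponent p\<close>.\<close>

theorem p_regular_centralizes_p_subgroup:
  assumes "p_subgroup p G D" and x: "p_regular p G x"
    and "\<And>d. d \<in> D \<Longrightarrow> conj_by G x d \<in> D"
    and "\<And>d. d \<in> D \<Longrightarrow> d [^] p_exponent p = \<one> \<Longrightarrow> conj_by G x d = d"
    and "d \<in> D"
  shows "conj_by G x d = d"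
  using assms(1,3-5)
proof (induction "card D" arbitrary: D d rule: less_induct)
  case less
  note D = less.prems(1) and inv = less.prems(2) and small = less.prems(3)
  have D': "subgroup D G" using D by (simp add: p_subgroup_def)
  have xG: "x \<in> carrier G" using x by (simp add: p_regular_def)
  have DG: "y \<in> D \<Longrightarrow> y \<in> carrier G" for y using D' subgroup.mem_carrier by metis
  have ih: "conj_by G x y = y"
    if E: "subgroup E G" "E \<subset> D" "\<And>y. y \<in> E \<Longrightarrow> conj_by G x y \<in> E" "y \<in> E" for E y
  proof (rule less.hyps[of E])
    show "card E < card D" using E(2) D' by (simp add: psubset_card_mono)
    show "p_subgroup p G E" using p_subgroup_subset[OF D E(1)] E(2) by blast
  qed (use E small in auto)
  show ?case
  proof (cases "D = {\<one>}")
    case True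
    then show ?thesis using less.prems(4) xG by simp
  next
    case False
    then have "{\<one>} \<subset> D" using subgroup.one_closed[OF D'] by blast
    then obtain K where K': "subgroup K G" and KD: "K \<subset> D" and Kpow: "\<And>y. y \<in> D \<Longrightarrow> y [^] p \<in> K"
      and Kcomm: "\<And>y z. y \<in> D \<Longrightarrow> z \<in> D \<Longrightarrow> conj_by G y z \<otimes> inv z \<in> K"
      and Kchar: "\<And>g. g \<in> carrier G \<Longrightarrow> conj_by G g ` D \<subseteq> D \<Longrightarrow> conj_by G g ` {\<one>} \<subseteq> {\<one>} \<Longrightarrow> conj_by G g ` K \<subseteq> K"
      by (rule p_subgroup_frattini[OF D triv_subgroup]) blast
    have "conj_by G x ` K \<subseteq> K" by (rule Kchar[OF xG]) (use xG inv in auto)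
    then have Kinv: "conj_by G x k \<in> K" if "k \<in> K" for k using that by blast
    have Kfix: "conj_by G x k = k" if "k \<in> K" for k
      using ih[OF K' KD Kinv that] .
    have Knorm: "conj_by G y k \<in> K" if "y \<in> D" "k \<in> K" for y k
    proof -
      have "conj_by G y k \<otimes> inv k \<in> K" using Kcomm that KD by blast
      then have "conj_by G y k \<otimes> inv k \<otimes> k \<in> K" using that(2) K' by (simp add: subgroup.m_closed)
      then show ?thesis using that DG KD by (simp add: m_assoc psubsetD)
    qed
    define c where "c y = inv y \<otimes> conj_by G x y" for y
    have cD: "c y \<in> D" if "y \<in> D" for y
      using that inv D' by (simp add: c_def subgroup.m_closed subgroup.m_inv_closed)
    have yc: "conj_by G x y = y \<otimes> c y" if "y \<in> D" for y
      using that DG inv by (simp add: c_def grp_simps)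
    \<comment> \<open>\<open>x\<close> fixes both \<open>k\<close> and the conjugate of
      \<open>k\<close> by \<open>y\<close>, so \<open>y\<close> and its image
      \<open>y \<otimes> c y\<close> conjugate \<open>k\<close> to the same element; hence
      \<open>c y\<close> commutes with \<open>k\<close>.\<close>
    have cK: "c y \<otimes> k = k \<otimes> c y" if y: "y \<in> D" and k: "k \<in> K" for y k
    proof -
      have G: "y \<in> carrier G" "k \<in> carrier G" "conj_by G x y \<in> carrier G"
        using y k DG KD xG by auto
      have "conj_by G y k = conj_by G x (conj_by G y k)" using Kfix Knorm y k by simp
      also have "\<dots> = conj_by G (conj_by G x y) (conj_by G x k)"
        using G xG by (simp add: conj_by_def grp_simps)
      also have "\<dots> = conj_by G (conj_by G x y) k" using Kfix k by simp
      also have "\<dots> = conj_by G y (conj_by G (c y) k)"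
        using G yc[OF y] cD[OF y] DG by (simp add: conj_by_comp)
      finally have "conj_by G (c y) k = k"
        using conj_by_inj[OF G(1)] G cD[OF y] DG by (simp add: inj_on_eq_iff)
      then show ?thesis using conj_by_eq_iff G cD[OF y] DG by blast
    qed
    define C where "C = {y \<in> D. \<forall>k\<in>K. conj_by G y k = k}"
    have KG: "k \<in> K \<Longrightarrow> k \<in> carrier G" for k using K' subgroup.mem_carrier by metis
    have C': "subgroup C G"
      unfolding C_def by (rule subgroup_fixing[OF D' subgroup.subset[OF K']])
    have Cinv: "conj_by G x y \<in> C" if "y \<in> C" for y
    proof -
      have y: "y \<in> D" "\<forall>k\<in>K. conj_by G y k = k" using that by (auto simp: C_def)
      have "conj_by G (conj_by G x y) k = k" if k: "k \<in> K" for k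
      proof -
        have "conj_by G (conj_by G x y) (conj_by G x k) = conj_by G x (conj_by G y k)"
          using conj_by_conj_by[OF xG DG[OF y(1)] KG[OF k]] .
        then show ?thesis using Kfix[OF k] y(2) k by simp
      qed
      then show ?thesis using y inv by (simp add: C_def)
    qed
    have cC: "c y \<in> C" if "y \<in> D" for y
      using that cD cK DG KG by (auto simp: C_def conj_by_eq_iff)
    have key: "c y = \<one>" if y: "y \<in> D" and fixc: "conj_by G x (c y) = c y" for y
    proof -
      obtain k where "c y [^] (p ^ k) = \<one>" using p_subgroup_pow[OF D cD[OF y]] by blast
      then show ?thesis
        using p_regular_shift_trivial[OF x DG[OF y] DG[OF cD[OF y]] yc[OF y] fixc] by blast
    qed
    \<comment> \<open>A proper centralizer \<open>C\<close> is centralized by \<open>x\<close> by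
      induction and contains \<open>c y\<close>, so \<open>key\<close> applies. If
      \<open>C = D\<close>, then \<open>K\<close> is central and the power computation below is
      available.\<close>
    have "c y = \<one>" if y: "y \<in> D" for y
    proof (cases "C = D")
      case False
      then have "C \<subset> D" by (auto simp: C_def)
      then show ?thesis using key[OF y] ih[OF C' _ Cinv cC[OF y]] by blast
    next
      case True
      have cent: "u \<otimes> k = k \<otimes> u" if "u \<in> D" "k \<in> K" for u k
      proof -
        have "conj_by G u k = k" using that True unfolding C_def by blast
        then show ?thesis using conj_by_eq_iff that DG KG by blast
      qed
      \<comment> \<open>\<open>c y\<close> is the product \<open>a \<otimes> b\<close>. Its power
        with exponent \<open>p_exponent p\<close> is trivial: the powers of \<open>t\<close> vanish,
        and \<open>b [^] p = y [^] p\<close> because \<open>x\<close> fixes the \<open>p\<close>-th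
        powers, which lie in \<open>K\<close>. So \<open>c y\<close> is an element of small order,
        and \<open>x\<close> fixes it by hypothesis.\<close>
      define a where "a = inv y"
      define b where "b = conj_by G x y"
      define t where "t = inv b \<otimes> inv a \<otimes> b \<otimes> a"
      have abD: "a \<in> D" "b \<in> D" using y inv D' by (auto simp: a_def b_def subgroup.m_inv_closed)
      then have ab: "a \<in> carrier G" "b \<in> carrier G" using DG by auto
      have "conj_by G (inv b) (inv a) \<otimes> inv (inv a) \<in> K"
        using Kcomm abD D' by (simp add: subgroup.m_inv_closed)
      then have tK: "t \<in> K" using ab by (simp add: t_def conj_by_def)
      then have t: "t \<in> carrier G" using KG by blast
      have ba: "b \<otimes> a = a \<otimes> b \<otimes> t" using ab by (simp add: t_def grp_simps)
      have ta: "t \<otimes> a = a \<otimes> t" and tb: "t \<otimes> b = b \<otimes> t" using cent[OF abD(1) tK] cent[OF abD(2) tK] by simp_all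
      have "a \<otimes> b [^] p = a \<otimes> b [^] p \<otimes> t [^] p"
        using class_two_pow(1)[OF ab t ba ta tb, of p] cent[OF abD(1) Kpow[OF abD(2)]] by simp
      then have tp: "t [^] p = \<one>" using ab t by simp
      obtain r where r: "(\<Sum>i<p_exponent p. i) = p * r" using p_dvd_triangular by (elim dvdE)
      obtain s where s: "p_exponent p = p * s" using p_dvd_p_exponent by (elim dvdE)
      have "c y [^] p_exponent p = a [^] p_exponent p \<otimes> b [^] p_exponent p"
        using class_two_pow(2)[OF ab t ba ta tb, of "p_exponent p"] r tp ab t
        by (simp add: c_def a_def b_def nat_pow_pow[symmetric])
      also have "b [^] p_exponent p = y [^] p_exponent p"
      proof -
        have "b [^] p = y [^] p"
          using Kfix[OF Kpow[OF y]] y DG xG by (simp add: b_def conj_by_pow)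
        then show ?thesis using ab y DG by (simp add: s nat_pow_pow[symmetric])
      qed
      finally have "c y [^] p_exponent p = \<one>"
        using y DG by (simp add: a_def nat_pow_inv)
      then show ?thesis using key[OF y] small cD[OF y] by blast
    qed
    then show ?thesis using yc less.prems(4) DG by simp
  qed
qed

end

section \<open>Transfer\<close>

text \<open>Frobenius' condition that the normalizer of each \<open>p\<close>-subgroup
  \<open>D\<close> modulo its centralizer is a \<open>p\<close>-group, expressed through
  elements.\<close>

definition p_regular_act_trivially :: "nat \<Rightarrow> ('a, 'b) monoid_scheme \<Rightarrow> bool" where
  "p_regular_act_trivially p G \<longleftrightarrow>
     (\<forall>D x. p_subgroup p G D \<and> p_regular p G x \<and> (\<forall>d\<in>D. conj_by G x d \<in> D) \<longrightarrow>
       (\<forall>d\<in>D. conj_by G x d = d))"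

text \<open>Split \<open>Y\<close> into cycles of \<open>\<sigma>\<close>: a cycle of length
  \<open>n\<close> contributes \<open>a [^] n\<close>, and the lengths add up to
  \<open>card Y\<close>. It evaluates the transfer at an element whose translation permutes the
  cosets.\<close>

lemma (in comm_group) finprod_cycles:
  assumes "finite Y" "\<And>c. c \<in> Y \<Longrightarrow> \<sigma> c \<in> Y" "f \<in> Y \<rightarrow> carrier G" "a \<in> carrier G"
    and "\<And>c. c \<in> Y \<Longrightarrow> \<exists>n>0. (\<sigma> ^^ n) c = c"
    and "\<And>c n. c \<in> Y \<Longrightarrow> (\<sigma> ^^ n) c = c \<Longrightarrow> finprod G (\<lambda>i. f ((\<sigma> ^^ i) c)) {..<n} = a [^] n"
  shows "finprod G f Y = a [^] card Y"
  using assms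
proof (induction "card Y" arbitrary: Y rule: less_induct)
  case less
  note cl = less.prems(2) and f = less.prems(3) and per = less.prems(5) and cyc = less.prems(6)
  show ?case
  proof (cases "Y = {}")
    case False
    then obtain c where c: "c \<in> Y" by blast
    define n where "n = (LEAST n. 0 < n \<and> (\<sigma> ^^ n) c = c)"
    have n: "0 < n" "(\<sigma> ^^ n) c = c"
      unfolding n_def using LeastI_ex[OF per[OF c]] by auto
    have min: "n \<le> m" if "0 < m" "(\<sigma> ^^ m) c = c" for m
      unfolding n_def using that by (simp add: Least_le)
    have mult: "(\<sigma> ^^ (n * q)) c = c" for q
      by (induction q) (simp_all add: funpow_add n(2))
    have mod: "(\<sigma> ^^ m) c = (\<sigma> ^^ (m mod n)) c" for m
    proof -
      have "(\<sigma> ^^ m) c = (\<sigma> ^^ (m mod n + n * (m div n))) c" by simp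
      also have "\<dots> = (\<sigma> ^^ (m mod n)) ((\<sigma> ^^ (n * (m div n))) c)" by (simp only: funpow_add o_apply)
      finally show ?thesis by (simp add: mult)
    qed
    define C where "C = (\<lambda>i. (\<sigma> ^^ i) c) ` {..<n}"
    have inC: "(\<sigma> ^^ m) c \<in> C" for m using mod[of m] n(1) by (auto simp: C_def)
    have it: "(\<sigma> ^^ m) y \<in> Y" if "y \<in> Y" for y m by (induction m) (simp_all add: that cl)
    have CY: "C \<subseteq> Y" using it c by (auto simp: C_def)
    have inj: "inj_on (\<lambda>i. (\<sigma> ^^ i) c) {..<n}"
    proof (rule linorder_inj_onI')
      fix i j assume ij: "i \<in> {..<n}" "j \<in> {..<n}" "i < j"
      show "(\<sigma> ^^ i) c \<noteq> (\<sigma> ^^ j) c"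
      proof
        assume eq: "(\<sigma> ^^ i) c = (\<sigma> ^^ j) c"
        have "(\<sigma> ^^ (n - j + i)) c = (\<sigma> ^^ (n - j)) ((\<sigma> ^^ i) c)" by (simp only: funpow_add o_apply)
        also have "\<dots> = (\<sigma> ^^ (n - j + j)) c" by (simp only: eq funpow_add o_apply)
        also have "\<dots> = c" using ij n by simp
        finally show False using min[of "n - j + i"] ij by simp
      qed
    qed
    \<comment> \<open>Each point has a positive period, so it is recovered from its image by
      iterating \<open>\<sigma>\<close>; an image in the cycle \<open>C\<close> would bring the
      point itself into \<open>C\<close>.\<close>
    have rest: "\<sigma> y \<in> Y - C" if y: "y \<in> Y - C" for y
    proof -
      obtain m where m: "0 < m" "(\<sigma> ^^ m) y = y" using per y by blast
      have "\<sigma> y \<notin> C"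
      proof
        assume "\<sigma> y \<in> C"
        then obtain i where i: "\<sigma> y = (\<sigma> ^^ i) c" by (auto simp: C_def)
        have "y = (\<sigma> ^^ (m - 1)) (\<sigma> y)" using m funpow_swap1[of \<sigma> "m - 1" y]
          by (metis Suc_diff_1 comp_apply funpow.simps(2))
        also have "\<dots> = (\<sigma> ^^ (m - 1 + i)) c" by (simp only: i funpow_add o_apply)
        finally show False using inC y by auto
      qed
      then show ?thesis using cl y by blast
    qed
    have C1: "finprod G f C = a [^] card C"
    proof -
      have "finprod G f C = finprod G (\<lambda>i. f ((\<sigma> ^^ i) c)) {..<n}"
        unfolding C_def by (rule finprod_reindex[OF _ inj]) (use f CY in \<open>auto simp: C_def\<close>)
      also have "\<dots> = a [^] n" by (rule cyc[OF c n(2)])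
      finally show ?thesis using inj by (simp add: C_def card_image)
    qed
    have finC: "finite C" by (simp add: C_def)
    have "c \<in> C" using inC[of 0] by simp
    then have lt: "card (Y - C) < card Y"
      using CY less.prems(1) by (intro psubset_card_mono) auto
    have C2: "finprod G f (Y - C) = a [^] card (Y - C)"
    proof (rule less.hyps[OF lt])
      show "finite (Y - C)" using less.prems(1) by simp
      show "f \<in> (Y - C) \<rightarrow> carrier G" using f by blast
      show "\<sigma> y \<in> Y - C" if "y \<in> Y - C" for y by (rule rest[OF that])
      show "\<exists>n>0. (\<sigma> ^^ n) y = y" if "y \<in> Y - C" for y using per that by blast
      show "finprod G (\<lambda>i. f ((\<sigma> ^^ i) y)) {..<n} = a [^] n" if "y \<in> Y - C" "(\<sigma> ^^ n) y = y" for y n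
        using cyc that by blast
    qed (use less.prems(4) in simp)
    have "finprod G f Y = finprod G f (C \<union> (Y - C))" using CY by (simp add: Un_absorb1)
    also have "\<dots> = finprod G f C \<otimes> finprod G f (Y - C)"
      by (rule finprod_Un_disjoint) (use finC less.prems(1) f CY in auto)
    also have "\<dots> = a [^] (card C + card (Y - C))"
      using C1 C2 less.prems(4) by (simp add: nat_pow_mult)
    also have "card C + card (Y - C) = card Y"
      using CY finC less.prems(1) by (simp add: card_Diff_subset card_mono)
    finally show ?thesis .
  qed simp
qed

context fin_grp
begin

text \<open>\<open>V\<close> is the transfer of \<open>\<phi>\<close>. Along a cycle of length
  \<open>n\<close> of \<open>s\<close> on the cosets, the factors telescope to a conjugate of
  \<open>s [^] n\<close> that lies in \<open>S\<close>, and stability says that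
  \<open>\<phi>\<close> does not distinguish it from \<open>s [^] n\<close>. So every cycle
  contributes \<open>n\<close> factors \<open>\<phi> s\<close>.\<close>

theorem transfer_hom:
  fixes A :: "('c, 'd) monoid_scheme"
  assumes S: "subgroup S G" and A: "comm_group A" and \<phi>: "\<phi> \<in> hom (G\<lparr>carrier := S\<rparr>) A"
    and stable: "\<And>g s. g \<in> carrier G \<Longrightarrow> s \<in> S \<Longrightarrow> conj_by G g s \<in> S \<Longrightarrow> \<phi> (conj_by G g s) = \<phi> s"
  shows "\<exists>V\<in>hom G A. \<forall>s\<in>S. V s = \<phi> s [^]\<^bsub>A\<^esub> card (rcosets S)"
proof -
  interpret A: comm_group A by (rule A)
  interpret L: group "G\<lparr>carrier := S\<rparr>" by (rule subgroup_imp_group[OF S])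
  have \<phi>_cl: "\<phi> s \<in> carrier A" if "s \<in> S" for s using \<phi> that by (auto simp: hom_def)
  have \<phi>_mult: "\<phi> (s \<otimes> t) = \<phi> s \<otimes>\<^bsub>A\<^esub> \<phi> t" if "s \<in> S" "t \<in> S" for s t
    using \<phi> that by (auto simp: hom_def)
  have \<phi>_one: "\<phi> \<one> = \<one>\<^bsub>A\<^esub>" using hom_one[OF \<phi> L.is_group A.is_group] by simp
  have SG: "S \<subseteq> carrier G" by (rule subgroup.subset[OF S])
  let ?Y = "rcosets S"
  have finY: "finite ?Y" by (simp add: RCOSETS_def)
  define r where "r c = (SOME t. t \<in> c)" for c :: "'a set"
  have r: "r c \<in> carrier G" "c = S #> r c" if "c \<in> ?Y" for c
  proof -
    have "c \<noteq> {}" using that subgroup.rcosets_non_empty[OF S] by blast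
    then have rc: "r c \<in> c" unfolding r_def by (simp add: some_in_eq)
    then show "r c \<in> carrier G" using that subgroup.rcosets_carrier[OF S is_group] by blast
    show "c = S #> r c" using that rc repr_independence[OF _ _ S] by (auto simp: RCOSETS_def)
  qed
  have mv: "c #> g \<in> ?Y" if "c \<in> ?Y" "g \<in> carrier G" for c g
    using that S by (auto simp: RCOSETS_def rcosets_act)
  have mv_mult: "c #> g #> h = c #> (g \<otimes> h)" if "c \<in> ?Y" "g \<in> carrier G" "h \<in> carrier G" for c g h
    using that subgroup.rcosets_carrier[OF S is_group] coset_mult_assoc by blast
  have mv_one: "c #> \<one> = c" if "c \<in> ?Y" for c
    using coset_mult_one subgroup.rcosets_carrier[OF S is_group that] by blast
  \<comment> \<open>The discrepancy in \<open>S\<close> between moving the representative of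
    \<open>c\<close> by \<open>g\<close> and taking the representative of the moved coset.
    \<open>cocycle\<close> makes \<open>V\<close> multiplicative and makes the cycles
    telescope.\<close>
  define fac where "fac g c = r c \<otimes> g \<otimes> inv (r (c #> g))" for g c
  have fac: "fac g c \<in> S" if c: "c \<in> ?Y" and g: "g \<in> carrier G" for g c
  proof -
    note r1 = r[OF c] and r2 = r[OF mv[OF c g]]
    have "S #> (r c \<otimes> g) = c #> g" using r1 rcosets_act[OF S g r1(1)] by simp
    then have "r c \<otimes> g \<in> S #> r (c #> g)"
      using r2 rcos_self[OF _ S, of "r c \<otimes> g"] r1(1) g by simp
    then show ?thesis
      using subgroup.rcos_module[OF S is_group r2(1), of "r c \<otimes> g"] r1(1) g by (simp add: fac_def)
  qed
  have cocycle: "fac (g \<otimes> h) c = fac g c \<otimes> fac h (c #> g)"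
    if c: "c \<in> ?Y" and g: "g \<in> carrier G" and h: "h \<in> carrier G" for g h c
    using r(1)[OF c] r(1)[OF mv[OF c g]] r(1)[OF mv[OF c, of "g \<otimes> h"]] g h
    by (simp add: fac_def mv_mult[OF c g h] grp_simps)
  define V where "V g = finprod A (\<lambda>c. \<phi> (fac g c)) ?Y" for g
  have funY: "(\<lambda>c. \<phi> (fac g c)) \<in> ?Y \<rightarrow> carrier A" if "g \<in> carrier G" for g
    using that fac \<phi>_cl by blast
  have "V \<in> hom G A"
  proof (rule homI)
    show "V g \<in> carrier A" if "g \<in> carrier G" for g
      unfolding V_def by (rule A.finprod_closed[OF funY[OF that]])
    show "V (g \<otimes> h) = V g \<otimes>\<^bsub>A\<^esub> V h" if g: "g \<in> carrier G" and h: "h \<in> carrier G" for g h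
    proof -
      have inj: "inj_on (\<lambda>c. c #> g) ?Y"
        by (rule inj_on_inverseI[of _ "\<lambda>c. c #> inv g"]) (simp add: mv_mult mv_one g)
      have onto: "(\<lambda>c. c #> g) ` ?Y = ?Y"
        by (rule card_subset_eq[OF finY]) (use mv g card_image[OF inj] in auto)
      have "V (g \<otimes> h) = finprod A (\<lambda>c. \<phi> (fac g c) \<otimes>\<^bsub>A\<^esub> \<phi> (fac h (c #> g))) ?Y"
        unfolding V_def by (rule A.finprod_cong') (use g h fac mv \<phi>_cl \<phi>_mult cocycle in auto)
      also have "\<dots> = V g \<otimes>\<^bsub>A\<^esub> finprod A (\<lambda>c. \<phi> (fac h (c #> g))) ?Y"
        unfolding V_def by (rule A.finprod_multf) (use g h fac mv \<phi>_cl in auto)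
      also have "finprod A (\<lambda>c. \<phi> (fac h (c #> g))) ?Y = finprod A (\<lambda>c. \<phi> (fac h c)) ((\<lambda>c. c #> g) ` ?Y)"
        by (rule A.finprod_reindex[OF _ inj, symmetric]) (use funY[OF h] onto in simp)
      finally show ?thesis by (simp add: V_def onto)
    qed
  qed
  moreover have "V s = \<phi> s [^]\<^bsub>A\<^esub> card ?Y" if s: "s \<in> S" for s
    unfolding V_def
  proof (rule A.finprod_cycles[where \<sigma> = "\<lambda>c. c #> s", OF finY])
    have sG: "s \<in> carrier G" using s SG by blast
    have iter: "((\<lambda>c. c #> s) ^^ n) c = c #> s [^] n" if "c \<in> ?Y" for c and n :: nat
      by (induction n) (simp_all add: mv_one mv_mult that sG)
    show "c #> s \<in> ?Y" if "c \<in> ?Y" for c using mv that sG by blast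
    show "(\<lambda>c. \<phi> (fac s c)) \<in> ?Y \<rightarrow> carrier A" by (rule funY[OF sG])
    show "\<phi> s \<in> carrier A" by (rule \<phi>_cl[OF s])
    show "\<exists>n>0. ((\<lambda>c. c #> s) ^^ n) c = c" if "c \<in> ?Y" for c
    proof (intro exI conjI)
      show "0 < order G" by (simp add: order_gt_0_iff_finite)
      show "((\<lambda>c. c #> s) ^^ order G) c = c" using iter[OF that] mv_one[OF that] pow_order_eq_1[OF sG] by simp
    qed
    fix c n assume c: "c \<in> ?Y" and "((\<lambda>c. c #> s) ^^ n) c = c"
    then have fixed: "c #> s [^] n = c" using iter by simp
    have part: "finprod A (\<lambda>i. \<phi> (fac s (c #> s [^] i))) {..<m} = \<phi> (fac (s [^] m) c)" for m :: nat
    proof (induction m)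
      case 0
      show ?case using r(1)[OF c] \<phi>_one mv_one[OF c] by (simp add: fac_def)
    next
      case (Suc m)
      have cl: "(\<lambda>i. \<phi> (fac s (c #> s [^] i))) \<in> {..<m} \<rightarrow> carrier A"
        and cl': "\<phi> (fac s (c #> s [^] m)) \<in> carrier A"
        using fac mv c sG \<phi>_cl by auto
      have "finprod A (\<lambda>i. \<phi> (fac s (c #> s [^] i))) {..<Suc m}
          = \<phi> (fac s (c #> s [^] m)) \<otimes>\<^bsub>A\<^esub> \<phi> (fac (s [^] m) c)"
        using A.finprod_insert[OF _ _ cl cl'] Suc by (simp add: lessThan_Suc)
      also have "\<dots> = \<phi> (fac (s [^] m) c \<otimes> fac s (c #> s [^] m))"
        using fac mv c sG \<phi>_cl \<phi>_mult by (simp add: A.m_comm)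
      finally show ?case using cocycle[OF c, of "s [^] m" s] sG by simp
    qed
    have "fac (s [^] n) c = conj_by G (r c) (s [^] n)"
      by (simp add: fac_def fixed conj_by_def)
    moreover have "s [^] n \<in> S" by (rule subgroup_nat_pow[OF S s])
    ultimately have "\<phi> (fac (s [^] n) c) = \<phi> (s [^] n)"
      using stable[OF r(1)[OF c]] fac[OF c, of "s [^] n"] sG by auto
    also have "\<dots> = \<phi> s [^]\<^bsub>A\<^esub> n"
      by (induction n) (simp_all add: \<phi>_one \<phi>_mult subgroup_nat_pow[OF S s] s)
    finally show "finprod A (\<lambda>i. \<phi> (fac s (((\<lambda>c. c #> s) ^^ i) c))) {..<n} = \<phi> s [^]\<^bsub>A\<^esub> n"
      using part[of n] iter[OF c] by simp
  qed
  ultimately show ?thesis by blast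
qed

end

section \<open>Fusion and Frobenius' theorem\<close>

context fin_grp
begin

lemma p_regular_act_trivially_subgroup:
  assumes "p_regular_act_trivially p G" "subgroup L G"
  shows "p_regular_act_trivially p (G\<lparr>carrier := L\<rparr>)"
  unfolding p_regular_act_trivially_def
proof (intro allI impI, elim conjE)
  fix D x
  assume "p_subgroup p (G\<lparr>carrier := L\<rparr>) D" and x: "p_regular p (G\<lparr>carrier := L\<rparr>) x"
    and inv: "\<forall>d\<in>D. conj_by (G\<lparr>carrier := L\<rparr>) x d \<in> D"
  then have "p_subgroup p G D" "p_regular p G x" "x \<in> L"
    using p_subgroup_of_subgroup[OF assms(2)] p_regular_of_subgroup[OF assms(2)] by auto
  then show "\<forall>d\<in>D. conj_by (G\<lparr>carrier := L\<rparr>) x d = d"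
    using assms(1) inv conj_by_of_subgroup[OF assms(2)] unfolding p_regular_act_trivially_def by simp
qed

lemma sylow_overgroup_index:
  assumes "sylow_subgroup p G S" "subgroup T G" "S \<subseteq> T"
  shows "\<not> p dvd card (rcosets T)"
  using index_dvd_index[OF assms(2) _ assms(3)] assms(1) dvd_trans
  by (auto simp: sylow_subgroup_def p_subgroup_def)

text \<open>The \<open>p\<close>-regular elements of \<open>N\<close> centralize \<open>D\<close>,
  so the product of the centralizer of \<open>D\<close> in \<open>N\<close> with \<open>S\<close>
  contains all of them; it also contains a Sylow subgroup, hence it is \<open>N\<close>.\<close>

lemma normalizer_factorization:
  assumes triv: "p_regular_act_trivially p G" and D: "p_subgroup p G D"
    and N: "subgroup N G" "\<And>g. g \<in> N \<Longrightarrow> conj_by G g ` D = D"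
    and S: "sylow_subgroup p (G\<lparr>carrier := N\<rparr>) S" and n: "n \<in> N"
  shows "\<exists>c\<in>N. \<exists>s\<in>S. (\<forall>d\<in>D. conj_by G c d = d) \<and> n = c \<otimes> s"
proof -
  let ?L = "G\<lparr>carrier := N\<rparr>"
  interpret L: fin_grp ?L p by (rule fin_grp_subgroup[OF N(1)])
  have NG: "g \<in> N \<Longrightarrow> g \<in> carrier G" for g using N(1) subgroup.mem_carrier by metis
  have DG: "D \<subseteq> carrier G" using D by (simp add: p_subgroup_def subgroup.subset)
  define C where "C = {g \<in> N. \<forall>d\<in>D. conj_by G g d = d}"
  have C: "subgroup C G" unfolding C_def by (rule subgroup_fixing[OF N(1) DG])
  have "C \<lhd> ?L"
    unfolding C_def by (rule normal_fixing[OF N(1) _ DG N(2)]) (use L.normal_self in simp)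
  moreover have SL: "subgroup S ?L" using S by (simp add: sylow_subgroup_def p_subgroup_def)
  ultimately have CS: "subgroup (C <#>\<^bsub>?L\<^esub> S) ?L" by (rule L.set_mult_subgroup)
  have sub: "C \<subseteq> C <#>\<^bsub>?L\<^esub> S" "S \<subseteq> C <#>\<^bsub>?L\<^esub> S"
    using L.subset_set_mult_left[OF SL, of C] L.subset_set_mult_right[of C S]
      L.subgroup_of_subgroup_iff C SL subgroup_of_subgroup_iff[OF N(1)] subgroup.subset[OF SL]
    by (auto simp: C_def)
  have "C <#>\<^bsub>?L\<^esub> S = carrier ?L"
  proof (rule L.subgroup_contains_p_regular_imp_full[OF CS])
    show "\<not> p dvd card (rcosets\<^bsub>?L\<^esub> (C <#>\<^bsub>?L\<^esub> S))"
      by (rule L.sylow_overgroup_index[OF S CS sub(2)])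
    show "x \<in> C <#>\<^bsub>?L\<^esub> S" if "p_regular p ?L x" for x
    proof -
      have x: "p_regular p G x" "x \<in> N" using that p_regular_of_subgroup[OF N(1)] by auto
      then have "\<forall>d\<in>D. conj_by G x d \<in> D" using N(2) by blast
      then have "x \<in> C" using triv D x unfolding p_regular_act_trivially_def C_def by blast
      then show ?thesis using sub by blast
    qed
  qed
  then have "n \<in> C <#> S" using n by simp
  then show ?thesis by (auto simp: set_mult_def C_def)
qed

text \<open>Downward induction on \<open>card (S \<inter> T)\<close>: the normalizers of \<open>D = S \<inter> T\<close> in \<open>S\<close> and in \<open>T\<close> are
  strictly larger than \<open>D\<close>, and Sylow subgroups of the normalizer of \<open>D\<close> in \<open>G\<close> are conjugate by an
  element centralizing \<open>D\<close>.\<close>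

lemma sylow_conj_centralizing_inter:
  assumes triv: "p_regular_act_trivially p G"
    and "sylow_subgroup p G S" "sylow_subgroup p G T"
  shows "\<exists>c\<in>carrier G. (\<forall>d\<in>S \<inter> T. conj_by G c d = d) \<and> T = conj_by G c ` S"
  using assms(2,3)
proof (induction "card S - card (S \<inter> T)" arbitrary: S T rule: less_induct)
  case less
  note S = less.prems(1) and T = less.prems(2)
  have Sp: "p_subgroup p G S" and S': "subgroup S G" and Tp: "p_subgroup p G T" and T': "subgroup T G"
    using S T by (auto simp: sylow_subgroup_def p_subgroup_def)
  have eqST: "card S = card T" by (rule sylow_subgroup_card_eq[OF S T])
  define D where "D = S \<inter> T"
  have D': "subgroup D G" unfolding D_def by (rule subgroups_Inter_pair[OF S' T'])
  have DG: "D \<subseteq> carrier G" by (rule subgroup.subset[OF D'])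
  have Dp: "p_subgroup p G D" using p_subgroup_subset[OF Sp D'] by (simp add: D_def)
  show ?case
  proof (cases "D = S")
    case True
    then have "S \<subseteq> T" by (auto simp: D_def)
    then have "S = T" using card_subset_eq[OF subgroup_finite[OF T']] eqST by blast
    moreover have "\<forall>d\<in>S \<inter> T. conj_by G \<one> d = d" using DG by (auto simp: D_def)
    ultimately show ?thesis
      using conj_by_self_image[OF S' subgroup.one_closed[OF S']] one_closed by metis
  next
    case False
    then have DS: "D \<subset> S" by (auto simp: D_def)
    have DT: "D \<subset> T"
    proof -
      have "D \<noteq> T"
      proof
        assume "D = T"
        then have "T \<subseteq> S" by (auto simp: D_def)
        then have "T = S" using card_subset_eq[OF subgroup_finite[OF S']] eqST by simp
        then show False using False by (simp add: D_def)
      qed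
      then show ?thesis by (auto simp: D_def)
    qed
    define N where "N = {g \<in> carrier G. conj_by G g ` D = D}"
    have N: "subgroup N G" unfolding N_def by (rule subgroup_normalizer[OF DG])
    have Nn: "conj_by G g ` D = D" if "g \<in> N" for g using that by (simp add: N_def)
    have NG: "g \<in> N \<Longrightarrow> g \<in> carrier G" for g by (simp add: N_def)
    have DN: "D \<subseteq> N" using DG conj_by_self_image[OF D'] by (auto simp: N_def)
    let ?L = "G\<lparr>carrier := N\<rparr>"
    interpret L: fin_grp ?L p by (rule fin_grp_subgroup[OF N])
    obtain x where x: "x \<in> S - D" "conj_by G x ` D = D"
      using p_subgroup_normalizer_grows[OF Sp D' DS] by blast
    obtain y where y: "y \<in> T - D" "conj_by G y ` D = D"
      using p_subgroup_normalizer_grows[OF Tp D' DT] by blast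
    have xN: "x \<in> N" using x S' subgroup.mem_carrier[of S G x] by (simp add: N_def)
    have yN: "y \<in> N" using y T' subgroup.mem_carrier[of T G y] by (simp add: N_def)
    have inL: "p_subgroup p ?L (A \<inter> N)" if "p_subgroup p G A" for A
    proof -
      have "subgroup (A \<inter> N) G" using that N by (simp add: p_subgroup_def subgroups_Inter_pair)
      then show ?thesis using that p_subgroup_subset[OF that] p_subgroup_of_subgroup[OF N] by simp
    qed
    obtain S0 where S0: "sylow_subgroup p ?L S0" "S \<inter> N \<subseteq> S0"
      using L.p_subgroup_in_sylow[OF inL[OF Sp]] by blast
    obtain T0 where T0: "sylow_subgroup p ?L T0" "T \<inter> N \<subseteq> T0"
      using L.p_subgroup_in_sylow[OF inL[OF Tp]] by blast
    obtain n where n: "n \<in> N" "T0 = conj_by ?L n ` S0"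
      using L.sylow_subgroups_conj[OF S0(1) T0(1)] by auto
    then have n': "T0 = conj_by G n ` S0" using conj_by_of_subgroup[OF N] by simp
    have S0p: "p_subgroup p G S0" "S0 \<subseteq> N"
      using S0(1) p_subgroup_of_subgroup[OF N] by (auto simp: sylow_subgroup_def)
    have S0': "subgroup S0 G" using S0p by (simp add: p_subgroup_def)
    have S0G: "S0 \<subseteq> carrier G" using S0p NG by blast
    obtain c s where c: "c \<in> N" "\<forall>d\<in>D. conj_by G c d = d" and s: "s \<in> S0" and ncs: "n = c \<otimes> s"
      using normalizer_factorization[OF triv Dp N Nn S0(1) n(1)] by blast
    have cG: "c \<in> carrier G" using c NG by blast
    \<comment> \<open>The factor \<open>s\<close> normalizes \<open>S0\<close>, so the conjugating
      element \<open>n\<close> may be replaced by \<open>c\<close>, which centralizes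
      \<open>D\<close>.\<close>
    have T0c: "T0 = conj_by G c ` S0"
      using n' ncs conj_by_set_comp[OF cG _ S0G, of s] s S0G conj_by_self_image[OF S0' s] by auto
    obtain S1 where S1: "sylow_subgroup p G S1" "S0 \<subseteq> S1"
      using p_subgroup_in_sylow[OF S0p(1)] by blast
    have S1': "subgroup S1 G" using S1 by (simp add: sylow_subgroup_def p_subgroup_def)
    define T1 where "T1 = conj_by G c ` S1"
    have T1: "sylow_subgroup p G T1" unfolding T1_def by (rule sylow_subgroup_conj_by[OF S1(1) cG])
    have T1': "subgroup T1 G" using T1 by (simp add: sylow_subgroup_def p_subgroup_def)
    have T01: "T0 \<subseteq> T1" using T0c S1(2) by (auto simp: T1_def)
    \<comment> \<open>The path is from \<open>S\<close> to \<open>S1\<close>, by \<open>c\<close> to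
      \<open>T1\<close>, then to \<open>T\<close>. The intersections of \<open>S\<close> with
      \<open>S1\<close> and of \<open>T1\<close> with \<open>T\<close> contain \<open>x\<close> and
      \<open>y\<close> besides \<open>D\<close>, so the induction hypothesis covers the two outer
      steps, and all three conjugating elements centralize \<open>D\<close>.\<close>
    have bigger: "card A - card (A \<inter> B) < card S - card (S \<inter> T)"
      if "subgroup A G" "D \<subset> A \<inter> B" "card A = card S" for A B
    proof -
      have "card D < card (A \<inter> B)" using that by (intro psubset_card_mono) auto
      moreover have "card (A \<inter> B) \<le> card A" using that by (intro card_mono) auto
      ultimately show ?thesis using that(3) by (simp add: D_def)
    qed
    have "D \<subset> S \<inter> S1" using DS DN x xN S0 S1 by blast
    then have DSS1: "D \<subset> S \<inter> S1" "card S - card (S \<inter> S1) < card S - card (S \<inter> T)"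
      using bigger[OF S'] by auto
    obtain a where a: "a \<in> carrier G" "\<forall>d\<in>S \<inter> S1. conj_by G a d = d" "S1 = conj_by G a ` S"
      using less.hyps[OF DSS1(2) S S1(1)] by blast
    have "D \<subset> T1 \<inter> T" using DT DN y yN T0 T01 by blast
    then have DTT1: "D \<subset> T1 \<inter> T" "card T1 - card (T1 \<inter> T) < card S - card (S \<inter> T)"
      using bigger[OF T1'] sylow_subgroup_card_eq[OF T1 S] by auto
    obtain b where b: "b \<in> carrier G" "\<forall>d\<in>T1 \<inter> T. conj_by G b d = d" "T = conj_by G b ` T1"
      using less.hyps[OF DTT1(2) T1 T] by blast
    have SG: "S \<subseteq> carrier G" by (rule subgroup.subset[OF S'])
    have "T = conj_by G (b \<otimes> (c \<otimes> a)) ` S"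
    proof -
      have "T = conj_by G b ` conj_by G c ` conj_by G a ` S" using a(3) b(3) by (simp only: T1_def)
      moreover have "conj_by G a ` S \<subseteq> carrier G" using a(1) SG by auto
      ultimately show ?thesis using conj_by_set_comp a(1) b(1) cG SG m_closed by metis
    qed
    moreover have "\<forall>d\<in>D. conj_by G (b \<otimes> (c \<otimes> a)) d = d"
    proof
      fix d assume d: "d \<in> D"
      then have "d \<in> carrier G" "conj_by G a d = d" "conj_by G c d = d" "conj_by G b d = d"
        using DG a(2) b(2) c(2) DSS1(1) DTT1(1) by blast+
      then show "conj_by G (b \<otimes> (c \<otimes> a)) d = d" using a(1) b(1) cG by (simp add: conj_by_comp)
    qed
    moreover have "b \<otimes> (c \<otimes> a) \<in> carrier G" using a(1) b(1) cG by simp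
    ultimately show ?thesis unfolding D_def by blast
  qed
qed

text \<open>With \<open>T\<close> the conjugate of \<open>S\<close> by \<open>inv g\<close>, the
  element \<open>x\<close> lies in \<open>S \<inter> T\<close>. Some \<open>c\<close> centralizing
  \<open>x\<close> takes \<open>S\<close> to \<open>T\<close>, so \<open>g \<otimes> c\<close>
  normalizes \<open>S\<close> and factors as an element centralizing \<open>S\<close> times an
  element \<open>s\<close> of \<open>S\<close>; this \<open>s\<close> acts on \<open>x\<close> as
  \<open>g\<close> does.\<close>

lemma sylow_controls_fusion:
  assumes triv: "p_regular_act_trivially p G" and S: "sylow_subgroup p G S"
    and x: "x \<in> S" and g: "g \<in> carrier G" and gx: "conj_by G g x \<in> S"
  shows "\<exists>s\<in>S. conj_by G g x = conj_by G s x"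
proof -
  have Sp: "p_subgroup p G S" and S': "subgroup S G"
    using S by (auto simp: sylow_subgroup_def p_subgroup_def)
  have SG: "S \<subseteq> carrier G" by (rule subgroup.subset[OF S'])
  have xG: "x \<in> carrier G" using x SG by blast
  define T where "T = conj_by G (inv g) ` S"
  have T: "sylow_subgroup p G T" unfolding T_def by (rule sylow_subgroup_conj_by[OF S]) (use g in simp)
  have xT: "x \<in> T" using gx g xG by (force simp: T_def intro: rev_image_eqI)
  obtain c where c: "c \<in> carrier G" "\<forall>d\<in>S \<inter> T. conj_by G c d = d" "T = conj_by G c ` S"
    using sylow_conj_centralizing_inter[OF triv S T] by blast
  define N where "N = {h \<in> carrier G. conj_by G h ` S = S}"
  have N: "subgroup N G" unfolding N_def by (rule subgroup_normalizer[OF SG])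
  have "conj_by G (g \<otimes> c) ` S = conj_by G g ` conj_by G (inv g) ` S"
    using conj_by_set_comp[OF g c(1) SG] c(3) by (simp only: T_def)
  also have "\<dots> = id ` S" unfolding image_image by (rule image_cong) (use g SG in \<open>simp_all add: subset_iff\<close>)
  finally have gcN: "g \<otimes> c \<in> N" using g c(1) by (simp add: N_def)
  have SN: "S \<subseteq> N" using SG conj_by_self_image[OF S'] by (auto simp: N_def)
  have "\<not> p dvd card (rcosets\<^bsub>G\<lparr>carrier := N\<rparr>\<^esub> S)"
    using index_factor_order[OF N S' SN] S
    by (auto simp: sylow_subgroup_def factor_order_def order_def FactGroup_def intro: dvd_mult)
  then have SL: "sylow_subgroup p (G\<lparr>carrier := N\<rparr>) S"
    using Sp SN p_subgroup_of_subgroup[OF N] by (simp add: sylow_subgroup_def)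
  obtain c' s where c': "c' \<in> N" "\<forall>d\<in>S. conj_by G c' d = d" and s: "s \<in> S" and eq: "g \<otimes> c = c' \<otimes> s"
    using normalizer_factorization[OF triv Sp N _ SL gcN] by (auto simp: N_def)
  have "conj_by G c x = x" using c(2) x xT by blast
  then have "conj_by G g x = conj_by G (c' \<otimes> s) x"
    using conj_by_comp[OF g c(1) xG] by (simp add: eq)
  also have "\<dots> = conj_by G c' (conj_by G s x)"
    using c'(1) s SG xG by (simp add: conj_by_comp N_def subsetD)
  also have "\<dots> = conj_by G s x" using c'(2) conj_by_subgroup[OF S' s x] by blast
  finally show ?thesis using s by blast
qed

text \<open>Transfer to \<open>S/U\<close>, where \<open>U\<close> is normal of index
  \<open>p\<close> in the Sylow subgroup \<open>S\<close>. An element of \<open>S\<close> outside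
  \<open>U\<close> is sent to a power of its coset with exponent the index of \<open>S\<close>,
  which is prime to \<open>p\<close>, so the transfer is onto a group of order \<open>p\<close>. Its
  kernel is the required subgroup.\<close>

lemma normal_index_p_exists:
  assumes triv: "p_regular_act_trivially p G" and dv: "p dvd card (carrier G)"
  shows "\<exists>M. M \<lhd> G \<and> card (carrier G) = p * card M"
proof -
  obtain S where S: "sylow_subgroup p G S" using sylow_subgroup_exists by blast
  have Sp: "p_subgroup p G S" and S': "subgroup S G" and idx: "\<not> p dvd card (rcosets S)"
    using S by (auto simp: sylow_subgroup_def p_subgroup_def)
  have "S \<noteq> {\<one>}" using lagrange'[OF S'] idx dv by auto
  then have "{\<one>} \<subset> S" using subgroup.one_closed[OF S'] by blast
  then obtain U where U: "U \<lhd> G\<lparr>carrier := S\<rparr>" "card S = p * card U"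
    using p_subgroup_maximal[OF Sp triv_subgroup] by blast
  let ?L = "G\<lparr>carrier := S\<rparr>"
  let ?A = "?L Mod U"
  interpret L: fin_grp ?L p by (rule fin_grp_subgroup[OF S'])
  interpret U: normal U ?L by (rule U(1))
  have oA: "order ?A = p" and A: "comm_group ?A"
    using L.normal_index_p(1,2)[OF U(1)] U(2) by auto
  interpret A: comm_group ?A by (rule A)
  have \<phi>: "(\<lambda>a. U #>\<^bsub>?L\<^esub> a) \<in> hom ?L ?A" by (rule U.r_coset_hom_Mod)
  have \<phi>_cl: "U #> s \<in> carrier ?A" if "s \<in> S" for s using \<phi> that by (auto simp: hom_def)
  have "\<exists>V\<in>hom G ?A. \<forall>s\<in>S. V s = (U #>\<^bsub>?L\<^esub> s) [^]\<^bsub>?A\<^esub> card (rcosets S)"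
  proof (rule transfer_hom[OF S' A \<phi>])
    fix g s assume g: "g \<in> carrier G" and s: "s \<in> S" "conj_by G g s \<in> S"
    then obtain t where t: "t \<in> S" "conj_by G g s = conj_by G t s"
      using sylow_controls_fusion[OF triv S] by blast
    \<comment> \<open>By control of fusion the conjugating element may be taken in \<open>S\<close>,
      and \<open>S/U\<close> is abelian; this is the stability that \<open>transfer_hom\<close> asks
      for.\<close>
    have "U #> (t \<otimes> s) = U #> (s \<otimes> t)"
      using A.m_comm[OF \<phi>_cl[OF t(1)] \<phi>_cl[OF s(1)]] U.rcos_sum[of t s] U.rcos_sum[of s t] t s by simp
    then have "(U #>\<^bsub>?L\<^esub> (t \<otimes>\<^bsub>?L\<^esub> s)) <#>\<^bsub>?L\<^esub> (U #>\<^bsub>?L\<^esub> inv t) = (U #>\<^bsub>?L\<^esub> (s \<otimes>\<^bsub>?L\<^esub> t)) <#>\<^bsub>?L\<^esub> (U #>\<^bsub>?L\<^esub> inv t)"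
      by simp
    then have "U #>\<^bsub>?L\<^esub> (t \<otimes> s \<otimes> inv t) = U #>\<^bsub>?L\<^esub> (s \<otimes> t \<otimes> inv t)"
      using U.rcos_sum[of "t \<otimes> s" "inv t"] U.rcos_sum[of "s \<otimes> t" "inv t"] t s S'
      by (simp add: subgroup.m_closed subgroup.m_inv_closed)
    moreover have "s \<otimes> t \<otimes> inv t = s" using t s S' by (simp add: grp_simps subgroup.mem_carrier)
    ultimately show "U #>\<^bsub>?L\<^esub> conj_by G g s = U #>\<^bsub>?L\<^esub> s"
      using t(2) by (simp add: conj_by_def)
  qed
  then obtain V where V: "V \<in> hom G ?A" "\<And>s. s \<in> S \<Longrightarrow> V s = (U #> s) [^]\<^bsub>?A\<^esub> card (rcosets S)"
    by auto
  interpret V: group_hom G ?A V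
    using V(1) by (simp add: group_hom_def group_hom_axioms_def)
  have finA: "finite (carrier ?A)" using A.order_gt_0_iff_finite oA p_gt_1 by simp
  interpret Af: fin_grp ?A p by unfold_locales (use finA prime_p in auto)
  have "U \<noteq> S" using U(2) subgroup_card_pos[OF S'] p_gt_1 by auto
  then obtain s where s: "s \<in> S" "s \<notin> U" using U.subset by auto
  have Vs: "V s \<noteq> \<one>\<^bsub>?A\<^esub>"
  proof
    assume "V s = \<one>\<^bsub>?A\<^esub>"
    then have 1: "(U #> s) [^]\<^bsub>?A\<^esub> card (rcosets S) = \<one>\<^bsub>?A\<^esub>" using V(2) s by simp
    have 2: "(U #> s) [^]\<^bsub>?A\<^esub> p = \<one>\<^bsub>?A\<^esub>"
      using A.pow_order_eq_1[OF \<phi>_cl[OF s(1)]] oA by simp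
    have "coprime (card (rcosets S)) p"
      using idx prime_p by (simp add: coprime_commute prime_imp_coprime)
    then have "U #> s = U" using Af.pow_coprime_eq_one[OF \<phi>_cl[OF s(1)] 1 2] by simp
    then show False using s L.coset_join1[of U s] U.is_subgroup U.subset by simp
  qed
  have img: "subgroup (V ` carrier G) ?A" by (rule V.img_is_subgroup)
  have "V ` carrier G = carrier ?A"
  proof -
    have "card (V ` carrier G) dvd p" using Af.lagrange'[OF img] oA by (metis dvd_triv_right order_def)
    moreover have "card (V ` carrier G) \<noteq> 1"
    proof
      assume "card (V ` carrier G) = 1"
      then obtain z where "V ` carrier G = {z}" by (auto simp: card_1_singleton_iff)
      moreover have "V s \<in> V ` carrier G" "V \<one> \<in> V ` carrier G"
        using s(1) subgroup.mem_carrier[OF S'] by blast+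
      ultimately have "V s = V \<one>" by simp
      then show False using Vs by simp
    qed
    ultimately have "card (V ` carrier G) = p" using prime_p prime_nat_iff by blast
    then show ?thesis
      using card_subset_eq[OF finA subgroup.subset[OF img]] oA by (simp add: order_def)
  qed
  then have "G Mod kernel G ?A V \<cong> ?A" by (rule V.FactGroup_iso)
  then have "order (G Mod kernel G ?A V) = p" using iso_same_order oA unfolding is_iso_def by fastforce
  then have "card (carrier G) = p * card (kernel G ?A V)"
    using lagrange'[OF V.subgroup_kernel] by (simp add: order_def FactGroup_def)
  then show ?thesis using V.normal_kernel by blast
qed

end

text \<open>A normal subgroup of index \<open>p\<close> contains all \<open>p\<close>-regular
  elements and inherits the hypothesis. Descending in this way ends at a group of order prime to
  \<open>p\<close>, whose elements are all \<open>p\<close>-regular. Describing the complement as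
  the set of \<open>p\<close>-regular elements makes it invariant under conjugation in every larger
  group.\<close>

theorem normal_p_complement_exists:
  assumes "fin_grp G p" and "p_regular_act_trivially p G"
  shows "{x. p_regular p G x} \<lhd> G \<and> \<not> p dvd card {x. p_regular p G x} \<and>
    (\<exists>k. card (carrier G) = card {x. p_regular p G x} * p ^ k)"
  using assms
proof (induction "card (carrier G)" arbitrary: G rule: less_induct)
  case (less G)
  interpret fin_grp G p by (rule less.prems(1))
  show ?case
  proof (cases "p dvd card (carrier G)")
    case False
    then have "coprime (card (carrier G)) p"
      using prime_p by (simp add: coprime_commute prime_imp_coprime)
    then have "{x. p_regular p G x} = carrier G"
      using p_regular_of_order[OF subgroup_self] by (auto simp: p_regular_def)
    then show ?thesis using False normal_self by (auto intro: exI[of _ 0])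
  next
    case True
    then obtain M where M: "M \<lhd> G" "card (carrier G) = p * card M"
      using normal_index_p_exists[OF less.prems(2)] by blast
    have M': "subgroup M G" using M by (simp add: normal_iff_conj_by)
    let ?M = "G\<lparr>carrier := M\<rparr>"
    have "card (carrier ?M) < card (carrier G)" using M(2) subgroup_card_pos[OF M'] p_gt_1 by simp
    note ih = less.hyps[OF this fin_grp_subgroup[OF M'] p_regular_act_trivially_subgroup[OF less.prems(2) M']]
    have inM: "x \<in> M" if x: "p_regular p G x" for x
    proof -
      obtain n where n: "coprime n p" "x [^]\<^bsub>G\<^esub> (n::nat) = \<one>\<^bsub>G\<^esub>" and xG: "x \<in> carrier G"
        using x by (auto simp: p_regular_def)
      have "x [^]\<^bsub>G\<^esub> n \<in> M" using n subgroup.one_closed[OF M'] by simp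
      moreover have "x [^]\<^bsub>G\<^esub> p \<in> M" by (rule normal_index_p(3)[OF M xG])
      ultimately show ?thesis using pow_coprime_mem[OF M' xG] n(1) by blast
    qed
    then have eq: "{x. p_regular p ?M x} = {x. p_regular p G x}"
      using p_regular_of_subgroup[OF M'] by auto
    obtain k where k: "card M = card {x. p_regular p G x} * p ^ k" using ih eq by auto
    have "card (carrier G) = card {x. p_regular p G x} * p ^ Suc k"
      using M(2) k by simp
    moreover have "{x. p_regular p G x} \<lhd> G"
      unfolding normal_iff_conj_by
      using ih eq normal_of_subgroup_iff[OF M'] p_regular_conj_by by auto
    ultimately show ?thesis using ih eq by metis
  qed
qed

section \<open>Chief factors\<close>

context fin_grp
begin

lemma normalD: "N \<lhd> G \<Longrightarrow> subgroup N G" "N \<lhd> G \<Longrightarrow> g \<in> carrier G \<Longrightarrow> x \<in> N \<Longrightarrow> conj_by G g x \<in> N"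
  using normal_iff_conj_by by blast+

lemma normal_subset_carrier: "N \<lhd> G \<Longrightarrow> N \<subseteq> carrier G"
  using normalD(1) subgroup.subset by blast

lemma normal_conj_by_image:
  assumes "N \<lhd> G" "g \<in> carrier G" shows "conj_by G g ` N = N"
proof (rule card_subset_eq)
  show "conj_by G g ` N \<subseteq> N" using normalD(2)[OF assms] by blast
  show "card (conj_by G g ` N) = card N" by (rule subgroup_conj_by_image(2)[OF assms(2) normalD(1)[OF assms(1)]])
qed (use normalD(1)[OF assms(1)] in simp)

lemma normal_Int: "M \<lhd> G \<Longrightarrow> N \<lhd> G \<Longrightarrow> M \<inter> N \<lhd> G"
  using normal_subgroup_intersect by blast

lemma normal_restrict: "N \<lhd> G \<Longrightarrow> subgroup H G \<Longrightarrow> N \<subseteq> H \<Longrightarrow> N \<lhd> G\<lparr>carrier := H\<rparr>"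
  using normal_of_subgroup_iff normalD subgroup.mem_carrier by metis

lemma chief_factorD:
  assumes "chief_factor G H K"
  shows "H \<lhd> G" "K \<lhd> G" "K \<subset> H" "subgroup H G" "subgroup K G"
    and "N \<lhd> G \<Longrightarrow> K \<subseteq> N \<Longrightarrow> N \<subseteq> H \<Longrightarrow> N = K \<or> N = H"
  using assms normalD(1) by (auto simp: chief_factor_def)

lemma pow_factor_order_mem:
  assumes H: "subgroup H G" and K: "K \<lhd> G" "K \<subseteq> H" and h: "h \<in> H"
  shows "h [^] factor_order G H K \<in> K"
proof -
  let ?L = "G\<lparr>carrier := H\<rparr>"
  interpret L: fin_grp ?L p by (rule fin_grp_subgroup[OF H])
  interpret K: normal K ?L by (rule normal_restrict[OF K(1) H K(2)])
  interpret Q: group "?L Mod K" by (rule K.factorgroup_is_group)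
  have "K #>\<^bsub>?L\<^esub> h \<in> carrier (?L Mod K)" using h by (auto simp: carrier_FactGroup)
  then have "(K #>\<^bsub>?L\<^esub> h) [^]\<^bsub>?L Mod K\<^esub> order (?L Mod K) = K" using Q.pow_order_eq_1 by simp
  then have "K #>\<^bsub>?L\<^esub> (h [^]\<^bsub>?L\<^esub> factor_order G H K) = K"
    using h K.FactGroup_pow by (simp add: factor_order_def)
  moreover have "h [^]\<^bsub>?L\<^esub> factor_order G H K \<in> carrier ?L" by (rule L.nat_pow_closed) (use h in simp)
  ultimately have "h [^]\<^bsub>?L\<^esub> factor_order G H K \<in> K"
    using L.coset_join1[OF _ _ K.is_subgroup] by blast
  then show ?thesis by (simp add: nat_pow_consistent[symmetric])
qed

lemma chief_factor_below:
  assumes N: "N \<lhd> G" and K: "K \<lhd> G" "K \<subset> N"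
  shows "\<exists>L. chief_factor G N L \<and> K \<subseteq> L"
proof -
  define F where "F = {L. L \<lhd> G \<and> L \<subset> N}"
  have "F \<subseteq> Pow N" by (auto simp: F_def)
  then have "finite F" using subgroup_finite[OF normalD(1)[OF N]] finite_subset by (metis finite_Pow_iff)
  moreover have "K \<in> F" using K by (simp add: F_def)
  ultimately have "\<exists>L\<in>F. K \<subseteq> L \<and> (\<forall>V\<in>F. L \<subseteq> V \<longrightarrow> L = V)" by (rule finite_has_maximal2)
  then obtain L where L: "L \<in> F" "K \<subseteq> L" "\<forall>V\<in>F. L \<subseteq> V \<longrightarrow> L = V" by blast
  then have "chief_factor G N L" using N by (auto simp: chief_factor_def F_def)
  then show ?thesis using L(2) by blast
qed

lemma card_set_mult:
  assumes N: "N \<lhd> G" and H: "subgroup H G"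
  shows "card (N <#> H) * card (N \<inter> H) = card N * card H"
proof -
  interpret second_isomorphism_grp N G H
    using assms by (simp add: second_isomorphism_grp_def second_isomorphism_grp_axioms_def)
  have NH: "subgroup (N <#> H) G" by (rule normal_set_mult_subgroup)
  have sub: "N \<subseteq> N <#> H" using H_contained_in_set_mult by blast
  have I: "subgroup (N \<inter> H) G" using subgroups_Inter_pair normalD(1)[OF N] H by blast
  have "factor_order G H (N \<inter> H) = factor_order G (N <#> H) N"
    unfolding factor_order_def by (rule iso_same_order[OF normal_intersection_quotient_isom])
  then have "factor_order G (N <#> H) N * card (N \<inter> H) = card H"
    using factor_order_mult_card[OF H I] by simp
  moreover have "factor_order G (N <#> H) N * card N = card (N <#> H)"
    by (rule factor_order_mult_card[OF NH normalD(1)[OF N] sub])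
  ultimately show ?thesis by (metis mult.assoc mult.commute)
qed

lemma set_mult_Int_modular:
  assumes "subgroup L G" "N \<subseteq> L" "H \<subseteq> carrier G"
  shows "(N <#> H) \<inter> L = N <#> (H \<inter> L)"
proof
  show "N <#> (H \<inter> L) \<subseteq> (N <#> H) \<inter> L"
    using set_mult_in_subgroup[OF assms(1,2), of "H \<inter> L"] by (auto simp: set_mult_def)
  show "(N <#> H) \<inter> L \<subseteq> N <#> (H \<inter> L)"
  proof
    fix x assume "x \<in> (N <#> H) \<inter> L"
    then obtain n h where nh: "n \<in> N" "h \<in> H" "x = n \<otimes> h" "x \<in> L" by (auto simp: set_mult_def)
    have LG: "y \<in> L \<Longrightarrow> y \<in> carrier G" for y using assms(1) subgroup.mem_carrier by metis
    have "inv n \<otimes> x \<in> L" using nh assms by (meson subgroup.m_closed subgroup.m_inv_closed subsetD)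
    moreover have "inv n \<otimes> x = h" using nh assms LG by (simp add: mult_inv_cancel subset_iff)
    ultimately show "x \<in> N <#> (H \<inter> L)" using nh by (auto simp: set_mult_def)
  qed
qed

text \<open>As \<open>H/K\<close> is chief and \<open>N \<inter> H\<close> is not inside
  \<open>K\<close>, the product of \<open>K\<close> and \<open>N \<inter> H\<close> is
  \<open>H\<close>. So the new factor is isomorphic to \<open>H/K\<close>; the orders are compared
  by counting.\<close>

lemma chief_factor_Int:
  assumes HK: "chief_factor G H K" and N: "N \<lhd> G" and ni: "\<not> N \<inter> H \<subseteq> K"
  shows "chief_factor G (N \<inter> H) (N \<inter> K)"
    and "factor_order G (N \<inter> H) (N \<inter> K) = factor_order G H K"
proof -
  note H = chief_factorD(1)[OF HK] and K = chief_factorD(2)[OF HK] and KH = chief_factorD(3)[OF HK]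
  note sH = normalD(1)[OF H] and sK = normalD(1)[OF K]
  have prodH: "K <#> L = H" if L: "L \<lhd> G" "L \<subseteq> H" "\<not> L \<subseteq> K" for L
  proof -
    have "K <#> L \<lhd> G" using normal_subgroup_set_mult_closed[OF K L(1)] .
    moreover have "K \<subseteq> K <#> L"
      by (rule subset_set_mult_left[OF normalD(1)[OF L(1)] normal_subset_carrier[OF K]])
    moreover have "L \<subseteq> K <#> L"
      by (rule subset_set_mult_right[OF sK normal_subset_carrier[OF L(1)]])
    moreover have "K <#> L \<subseteq> H"
      by (rule set_mult_in_subgroup[OF sH]) (use KH L(2) in auto)
    ultimately show ?thesis using chief_factorD(6)[OF HK, of "K <#> L"] L(3) by blast
  qed
  have NH: "N \<inter> H \<lhd> G" and NK: "N \<inter> K \<lhd> G" using normal_Int N H K by auto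
  show "chief_factor G (N \<inter> H) (N \<inter> K)"
    unfolding chief_factor_def
  proof (intro conjI allI impI)
    fix L assume "L \<lhd> G \<and> N \<inter> K \<subseteq> L \<and> L \<subseteq> N \<inter> H"
    then have L: "L \<lhd> G" "N \<inter> K \<subseteq> L" "L \<subseteq> N \<inter> H" by auto
    show "L = N \<inter> K \<or> L = N \<inter> H"
    proof (cases "L \<subseteq> K")
      case False
      have "N \<inter> H \<subseteq> L"
      proof
        fix x assume x: "x \<in> N \<inter> H"
        then obtain k l where kl: "k \<in> K" "l \<in> L" "x = k \<otimes> l"
          using prodH[OF L(1) _ False] L(3) by (auto simp: set_mult_def)
        have "k = x \<otimes> inv l" using kl L(1) K normal_subset_carrier by (simp add: grp_simps subset_iff)
        also have "\<dots> \<in> N"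
          using x kl(2) L(3) normalD(1)[OF N] by (meson IntD1 subgroup.m_closed subgroup.m_inv_closed subsetD)
        finally have "k \<in> L" using kl L(2) by blast
        then show "x \<in> L" using kl normalD(1)[OF L(1)] by (simp add: subgroup.m_closed)
      qed
      then show ?thesis using L(3) by blast
    qed (use L in blast)
  qed (use NH NK KH ni in auto)
  have "K <#> (N \<inter> H) = H" using prodH[OF NH] ni by blast
  then have "card H * card (K \<inter> (N \<inter> H)) = card K * card (N \<inter> H)"
    using card_set_mult[OF K normalD(1)[OF NH]] by simp
  moreover have "K \<inter> (N \<inter> H) = N \<inter> K" using KH by blast
  moreover have "factor_order G H K * card K = card H" using factor_order_mult_card[OF sH sK] KH by blast
  ultimately have "factor_order G H K * card (N \<inter> K) * card K = card (N \<inter> H) * card K"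
    by (metis mult.commute mult.left_commute)
  then have "factor_order G H K * card (N \<inter> K) = card (N \<inter> H)"
    using subgroup_card_pos[OF sK] by simp
  then show "factor_order G (N \<inter> H) (N \<inter> K) = factor_order G H K"
    using factor_order_unique normalD(1)[OF NH] normalD(1)[OF NK] KH
    by (metis Int_mono order_refl psubset_imp_subset)
qed

text \<open>Here \<open>N\<close> meets \<open>H\<close> and \<open>K\<close> in the same subgroup,
  so multiplying both by \<open>N\<close> multiplies their orders by the same number. By the modular
  law a normal subgroup between the products comes from its intersection with
  \<open>H\<close>.\<close>

lemma chief_factor_set_mult:
  assumes HK: "chief_factor G H K" and N: "N \<lhd> G" and ni: "N \<inter> H \<subseteq> K"
  shows "chief_factor G (N <#> H) (N <#> K)"
    and "factor_order G (N <#> H) (N <#> K) = factor_order G H K"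
proof -
  note H = chief_factorD(1)[OF HK] and K = chief_factorD(2)[OF HK] and KH = chief_factorD(3)[OF HK]
  note sH = normalD(1)[OF H] and sK = normalD(1)[OF K]
  have NH: "N <#> H \<lhd> G" and NK: "N <#> K \<lhd> G" using normal_subgroup_set_mult_closed N H K by auto
  have sub: "N <#> K \<subseteq> N <#> H" using KH by (auto simp: set_mult_def)
  have "N \<inter> K = N \<inter> H" using ni KH by blast
  then have "card (N <#> H) * card (N \<inter> K) = card N * (factor_order G H K * card K)"
    using card_set_mult[OF N sH] factor_order_mult_card[OF sH sK] KH by auto
  moreover have "card (N <#> K) * card (N \<inter> K) = card N * card K" by (rule card_set_mult[OF N sK])
  ultimately have "factor_order G H K * card (N <#> K) * card (N \<inter> K) = card (N <#> H) * card (N \<inter> K)"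
    by (simp add: ac_simps)
  moreover have "subgroup (N \<inter> K) G" using normalD(1)[OF normal_Int[OF N K]] .
  ultimately have card: "factor_order G H K * card (N <#> K) = card (N <#> H)"
    using subgroup_card_pos[of "N \<inter> K"] by (metis less_irrefl mult_cancel2)
  then show "factor_order G (N <#> H) (N <#> K) = factor_order G H K"
    using factor_order_unique normalD(1)[OF NH] normalD(1)[OF NK] sub by blast
  have "factor_order G H K * card K \<noteq> card K"
    using factor_order_mult_card[OF sH sK] KH psubset_card_mono[OF subgroup_finite[OF sH] KH] by auto
  then have "factor_order G H K \<noteq> 1" by auto
  then have "N <#> K \<noteq> N <#> H" using card subgroup_card_pos[OF normalD(1)[OF NH]] by auto
  moreover have "L = N <#> K \<or> L = N <#> H" if L: "L \<lhd> G" "N <#> K \<subseteq> L" "L \<subseteq> N <#> H" for L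
  proof -
    have NL: "N \<subseteq> L" and KL: "K \<subseteq> L"
      using subset_set_mult_left[OF sK normal_subset_carrier[OF N]]
        subset_set_mult_right[OF normalD(1)[OF N] normal_subset_carrier[OF K]] L(2) by auto
    have "L = (N <#> H) \<inter> L" using L(3) by blast
    also have "\<dots> = N <#> (H \<inter> L)"
      by (rule set_mult_Int_modular[OF normalD(1)[OF L(1)] NL normal_subset_carrier[OF H]])
    finally have "L = N <#> (H \<inter> L)" .
    moreover have "H \<inter> L = K \<or> H \<inter> L = H"
      by (rule chief_factorD(6)[OF HK]) (use normal_Int H L(1) KH KL in auto)
    ultimately show ?thesis by auto
  qed
  ultimately show "chief_factor G (N <#> H) (N <#> K)"
    using NH NK sub by (auto simp: chief_factor_def)
qed

text \<open>The role of the Jordan-Hoelder theorem: each chief factor is matched with one of the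
  same order, below \<open>N\<close> or above \<open>N\<close> according to whether
  \<open>N \<inter> H \<subseteq> K\<close>.\<close>

lemma p_supersolvable_normal_series:
  assumes N: "N \<lhd> G"
    and below: "\<And>H K. chief_factor G H K \<Longrightarrow> H \<subseteq> N \<Longrightarrow> p dvd factor_order G H K \<Longrightarrow> factor_order G H K = p"
    and above: "\<And>H K. chief_factor G H K \<Longrightarrow> N \<subseteq> K \<Longrightarrow> p dvd factor_order G H K \<Longrightarrow> factor_order G H K = p"
  shows "p_supersolvable p G"
  unfolding p_supersolvable_def
proof (intro conjI allI impI, rule is_group, rule fin, elim conjE)
  fix H K assume HK: "chief_factor G H K" and dv: "p dvd factor_order G H K"
  show "factor_order G H K = p"
  proof (cases "N \<inter> H \<subseteq> K")
    case True
    have "N \<subseteq> N <#> K"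
      by (rule subset_set_mult_left[OF chief_factorD(5)[OF HK] normal_subset_carrier[OF N]])
    then show ?thesis using above[of "N <#> H" "N <#> K"] chief_factor_set_mult[OF HK N True] dv by simp
  next
    case False
    then show ?thesis using below[of "N \<inter> H" "N \<inter> K"] chief_factor_Int[OF HK N False] dv by simp
  qed
qed

text \<open>The join of \<open>K\<close> with the Frattini subgroup of \<open>H\<close> is normal in
  \<open>G\<close> and proper in \<open>H\<close>, hence equals \<open>K\<close>. So
  \<open>H/K\<close> is elementary abelian.\<close>

lemma chief_factor_p_subgroup:
  assumes HK: "chief_factor G H K" and H: "p_subgroup p G H"
  shows "h \<in> H \<Longrightarrow> h [^] p \<in> K"
    and "h \<in> H \<Longrightarrow> h' \<in> H \<Longrightarrow> conj_by G h h' \<otimes> inv h' \<in> K"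
proof -
  note nH = chief_factorD(1)[OF HK] and nK = chief_factorD(2)[OF HK]
  obtain L where L: "subgroup L G" "K \<subseteq> L" "L \<subset> H" and pow: "\<And>y. y \<in> H \<Longrightarrow> y [^] p \<in> L"
    and comm: "\<And>y z. y \<in> H \<Longrightarrow> z \<in> H \<Longrightarrow> conj_by G y z \<otimes> inv z \<in> L"
    and inv: "\<And>g. g \<in> carrier G \<Longrightarrow> conj_by G g ` H \<subseteq> H \<Longrightarrow> conj_by G g ` K \<subseteq> K \<Longrightarrow> conj_by G g ` L \<subseteq> L"
    by (rule p_subgroup_frattini[OF H chief_factorD(5,3)[OF HK]]) blast
  have "conj_by G g ` L \<subseteq> L" if "g \<in> carrier G" for g
    by (rule inv[OF that]) (simp_all add: normal_conj_by_image nH nK that)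
  then have "L \<lhd> G" using L(1) by (auto simp: normal_iff_conj_by)
  then have "L = K" using chief_factorD(6)[OF HK] L by blast
  then show "h \<in> H \<Longrightarrow> h [^] p \<in> K"
    and "h \<in> H \<Longrightarrow> h' \<in> H \<Longrightarrow> conj_by G h h' \<otimes> inv h' \<in> K"
    using pow comm by auto
qed

text \<open>Descend along chief factors \<open>B/K\<close>. If \<open>p\<close> divides the order of
  the factor, the commutator of \<open>x\<close> and \<open>d\<close> lies in \<open>K\<close>, is
  fixed by \<open>x\<close> by induction, and so is trivial by
  \<open>p_regular_shift_trivial\<close>. Otherwise the \<open>p\<close>-element \<open>d\<close>
  already lies in \<open>K\<close>.\<close>

lemma p_regular_centralizes_series:
  assumes D: "p_subgroup p G D" and x: "p_regular p G x" and inv: "\<And>d. d \<in> D \<Longrightarrow> conj_by G x d \<in> D"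
    and "B \<lhd> G"
    and "\<And>H K h. chief_factor G H K \<Longrightarrow> H \<subseteq> B \<Longrightarrow> p dvd factor_order G H K \<Longrightarrow> h \<in> H \<Longrightarrow>
           conj_by G x h \<otimes> inv h \<in> K"
    and "d \<in> D" "d \<in> B"
  shows "conj_by G x d = d"
  using assms(4-)
proof (induction "card B" arbitrary: B d rule: less_induct)
  case less
  note B = less.prems(1) and act = less.prems(2) and d = less.prems(3,4)
  have D': "subgroup D G" using D by (simp add: p_subgroup_def)
  have xG: "x \<in> carrier G" using x by (simp add: p_regular_def)
  have dG: "d \<in> carrier G" using d D' subgroup.mem_carrier by metis
  show ?case
  proof (cases "B = {\<one>}")
    case True
    then show ?thesis using d xG by simp
  next
    case False
    then have "{\<one>} \<subset> B" using subgroup.one_closed[OF normalD(1)[OF B]] by blast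
    then obtain K where BK: "chief_factor G B K" using chief_factor_below[OF B one_is_normal] by blast
    note K = chief_factorD(2,3,5)[OF BK]
    have lt: "card K < card B" using K(2) subgroup_finite[OF normalD(1)[OF B]] by (rule psubset_card_mono[rotated])
    have ih: "conj_by G x e = e" if "e \<in> D" "e \<in> K" for e
      by (rule less.hyps[OF lt K(1) _ that]) (use act K(2) in blast)
    show ?thesis
    proof (cases "p dvd factor_order G B K")
      case True
      define c where "c = inv d \<otimes> conj_by G x d"
      have cD: "c \<in> D" using d(1) inv D' by (simp add: c_def subgroup.m_closed subgroup.m_inv_closed)
      have cG: "c \<in> carrier G" using cD D' subgroup.mem_carrier by metis
      have "conj_by G (inv d) (conj_by G x d \<otimes> inv d) \<in> K"
        using normalD(2)[OF K(1)] act[OF BK order_refl True d(2)] dG by blast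
      then have cK: "c \<in> K" using dG xG by (simp add: c_def conj_by_def grp_simps)
      obtain k where k: "c [^] (p ^ k) = \<one>" using p_subgroup_pow[OF D cD] by blast
      have dc: "conj_by G x d = d \<otimes> c" using dG xG by (simp add: c_def grp_simps)
      have "c = \<one>" by (rule p_regular_shift_trivial[OF x dG cG dc ih[OF cD cK] k])
      then show ?thesis using dc dG by simp
    next
      case False
      obtain k where k: "d [^] (p ^ k) = \<one>" using p_subgroup_pow[OF D d(1)] by blast
      have "d [^] factor_order G B K \<in> K"
        using pow_factor_order_mem[OF normalD(1)[OF B] K(1) _ d(2)] K(2) by blast
      moreover have "d [^] (p ^ k) \<in> K" using k subgroup.one_closed[OF K(3)] by simp
      moreover have "coprime (factor_order G B K) (p ^ k)"
        using False prime_p by (simp add: coprime_commute prime_imp_coprime)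
      ultimately have "d \<in> K" by (rule pow_coprime_mem[OF K(3) dG])
      then show ?thesis using ih d(1) by blast
    qed
  qed
qed

end

section \<open>Eigenvectors and minimal normal subgroups\<close>

text \<open>This is \<open>f(T) v\<close> in multiplicative notation, evaluated by Horner's scheme.
  Integer coefficients serve as exponents, so an elementary abelian group can be used without making
  it a vector space over the prime field.\<close>

definition poly_act :: "('a, 'b) monoid_scheme \<Rightarrow> ('a \<Rightarrow> 'a) \<Rightarrow> 'a \<Rightarrow> int poly \<Rightarrow> 'a" where
  "poly_act G T v = (\<lambda>f. fold_coeffs (\<lambda>a w. v [^]\<^bsub>G\<^esub> a \<otimes>\<^bsub>G\<^esub> T w) f \<one>\<^bsub>G\<^esub>)"

definition factor_centralizer :: "('a, 'b) monoid_scheme \<Rightarrow> 'a set \<Rightarrow> 'a set \<Rightarrow> 'a set" where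
  "factor_centralizer G H K = {g \<in> carrier G. \<forall>h\<in>H. conj_by G g h \<otimes>\<^bsub>G\<^esub> inv\<^bsub>G\<^esub> h \<in> K}"

section \<open>Endomorphisms as an action of integer polynomials\<close>

context comm_group
begin

context
  fixes T v
  assumes T: "T \<in> hom G G" and v: "v \<in> carrier G"
begin

lemma endo_closed: "x \<in> carrier G \<Longrightarrow> T x \<in> carrier G"
  using T by (auto simp: hom_def)

lemma endo_mult: "x \<in> carrier G \<Longrightarrow> y \<in> carrier G \<Longrightarrow> T (x \<otimes> y) = T x \<otimes> T y"
  using T by (auto simp: hom_def)

lemma endo_one: "T \<one> = \<one>"
  using hom_one[OF T] by simp

lemma endo_int_pow: "x \<in> carrier G \<Longrightarrow> T (x [^] (c::int)) = T x [^] c"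
  using group_hom.hom_int_pow[of G G T x c] T by (simp add: group_hom_def group_hom_axioms_def)

lemma poly_act_0: "poly_act G T v 0 = \<one>"
  by (simp add: poly_act_def)

lemma poly_act_pCons: "poly_act G T v (pCons a f) = v [^] a \<otimes> T (poly_act G T v f)"
  \<comment> \<open>\<open>pCons 0 0\<close> is the zero polynomial, so \<open>fold_coeffs\<close>
    does no step there; both sides are then the identity because \<open>T\<close> fixes it.\<close>
  by (cases "a = 0 \<and> f = 0") (auto simp: poly_act_def endo_one)

lemma poly_act_closed: "poly_act G T v f \<in> carrier G"
  by (induction f) (simp_all add: poly_act_0 poly_act_pCons endo_closed v)

lemma poly_act_add: "poly_act G T v (f + g) = poly_act G T v f \<otimes> poly_act G T v g"
proof (induction f g rule: poly_induct2)
  case (pCons a f b g)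
  have "poly_act G T v (pCons a f + pCons b g)
      = (v [^] a \<otimes> v [^] b) \<otimes> (T (poly_act G T v f) \<otimes> T (poly_act G T v g))"
    by (simp add: poly_act_pCons pCons.IH endo_mult poly_act_closed int_pow_mult v)
  then show ?case by (simp add: poly_act_pCons v endo_closed poly_act_closed m_ac)
qed (simp add: poly_act_0)

lemma poly_act_smult: "poly_act G T v (Polynomial.smult c f) = poly_act G T v f [^] c"
proof (induction f)
  case (pCons a f)
  have "poly_act G T v (Polynomial.smult c (pCons a f)) = v [^] (a * c) \<otimes> T (poly_act G T v f) [^] c"
    by (simp add: poly_act_pCons pCons.IH endo_int_pow poly_act_closed mult.commute)
  then show ?case
    by (simp add: poly_act_pCons int_pow_distrib int_pow_pow v endo_closed poly_act_closed)
qed (simp add: poly_act_0)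

lemma poly_act_monom: "poly_act G T v (Polynomial.monom 1 n) = (T ^^ n) v"
proof (induction n)
  case 0
  show ?case by (simp add: Polynomial.monom_0 poly_act_pCons poly_act_0 endo_one v)
next
  case (Suc n)
  have "poly_act G T v (Polynomial.monom 1 (Suc n)) = T (poly_act G T v (Polynomial.monom 1 n))"
    by (simp only: monom_Suc poly_act_pCons int_pow_0 l_one[OF endo_closed[OF poly_act_closed]])
  then show ?case by (simp add: Suc)
qed

lemma poly_act_linear_factor:
  "poly_act G T v ([:- c, 1:] * f) = T (poly_act G T v f) \<otimes> inv (poly_act G T v f [^] c)"
proof -
  have eq: "[:- c, 1:] * f = Polynomial.smult (- c) f + pCons 0 f" by simp
  show ?thesis
    unfolding eq poly_act_add poly_act_smult poly_act_pCons
    by (simp add: endo_closed poly_act_closed int_pow_neg m_comm)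
qed

text \<open>Split off the roots of \<open>f\<close> one at a time: either the cofactor kills \<open>v\<close> as well, or it maps \<open>v\<close>
  to an eigenvector.\<close>

lemma eigenvector_of_annihilator:
  fixes p :: nat
  assumes p: "Factorial_Ring.prime p" and vp: "v [^] p = \<one>" and v1: "v \<noteq> \<one>"
    and f: "Polynomial.degree f = d" "\<not> int p dvd Polynomial.coeff f d" "poly_act G T v f = \<one>"
    and A: "finite A" "card A = d" "\<And>a. a \<in> A \<Longrightarrow> int p dvd poly f a"
      "\<And>a b. a \<in> A \<Longrightarrow> b \<in> A \<Longrightarrow> a \<noteq> b \<Longrightarrow> \<not> int p dvd (a - b)"
  shows "\<exists>w\<in>carrier G. w \<noteq> \<one> \<and> (\<exists>c::int. T w = w [^] c)"
  using f A
proof (induction d arbitrary: f A)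
  case 0
  then obtain c where c: "f = [:c:]" by (meson degree_eq_zeroE)
  then have "v [^] c = \<one>" using 0 by (simp add: poly_act_pCons poly_act_0 endo_one v)
  then have "int (ord v) dvd c" using int_pow_eq_id[OF v] by simp
  moreover have "ord v = p"
    using vp v1 p v by (metis ord_eq_1 pow_eq_id prime_nat_iff)
  ultimately show ?case using 0 c by simp
next
  case (Suc d)
  then obtain a where a: "a \<in> A" by fastforce
  \<comment> \<open>\<open>f\<close> is \<open>X - a\<close> times \<open>q\<close> plus the
    constant \<open>poly f a\<close>, a multiple of \<open>p\<close>, which kills \<open>v\<close>.
    Thus \<open>T\<close> acts on \<open>q(T) v\<close> as the power \<open>a\<close>. If
    \<open>q(T) v\<close> is trivial, \<open>q\<close> takes over: it has the leading coefficient of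
    \<open>f\<close>, and the other roots modulo \<open>p\<close> remain its roots because
    \<open>p\<close> is prime.\<close>
  define q where "q = synthetic_div f a"
  have fq: "f = [:- a, 1:] * q + [:poly f a:]" unfolding q_def by (simp add: synthetic_div_correct' del: mult_pCons_left)
  obtain s where s: "poly f a = int p * s" using Suc.prems(6)[OF a] by (elim dvdE)
  have "v [^] poly f a = \<one>" using vp v by (simp add: s int_pow_pow[symmetric] int_pow_int)
  then have "poly_act G T v [:poly f a:] = \<one>" by (simp add: poly_act_pCons poly_act_0 endo_one)
  then have "poly_act G T v ([:- a, 1:] * q) = \<one>"
    using Suc.prems(3) fq poly_act_add[of "[:- a, 1:] * q" "[:poly f a:]"] poly_act_closed by simp
  then have eig: "T (poly_act G T v q) = poly_act G T v q [^] a"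
    unfolding poly_act_linear_factor
    by (metis endo_closed inv_closed inv_equality inv_inv int_pow_closed poly_act_closed)
  show ?case
  proof (cases "poly_act G T v q = \<one>")
    case False
    then show ?thesis using eig poly_act_closed by blast
  next
    case True
    show ?thesis
    proof (rule Suc.IH[of q "A - {a}"])
      show dq: "Polynomial.degree q = d" using Suc.prems(1) by (simp add: q_def degree_synthetic_div)
      have "Polynomial.coeff f (Suc d) = Polynomial.coeff q d"
        using arg_cong[OF fq, of "\<lambda>g. Polynomial.coeff g (Suc d)"] dq by (simp add: coeff_eq_0)
      then show "\<not> int p dvd Polynomial.coeff q d" using Suc.prems(2) by simp
      show "int p dvd poly q b" if b: "b \<in> A - {a}" for b
      proof -
        have "poly f b = (b - a) * poly q b + poly f a"
          using arg_cong[OF fq, of "\<lambda>g. poly g b"] by (simp add: algebra_simps)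
        then have "int p dvd (b - a) * poly q b"
          using Suc.prems(6)[of b] Suc.prems(6)[OF a] b by (metis DiffD1 dvd_add_left_iff)
        moreover have "\<not> int p dvd (b - a)" using Suc.prems(7)[of b a] a b by blast
        moreover have "Factorial_Ring.prime (int p)" using p by simp
        ultimately show ?thesis using prime_dvd_multD by blast
      qed
    qed (use True Suc.prems a in auto)
  qed
qed

text \<open>The polynomial is \<open>X^(p-1) - 1\<close>: periodicity says that it kills
  \<open>v\<close>, and by Fermat it has the roots \<open>1\<close> to \<open>p - 1\<close> modulo
  \<open>p\<close>, as many as its degree.\<close>

lemma eigenvector_exists:
  fixes p :: nat
  assumes p: "Factorial_Ring.prime p" and vp: "v [^] p = \<one>" and v1: "v \<noteq> \<one>"
    and per: "(T ^^ (p - 1)) v = v"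
  shows "\<exists>w\<in>carrier G. w \<noteq> \<one> \<and> (\<exists>c::int. T w = w [^] c)"
proof -
  define f :: "int poly" where "f = Polynomial.monom 1 (p - 1) + [:-1:]"
  have p1: "1 < p" using p prime_gt_1_nat by blast
  show ?thesis
  proof (rule eigenvector_of_annihilator[OF p vp v1, of f "p - 1" "int ` {1..<p}"])
    have "Polynomial.degree [:- 1 :: int:] < Polynomial.degree (Polynomial.monom (1::int) (p - 1))"
      using p1 by (simp add: degree_monom_eq)
    then show deg: "Polynomial.degree f = p - 1"
      unfolding f_def by (simp add: degree_add_eq_left degree_monom_eq)
    have "Polynomial.coeff f (p - 1) = 1" using p1 by (simp add: f_def coeff_eq_0)
    then show "\<not> int p dvd Polynomial.coeff f (p - 1)" using p1 by simp
    show "poly_act G T v f = \<one>"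
      using v per by (simp add: f_def poly_act_add poly_act_monom poly_act_pCons poly_act_0 endo_one int_pow_neg)
    show "card (int ` {1..<p}) = p - 1" by (simp add: card_image)
    show "int p dvd poly f a" if a: "a \<in> int ` {1..<p}" for a
    proof -
      obtain n where n: "a = int n" "n \<in> {1..<p}" using a by blast
      then have "\<not> p dvd n" using nat_dvd_not_less by auto
      then have "[int (n ^ (p - 1)) = int 1] (mod int p)"
        using fermat_theorem[OF p] cong_int_iff by blast
      then show ?thesis using n by (simp add: f_def poly_monom cong_iff_dvd_diff)
    qed
    show "\<not> int p dvd (a - b)" if "a \<in> int ` {1..<p}" "b \<in> int ` {1..<p}" "a \<noteq> b" for a b
    proof
      assume "int p dvd a - b"
      then have "int p \<le> \<bar>a - b\<bar>" using dvd_imp_le_int[of "a - b" "int p"] that(3) by simp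
      then show False using that by auto
    qed
  qed simp
qed

end
end

context fin_grp
begin

text \<open>\<open>V\<close> is cyclic of order \<open>p\<close>, so each conjugation acts on it as
  a power map. Power maps commute, and by Fermat the power \<open>p - 1\<close> of each is the
  identity.\<close>

lemma order_p_action:
  assumes V: "V \<lhd> G" "card V = p" and g: "g \<in> carrier G" and u: "u \<in> carrier G" and x: "x \<in> V"
  shows "conj_by G (g [^] (p - 1)) x = x"
    and "conj_by G g (conj_by G u x) = conj_by G u (conj_by G g x)"
proof -
  have V': "subgroup V G" by (rule normalD(1)[OF V(1)])
  have VG: "y \<in> V \<Longrightarrow> y \<in> carrier G" for y using V' subgroup.mem_carrier by metis
  have vp: "y [^] p = \<one>" if "y \<in> V" for y using pow_card_subgroup[OF V' that] V(2) by simp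
  have "V \<noteq> {\<one>}" using V(2) p_gt_1 by auto
  then obtain v where v: "v \<in> V" "v \<noteq> \<one>" using subgroup.one_closed[OF V'] by blast
  have "ord v dvd p" using vp[OF v(1)] pow_eq_id VG[OF v(1)] by blast
  moreover have "ord v \<noteq> 1" using v VG ord_eq_1 by blast
  ultimately have ov: "ord v = p" using prime_p prime_nat_iff by blast
  have "generate G {v} \<subseteq> V" by (rule generate_subgroup_incl[OF _ V']) (use v in simp)
  moreover have "card (generate G {v}) = card V" using generate_pow_card[OF VG[OF v(1)]] ov V(2) by simp
  ultimately have gen: "generate G {v} = V" using card_subset_eq[OF subgroup_finite[OF V']] by blast
  have nat_gen: "\<exists>n::nat. y = v [^] n" if "y \<in> V" for y
    using that gen generate_pow_on_finite_carrier[OF fin VG[OF v(1)]] by auto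
  have scalar: "\<exists>a. \<not> p dvd a \<and> (\<forall>y\<in>V. conj_by G h y = y [^] (a::nat))" if h: "h \<in> carrier G" for h
  proof -
    obtain a where a: "conj_by G h v = v [^] (a::nat)" using nat_gen normalD(2)[OF V(1) h v(1)] by blast
    have "conj_by G h y = y [^] a" if y: "y \<in> V" for y
    proof -
      obtain n where n: "y = v [^] (n::nat)" using nat_gen[OF y] by blast
      then show ?thesis using h VG[OF v(1)] a by (simp add: conj_by_pow nat_pow_pow mult.commute)
    qed
    moreover have "\<not> p dvd a"
    proof
      assume "p dvd a"
      then have "conj_by G h v = \<one>" using a ov pow_eq_id VG v(1) by simp
      then have "conj_by G h v = conj_by G h \<one>" using h by simp
      then show False using conj_by_inj[OF h] VG v by (simp add: inj_on_eq_iff)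
    qed
    ultimately show ?thesis by blast
  qed
  obtain a where a: "\<not> p dvd a" "\<forall>y\<in>V. conj_by G g y = y [^] (a::nat)" using scalar[OF g] by blast
  obtain b where b: "\<forall>y\<in>V. conj_by G u y = y [^] (b::nat)" using scalar[OF u] by blast
  show "conj_by G g (conj_by G u x) = conj_by G u (conj_by G g x)"
    using a(2) b x VG subgroup_nat_pow[OF V'] by (simp add: nat_pow_pow mult.commute)
  have "conj_by G (g [^] n) x = x [^] (a ^ n)" for n :: nat
  proof (induction n)
    case (Suc n)
    have "conj_by G (g [^] Suc n) x = conj_by G (g [^] n) x [^] a"
      using a(2) g x VG by (simp add: conj_by_comp conj_by_pow)
    then show ?case using Suc VG[OF x] by (simp add: nat_pow_pow mult.commute)
  qed (use x VG in simp)
  then have 1: "conj_by G (g [^] (p - 1)) x = x [^] (a ^ (p - 1))" .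
  have "[a ^ (p - 1) = 1] (mod p)" by (rule fermat_theorem[OF prime_p a(1)])
  then have "int (ord x) dvd int (a ^ (p - 1)) - 1"
    using vp[OF x] pow_eq_id VG[OF x]
    by (metis cong_iff_dvd_diff cong_int_iff dvd_trans int_dvd_int_iff of_nat_1)
  then have "x [^] (int (a ^ (p - 1)) - 1) = \<one>" using int_pow_eq_id[OF VG[OF x]] by simp
  then have "x [^] int (a ^ (p - 1)) \<otimes> inv x = \<one>" using int_pow_diff[OF VG[OF x], of _ 1] VG[OF x] by simp
  then show "conj_by G (g [^] (p - 1)) x = x"
    using VG[OF x] 1 by (simp add: int_pow_int inv_solve_right' del: of_nat_power)
qed

text \<open>Each \<open>g\<close> has an eigenvector in \<open>V\<close>. Since the actions commute,
  the eigenspace \<open>E\<close> is normal in \<open>G\<close>, so it is all of \<open>V\<close>.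
  Then every \<open>g\<close> acts as a power map, every cyclic subgroup of \<open>V\<close> is
  normal, and \<open>V\<close> is cyclic.\<close>

lemma minimal_normal_order_p:
  assumes V: "V \<lhd> G" "V \<noteq> {\<one>}" and min: "\<And>N. N \<lhd> G \<Longrightarrow> N \<subseteq> V \<Longrightarrow> N = {\<one>} \<or> N = V"
    and comm: "\<And>x y. x \<in> V \<Longrightarrow> y \<in> V \<Longrightarrow> x \<otimes> y = y \<otimes> x" and exp: "\<And>x. x \<in> V \<Longrightarrow> x [^] p = \<one>"
    and pow: "\<And>g x. g \<in> carrier G \<Longrightarrow> x \<in> V \<Longrightarrow> conj_by G (g [^] (p - 1)) x = x"
    and cc: "\<And>g u x. g \<in> carrier G \<Longrightarrow> u \<in> carrier G \<Longrightarrow> x \<in> V \<Longrightarrow>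
        conj_by G g (conj_by G u x) = conj_by G u (conj_by G g x)"
  shows "card V = p"
proof -
  have V': "subgroup V G" by (rule normalD(1)[OF V(1)])
  have VG: "y \<in> V \<Longrightarrow> y \<in> carrier G" for y using V' subgroup.mem_carrier by metis
  let ?V = "G\<lparr>carrier := V\<rparr>"
  interpret V: group ?V by (rule subgroup_imp_group[OF V'])
  interpret V: comm_group ?V by (rule V.group_comm_groupI) (simp add: comm)
  obtain v where v: "v \<in> V" "v \<noteq> \<one>" using V(2) subgroup.one_closed[OF V'] by blast
  have ipow: "x [^]\<^bsub>?V\<^esub> (c::int) = x [^] c" if "x \<in> V" for x c
    using int_pow_consistent[OF V' that] by simp
  have scalar: "\<exists>c::int. \<forall>y\<in>V. conj_by G g y = y [^] c" if g: "g \<in> carrier G" for g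
  proof -
    have hom: "conj_by G g \<in> hom ?V ?V"
      using g VG normalD(2)[OF V(1) g] by (auto simp: hom_def conj_by_mult)
    have it: "(conj_by G g ^^ n) v = conj_by G (g [^] n) v" for n :: nat
      using g VG[OF v(1)] by (induction n) (simp_all add: conj_by_comp[symmetric] nat_pow_Suc2[symmetric] del: nat_pow_Suc)
    have "\<exists>w\<in>carrier ?V. w \<noteq> \<one>\<^bsub>?V\<^esub> \<and> (\<exists>c::int. conj_by G g w = w [^]\<^bsub>?V\<^esub> c)"
    proof (rule V.eigenvector_exists[OF hom _ prime_p])
      show "v [^]\<^bsub>?V\<^esub> p = \<one>\<^bsub>?V\<^esub>" using exp[OF v(1)] by (simp add: nat_pow_consistent[symmetric])
      show "(conj_by G g ^^ (p - 1)) v = v" using it pow[OF g v(1)] by simp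
    qed (use v in auto)
    then obtain w c where w: "w \<in> V" "w \<noteq> \<one>" "conj_by G g w = w [^] (c::int)" using ipow by auto
    define E where "E = {y \<in> V. conj_by G g y = y [^] c}"
    have "E \<lhd> G"
      unfolding normal_iff_conj_by
    proof (intro conjI ballI)
      show "subgroup E G"
      proof (rule subgroupI)
        show "E \<subseteq> carrier G" using VG by (auto simp: E_def)
        show "E \<noteq> {}" using w by (auto simp: E_def)
        show "inv a \<in> E" if "a \<in> E" for a
          using that VG g V' by (simp add: E_def conj_by_inv int_pow_inv subgroup.m_inv_closed)
        show "a \<otimes> b \<in> E" if "a \<in> E" "b \<in> E" for a b
          using that VG g V' comm by (simp add: E_def conj_by_mult int_pow_mult_distrib subgroup.m_closed)
      qed
      fix u y assume u: "u \<in> carrier G" and y: "y \<in> E"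
      then have yV: "y \<in> V" "conj_by G g y = y [^] c" by (auto simp: E_def)
      interpret cu: group_hom G G "conj_by G u" by (rule group_hom_conj_by[OF u])
      have "conj_by G g (conj_by G u y) = conj_by G u y [^] c"
        using cc[OF g u yV(1)] yV VG by (simp add: cu.hom_int_pow)
      then show "conj_by G u y \<in> E" using normalD(2)[OF V(1) u yV(1)] by (simp add: E_def)
    qed
    moreover have "E \<subseteq> V" by (auto simp: E_def)
    moreover have "E \<noteq> {\<one>}" using w by (auto simp: E_def)
    ultimately have "E = V" using min by blast
    then show ?thesis unfolding E_def by blast
  qed
  have gen: "generate G {v} = range (\<lambda>i::int. v [^] i)" using generate_pow[OF VG[OF v(1)]] by auto
  have sub: "subgroup (generate G {v}) G" by (rule generate_is_subgroup) (use v VG in simp)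
  have "generate G {v} \<lhd> G"
    unfolding normal_iff_conj_by
  proof (intro conjI ballI, rule sub)
    fix g y assume g: "g \<in> carrier G" and y: "y \<in> generate G {v}"
    have "y \<in> V" using y generate_subgroup_incl[of "{v}" V] V' v by blast
    then obtain c where "conj_by G g y = y [^] (c::int)" using scalar[OF g] by blast
    then show "conj_by G g y \<in> generate G {v}" using subgroup_int_pow_closed[OF sub y] by simp
  qed
  moreover have "generate G {v} \<subseteq> V" by (rule generate_subgroup_incl[OF _ V']) (use v in simp)
  moreover have "v \<in> generate G {v}" by (auto intro: generate.incl)
  ultimately have "generate G {v} = V" using min v(2) by blast
  then have "card V = ord v" using generate_pow_card[OF VG[OF v(1)]] by simp
  moreover have "ord v dvd p" using exp[OF v(1)] pow_eq_id VG[OF v(1)] by blast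
  moreover have "ord v \<noteq> 1" using v VG ord_eq_1 by blast
  ultimately show ?thesis using prime_p prime_nat_iff by blast
qed

end

section \<open>Chief factors below a normal \<open>p\<close>-subgroup\<close>

text \<open>\<open>R\<close> selects the factors to be centralized: those below a fixed
  \<open>K\<close> in one application, those of order divisible by \<open>p\<close> in the
  other.\<close>

definition chief_centralizer :: "('a, 'b) monoid_scheme \<Rightarrow> ('a set \<Rightarrow> 'a set \<Rightarrow> bool) \<Rightarrow> 'a set" where
  "chief_centralizer G R =
     {g \<in> carrier G. \<forall>H K. chief_factor G H K \<and> R H K \<longrightarrow> g \<in> factor_centralizer G H K}"

context fin_grp
begin

section \<open>Actions on \<open>H/K\<close> inside the quotient \<open>G/K\<close>\<close>

lemma fin_grp_FactGroup:
  assumes "K \<lhd> G" shows "fin_grp (G Mod K) p"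
proof -
  interpret K: normal K G by (rule assms)
  interpret Q: group "G Mod K" by (rule K.factorgroup_is_group)
  show ?thesis by unfold_locales (simp_all add: carrier_FactGroup prime_p)
qed

lemma coset_eq_iff:
  assumes "subgroup K G" "a \<in> carrier G" "b \<in> carrier G"
  shows "K #> a = K #> b \<longleftrightarrow> a \<otimes> inv b \<in> K"
  using assms by (metis is_group rcos_self repr_independence subgroup.rcos_module)

lemma coset_conj_by:
  assumes K: "K \<lhd> G" and g: "g \<in> carrier G" and h: "h \<in> carrier G"
  shows "conj_by (G Mod K) (K #> g) (K #> h) = K #> conj_by G g h"
proof -
  interpret K: normal K G by (rule K)
  have "K #> g \<in> carrier (G Mod K)" using g by (simp add: carrier_FactGroup)
  then have "inv\<^bsub>G Mod K\<^esub> (K #> g) = K #> inv g"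
    using g by (simp add: K.inv_FactGroup K.rcos_inv)
  then show ?thesis using g h by (simp add: conj_by_def K.rcos_sum)
qed

lemma coset_fixed_iff_factor:
  assumes K: "K \<lhd> G" and g: "g \<in> carrier G" and h: "h \<in> carrier G"
  shows "conj_by (G Mod K) (K #> g) (K #> h) = K #> h \<longleftrightarrow> conj_by G g h \<otimes> inv h \<in> K"
  using coset_conj_by[OF assms] coset_eq_iff[OF normalD(1)[OF K], of "conj_by G g h" h] g h by simp

lemma normal_factor_image:
  assumes H: "H \<lhd> G" and K: "K \<lhd> G"
  shows "(\<lambda>h. K #> h) ` H \<lhd> G Mod K" "card ((\<lambda>h. K #> h) ` H) = factor_order G H K"
proof -
  interpret K: normal K G by (rule K)
  interpret Q: fin_grp "G Mod K" p by (rule fin_grp_FactGroup[OF K])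
  interpret pr: group_hom G "G Mod K" "\<lambda>a. K #> a"
    by (simp add: group_hom_def group_hom_axioms_def K.r_coset_hom_Mod Q.is_group)
  have HG: "h \<in> H \<Longrightarrow> h \<in> carrier G" for h using normal_subset_carrier[OF H] by blast
  show "(\<lambda>h. K #> h) ` H \<lhd> G Mod K"
    unfolding Q.normal_iff_conj_by
  proof (intro conjI ballI)
    show "subgroup ((\<lambda>h. K #> h) ` H) (G Mod K)" by (rule pr.subgroup_img_is_subgroup[OF normalD(1)[OF H]])
    fix q v assume "q \<in> carrier (G Mod K)" "v \<in> (\<lambda>h. K #> h) ` H"
    then obtain g h where "g \<in> carrier G" "q = K #> g" "h \<in> H" "v = K #> h"
      by (auto simp: carrier_FactGroup)
    then show "conj_by (G Mod K) q v \<in> (\<lambda>h. K #> h) ` H"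
      using coset_conj_by[OF K] HG normalD(2)[OF H] by simp
  qed
  have "(\<lambda>h. K #> h) ` H = carrier (G\<lparr>carrier := H\<rparr> Mod K)" by (simp add: carrier_FactGroup)
  then show "card ((\<lambda>h. K #> h) ` H) = factor_order G H K" by (simp add: factor_order_def order_def)
qed

text \<open>It is the preimage in \<open>G\<close> of the centralizer of the image of
  \<open>H\<close> in \<open>G/K\<close>.\<close>

lemma normal_factor_centralizer:
  assumes H: "H \<lhd> G" and K: "K \<lhd> G"
  shows "factor_centralizer G H K \<lhd> G"
proof -
  let ?Q = "G Mod K"
  let ?V = "(\<lambda>h. K #> h) ` H"
  interpret K: normal K G by (rule K)
  interpret Q: fin_grp ?Q p by (rule fin_grp_FactGroup[OF K])
  define W where "W = {q \<in> carrier ?Q. \<forall>v\<in>?V. conj_by ?Q q v = v}"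
  have V: "?V \<lhd> ?Q" by (rule normal_factor_image(1)[OF H K])
  have W: "W \<lhd> ?Q"
    unfolding W_def
    using Q.normal_fixing[OF Q.subgroup_self _ Q.normal_subset_carrier[OF V] Q.normal_conj_by_image[OF V]]
      Q.normal_self by simp
  have "factor_centralizer G H K = {x \<in> carrier G. K #> x \<in> W}"
  proof -
    have "K #> x \<in> W \<longleftrightarrow> (\<forall>h\<in>H. conj_by G x h \<otimes> inv h \<in> K)" if x: "x \<in> carrier G" for x
    proof -
      have "K #> x \<in> carrier ?Q" using x by (simp add: carrier_FactGroup)
      then show ?thesis
        using coset_fixed_iff_factor[OF K x] normal_subset_carrier[OF H] by (auto simp: W_def)
    qed
    then show ?thesis by (auto simp: factor_centralizer_def)
  qed
  then show ?thesis
    using K.factgroup_subgroup_union_char[OF Q.normalD(1)[OF W]] K.factgroup_subgroup_union_normal[OF W] by simp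
qed

lemma order_p_factor_centralizer:
  assumes H: "H \<lhd> G" and K: "K \<lhd> G" "K \<subseteq> H" and ord: "factor_order G H K = p"
    and g: "g \<in> carrier G" and u: "u \<in> carrier G"
  shows "g [^] (p - 1) \<in> factor_centralizer G H K"
    and "inv u \<otimes> inv g \<otimes> u \<otimes> g \<in> factor_centralizer G H K"
proof -
  let ?Q = "G Mod K"
  interpret K: normal K G by (rule K(1))
  interpret Q: fin_grp ?Q p by (rule fin_grp_FactGroup[OF K(1)])
  let ?V = "(\<lambda>h. K #> h) ` H"
  have V: "?V \<lhd> ?Q" "card ?V = p" using normal_factor_image[OF H K(1)] ord by auto
  have mem: "K #> x \<in> carrier ?Q" if "x \<in> carrier G" for x using that by (simp add: carrier_FactGroup)
  have HG: "h \<in> H \<Longrightarrow> h \<in> carrier G" for h using normal_subset_carrier[OF H] by blast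
  show "g [^] (p - 1) \<in> factor_centralizer G H K"
    unfolding factor_centralizer_def
  proof (intro CollectI conjI ballI)
    fix h assume h: "h \<in> H"
    have "conj_by ?Q (K #> (g [^] (p - 1))) (K #> h) = K #> h"
      using Q.order_p_action(1)[OF V mem[OF g] mem[OF g], of "K #> h"] h g
      by (simp add: K.FactGroup_pow)
    then show "conj_by G (g [^] (p - 1)) h \<otimes> inv h \<in> K"
      using coset_fixed_iff_factor[OF K(1)] g HG[OF h] by simp
  qed (use g in simp)
  show "inv u \<otimes> inv g \<otimes> u \<otimes> g \<in> factor_centralizer G H K"
    unfolding factor_centralizer_def
  proof (intro CollectI conjI ballI)
    fix h assume h: "h \<in> H"
    have hG: "h \<in> carrier G" by (rule HG[OF h])
    have "K #> conj_by G g (conj_by G u h) = K #> conj_by G u (conj_by G g h)"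
      using Q.order_p_action(2)[OF V mem[OF g] mem[OF u], of "K #> h"] h g u hG
      by (simp add: coset_conj_by[OF K(1)])
    then have "K #> conj_by G (inv u) (conj_by G (inv g) (conj_by G u (conj_by G g h)))
        = K #> conj_by G (inv u) (conj_by G (inv g) (conj_by G g (conj_by G u h)))"
      using coset_conj_by[OF K(1)] g u hG by (metis conj_by_closed inv_closed)
    then have "K #> conj_by G (inv u \<otimes> inv g \<otimes> u \<otimes> g) h = K #> h"
      using g u hG by (simp add: conj_by_comp)
    then show "conj_by G (inv u \<otimes> inv g \<otimes> u \<otimes> g) h \<otimes> inv h \<in> K"
      using coset_eq_iff[OF normalD(1)[OF K(1)]] g u hG by simp
  qed (use g u in simp)
qed

lemma normal_chief_centralizer: "chief_centralizer G R \<lhd> G"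
proof -
  let ?C = "chief_centralizer G R"
  have Cin: "g \<in> ?C \<longleftrightarrow> g \<in> carrier G \<and>
      (\<forall>H K. chief_factor G H K \<and> R H K \<longrightarrow> g \<in> factor_centralizer G H K)" for g
    by (simp add: chief_centralizer_def)
  have fcn: "factor_centralizer G H K \<lhd> G" if "chief_factor G H K" for H K
    using normal_factor_centralizer chief_factorD(1,2)[OF that] by blast
  show ?thesis
    unfolding normal_iff_conj_by
  proof (intro conjI ballI)
    show "subgroup ?C G"
    proof (rule subgroupI)
      show "?C \<subseteq> carrier G" using Cin by blast
      have "\<one> \<in> ?C" using Cin subgroup.one_closed normalD(1) fcn one_closed by metis
      then show "?C \<noteq> {}" by blast
      show "inv a \<in> ?C" if "a \<in> ?C" for a
        using that Cin subgroup.m_inv_closed normalD(1) fcn inv_closed by metis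
      show "a \<otimes> b \<in> ?C" if "a \<in> ?C" "b \<in> ?C" for a b
        using that Cin subgroup.m_closed normalD(1) fcn m_closed by metis
    qed
    show "conj_by G g c \<in> ?C" if "g \<in> carrier G" "c \<in> ?C" for g c
      using that Cin normalD(2) fcn conj_by_closed by metis
  qed
qed

text \<open>Hence \<open>G\<close> modulo this subgroup is abelian of exponent dividing
  \<open>p - 1\<close>; the two conclusions say so without forming the quotient.\<close>

lemma chief_centralizer_order_p:
  assumes ord: "\<And>H K. chief_factor G H K \<Longrightarrow> R H K \<Longrightarrow> factor_order G H K = p"
    and g: "g \<in> carrier G"
  shows "g [^] (p - 1) \<in> chief_centralizer G R"
    and "u \<in> carrier G \<Longrightarrow> inv u \<otimes> inv g \<otimes> u \<otimes> g \<in> chief_centralizer G R"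
proof -
  have "g [^] (p - 1) \<in> factor_centralizer G H K" if "chief_factor G H K" "R H K" for H K
    using order_p_factor_centralizer(1)[OF _ _ _ ord[OF that] g g] chief_factorD(1,2,3)[OF that(1)] by blast
  then show "g [^] (p - 1) \<in> chief_centralizer G R" using g by (simp add: chief_centralizer_def)
  assume u: "u \<in> carrier G"
  have "inv u \<otimes> inv g \<otimes> u \<otimes> g \<in> factor_centralizer G H K" if "chief_factor G H K" "R H K" for H K
    using order_p_factor_centralizer(2)[OF _ _ _ ord[OF that] g u] chief_factorD(1,2,3)[OF that(1)] by blast
  then show "inv u \<otimes> inv g \<otimes> u \<otimes> g \<in> chief_centralizer G R"
    using g u by (simp add: chief_centralizer_def)
qed

text \<open>If no element of \<open>H - K\<close> has order dividing \<open>p_exponent p\<close>, then by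
  \<open>p_regular_centralizes_p_subgroup\<close> the centralizer \<open>C\<close> of the chief factors below \<open>K\<close> acts on \<open>H/K\<close>
  as a \<open>p\<close>-group, hence trivially. By induction \<open>G/C\<close> is abelian of exponent dividing \<open>p - 1\<close>.\<close>

theorem chief_factor_order_p:
  assumes cov: "\<And>x H K. x \<in> carrier G \<Longrightarrow> x [^] p_exponent p = \<one> \<Longrightarrow> chief_factor G H K \<Longrightarrow>
      p dvd factor_order G H K \<Longrightarrow> x \<in> H \<Longrightarrow> x \<notin> K \<Longrightarrow> H = K <#> generate G {x}"
    and "chief_factor G H K" "p_subgroup p G H"
  shows "factor_order G H K = p"
  using assms(2,3)
proof (induction "card H" arbitrary: H K rule: less_induct)
  case less
  note HK = less.prems(1) and Hp = less.prems(2)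
  note nH = chief_factorD(1)[OF HK] and nK = chief_factorD(2)[OF HK] and KH = chief_factorD(3)[OF HK]
    and sH = chief_factorD(4)[OF HK] and sK = chief_factorD(5)[OF HK]
  have HG: "h \<in> H \<Longrightarrow> h \<in> carrier G" for h using normal_subset_carrier[OF nH] by blast
  have dv: "p dvd factor_order G H K" by (rule p_dvd_factor_order[OF Hp sK KH])
  show ?case
  proof (cases "\<exists>x\<in>H - K. x [^] p_exponent p = \<one>")
    case True
    then obtain x where x: "x \<in> H" "x \<notin> K" "x [^] p_exponent p = \<one>" by blast
    show ?thesis
      by (rule factor_order_cyclic[OF sH sK _ x(1) chief_factor_p_subgroup(1)[OF HK Hp x(1)]
            cov[OF HG[OF x(1)] x(3) HK dv x(1,2)] dv]) (use KH in blast)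
  next
    case False
    have ih: "factor_order G H' K' = p" if "chief_factor G H' K'" "H' \<subseteq> K" for H' K'
    proof (rule less.hyps[OF _ that(1)])
      have "H' \<subset> H" using that(2) KH by blast
      then show "card H' < card H" using sH by (simp add: psubset_card_mono)
      show "p_subgroup p G H'"
        using p_subgroup_subset[OF Hp chief_factorD(4)[OF that(1)]] that(2) KH by blast
    qed
    define C where "C = chief_centralizer G (\<lambda>H' K'. H' \<subseteq> K)"
    have CG: "c \<in> C \<Longrightarrow> c \<in> carrier G" for c by (simp add: C_def chief_centralizer_def)
    have sC: "subgroup C G" and nC: "\<And>g c. g \<in> carrier G \<Longrightarrow> c \<in> C \<Longrightarrow> conj_by G g c \<in> C"
      unfolding C_def by (rule normalD(1)[OF normal_chief_centralizer], rule normalD(2)[OF normal_chief_centralizer])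
    have Cpow: "g [^] (p - 1) \<in> C" if "g \<in> carrier G" for g
      unfolding C_def by (rule chief_centralizer_order_p(1)[where R = "\<lambda>H' K'. H' \<subseteq> K", OF ih that])
    have Ccomm: "inv u \<otimes> inv g \<otimes> u \<otimes> g \<in> C" if "g \<in> carrier G" "u \<in> carrier G" for g u
      unfolding C_def by (rule chief_centralizer_order_p(2)[where R = "\<lambda>H' K'. H' \<subseteq> K", OF ih that])
    \<comment> \<open>Elements of small order in \<open>H\<close> lie in \<open>K\<close>, where the
      stabilized chief factors make \<open>x\<close> act trivially. Having fixed all these elements,
      \<open>x\<close> fixes all of \<open>H\<close>.\<close>
    have reg: "conj_by G x h = h" if x: "p_regular p G x" "x \<in> C" and h: "h \<in> H" for x h
    proof (rule p_regular_centralizes_p_subgroup[OF Hp x(1) _ _ h])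
      have xG: "x \<in> carrier G" using x(1) by (simp add: p_regular_def)
      show "conj_by G x d \<in> H" if "d \<in> H" for d by (rule normalD(2)[OF nH xG that])
      show "conj_by G x d = d" if d: "d \<in> H" "d [^] p_exponent p = \<one>" for d
      proof (rule p_regular_centralizes_series[OF Hp x(1) _ nK _ d(1)])
        show "d \<in> K" using False d by blast
        show "conj_by G x d \<in> H" if "d \<in> H" for d by (rule normalD(2)[OF nH xG that])
        show "conj_by G x h' \<otimes> inv h' \<in> K'"
          if "chief_factor G H' K'" "H' \<subseteq> K" "h' \<in> H'" for H' K' h'
          using x(2) that unfolding C_def chief_centralizer_def factor_centralizer_def by blast
      qed
    qed
    let ?Q = "G Mod K"
    let ?V = "(\<lambda>h. K #> h) ` H"
    interpret K: normal K G by (rule nK)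
    interpret Q: fin_grp ?Q p by (rule fin_grp_FactGroup[OF nK])
    interpret GC: fin_grp "G\<lparr>carrier := C\<rparr>" p by (rule fin_grp_subgroup[OF sC])
    have V: "?V \<lhd> ?Q" and cV: "card ?V = factor_order G H K"
      using normal_factor_image[OF nH nK] by auto
    have mem: "K #> x \<in> carrier ?Q" if "x \<in> carrier G" for x using that by (simp add: carrier_FactGroup)
    have min: "N = {\<one>\<^bsub>?Q\<^esub>} \<or> N = ?V" if N: "N \<lhd> ?Q" "N \<subseteq> ?V" for N
    proof -
      have U: "\<Union>N \<lhd> G" by (rule K.factgroup_subgroup_union_normal[OF N(1)])
      have Uc: "\<Union>N = {x \<in> carrier G. K #> x \<in> N}"
        by (rule K.factgroup_subgroup_union_char[OF Q.normalD(1)[OF N(1)]])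
      have K1: "K \<in> N" using subgroup.one_closed[OF Q.normalD(1)[OF N(1)]] by simp
      have KU: "K \<subseteq> \<Union>N" using K1 by blast
      have UH: "\<Union>N \<subseteq> H"
      proof
        fix x assume "x \<in> \<Union>N"
        then have x: "x \<in> carrier G" "K #> x \<in> ?V" using Uc N(2) by auto
        then obtain h where h: "h \<in> H" "K #> x = K #> h" by blast
        then have "x \<otimes> inv h \<in> H" using coset_eq_iff[OF sK x(1) HG[OF h(1)]] KH by blast
        then have "x \<otimes> inv h \<otimes> h \<in> H" using h(1) sH by (simp add: subgroup.m_closed)
        then show "x \<in> H" using x h HG by (simp add: m_assoc)
      qed
      consider "\<Union>N = K" | "\<Union>N = H" using chief_factorD(6)[OF HK U KU UH] by blast
      then show ?thesis
      proof cases
        case 1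
        have "N \<subseteq> {K}"
        proof
          fix n assume n: "n \<in> N"
          then obtain h where h: "h \<in> H" "n = K #> h" using N(2) by blast
          then have "h \<in> \<Union>N" using n Uc HG by simp
          then show "n \<in> {K}" using 1 h coset_join2[OF HG[OF h(1)] sK] by simp
        qed
        then show ?thesis using K1 by auto
      next
        case 2
        then have "?V \<subseteq> N" using Uc by auto
        then show ?thesis using N(2) by auto
      qed
    qed
    let ?act = "\<lambda>c v. conj_by ?Q (K #> c) v"
    \<comment> \<open>The points of \<open>H/K\<close> fixed by \<open>C\<close>. Letting
      \<open>v\<close> act on the image of \<open>C\<close> is the form in which
      \<open>normal_fixing\<close> yields normality; the fact \<open>W\<close> exchanges the roles,
      both sides saying that the elements commute.\<close>
    let ?W = "{v \<in> ?V. \<forall>q\<in>(\<lambda>c. K #> c) ` C. conj_by ?Q v q = q}"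
    have VQ: "v \<in> ?V \<Longrightarrow> v \<in> carrier ?Q" for v using Q.normal_subset_carrier[OF V] by blast
    have W: "?W = {v \<in> ?V. \<forall>c\<in>carrier (G\<lparr>carrier := C\<rparr>). ?act c v = v}"
    proof -
      have "conj_by ?Q v (K #> c) = K #> c \<longleftrightarrow> ?act c v = v" if "v \<in> ?V" "c \<in> C" for v c
        using Q.conj_by_eq_iff[OF VQ[OF that(1)] mem[OF CG[OF that(2)]]]
          Q.conj_by_eq_iff[OF mem[OF CG[OF that(2)]] VQ[OF that(1)]] by auto
      then show ?thesis by auto
    qed
    \<comment> \<open>The \<open>p\<close>-regular elements of \<open>C\<close> act trivially, so
      the counting lemma applies. As \<open>p\<close> divides the order of \<open>H/K\<close>, there
      are nontrivial fixed points, and by minimality everything is fixed.\<close>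
    have "[card ?V = card ?W] (mod p)"
      unfolding W
    proof (rule GC.card_cong_card_fixed_points)
      show "finite ?V" using sH by simp
      show "?act c v \<in> ?V" if "c \<in> carrier (G\<lparr>carrier := C\<rparr>)" "v \<in> ?V" for c v
        using that Q.normalD(2)[OF V mem[OF CG]] by simp
      show "?act \<one>\<^bsub>G\<lparr>carrier := C\<rparr>\<^esub> v = v" if "v \<in> ?V" for v
        using that HG coset_conj_by[OF nK] by auto
      show "?act (b \<otimes>\<^bsub>G\<lparr>carrier := C\<rparr>\<^esub> c) v = ?act b (?act c v)"
        if "b \<in> carrier (G\<lparr>carrier := C\<rparr>)" "c \<in> carrier (G\<lparr>carrier := C\<rparr>)" "v \<in> ?V" for b c v
        using that HG CG by (auto simp: coset_conj_by[OF nK] conj_by_comp)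
      show "?act c v = v" if "p_regular p (G\<lparr>carrier := C\<rparr>) c" "v \<in> ?V" for c v
      proof -
        have "p_regular p G c" "c \<in> C" using that(1) p_regular_of_subgroup[OF sC] by auto
        then show ?thesis using that(2) reg HG CG by (auto simp: coset_conj_by[OF nK])
      qed
    qed
    then have "p dvd card ?V \<longleftrightarrow> p dvd card ?W" by (rule cong_dvd_iff)
    then have "?W \<noteq> {\<one>\<^bsub>?Q\<^esub>}" using dv cV p_gt_1 by auto
    moreover have "?W = {\<one>\<^bsub>?Q\<^esub>} \<or> ?W = ?V"
    proof (rule min[OF _ Collect_restrict])
      show "?W \<lhd> ?Q"
      proof -
        have nCQ: "(\<lambda>c. K #> c) ` C \<lhd> ?Q"
          using normal_factor_image(1)[OF _ nK, of C] normal_chief_centralizer by (simp add: C_def)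
        show ?thesis
          using Q.normal_fixing[OF Q.subgroup_self _ Q.normal_subset_carrier[OF nCQ] Q.normal_conj_by_image[OF nCQ],
            of ?V] V by simp
      qed
    qed
    ultimately have WV: "?W = ?V" by (simp only: simp_thms)
    have Cact: "conj_by ?Q (K #> c) v = v" if "c \<in> C" "v \<in> ?V" for c v
      using subsetD[OF equalityD1[OF trans[OF WV[symmetric] W]] that(2)] that(1) by simp
    have "card ?V = p"
    proof (rule Q.minimal_normal_order_p[OF V])
      show "?V \<noteq> {\<one>\<^bsub>?Q\<^esub>}" using cV dv p_gt_1 by auto
      show "N = {\<one>\<^bsub>?Q\<^esub>} \<or> N = ?V" if "N \<lhd> ?Q" "N \<subseteq> ?V" for N
        by (rule min[OF that])
      show "v \<otimes>\<^bsub>?Q\<^esub> w = w \<otimes>\<^bsub>?Q\<^esub> v" if vw: "v \<in> ?V" "w \<in> ?V" for v w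
      proof -
        obtain a b where ab: "a \<in> H" "v = K #> a" "b \<in> H" "w = K #> b" using vw by blast
        have "conj_by ?Q v w = w"
          using coset_fixed_iff_factor[OF nK HG[OF ab(1)] HG[OF ab(3)]] chief_factor_p_subgroup(2)[OF HK Hp ab(1,3)] ab
          by simp
        then show ?thesis using Q.conj_by_eq_iff mem HG ab by simp
      qed
      show "v [^]\<^bsub>?Q\<^esub> p = \<one>\<^bsub>?Q\<^esub>" if v: "v \<in> ?V" for v
      proof -
        obtain a where a: "a \<in> H" "v = K #> a" using v by blast
        then show ?thesis
          using chief_factor_p_subgroup(1)[OF HK Hp a(1)] K.FactGroup_pow[OF HG[OF a(1)]] HG coset_join2 sK by simp
      qed
      show "conj_by ?Q (g [^]\<^bsub>?Q\<^esub> (p - 1)) v = v" if gv: "g \<in> carrier ?Q" "v \<in> ?V" for g v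
      proof -
        obtain x where x: "x \<in> carrier G" "g = K #> x" using gv(1) by (auto simp: carrier_FactGroup)
        then show ?thesis using Cact[OF Cpow[OF x(1)] gv(2)] K.FactGroup_pow[OF x(1)] by simp
      qed
      show "conj_by ?Q g (conj_by ?Q u v) = conj_by ?Q u (conj_by ?Q g v)"
        if guv: "g \<in> carrier ?Q" "u \<in> carrier ?Q" "v \<in> ?V" for g u v
      proof -
        obtain x y where x: "x \<in> carrier G" "g = K #> x" and y: "y \<in> carrier G" "u = K #> y"
          using guv by (auto simp: carrier_FactGroup)
        have "x \<otimes> y \<otimes> (inv y \<otimes> inv x \<otimes> y \<otimes> x) = y \<otimes> x" using x y by (simp add: grp_simps)
        moreover have "K #> x \<otimes> y \<otimes> (inv y \<otimes> inv x \<otimes> y \<otimes> x)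
          = g \<otimes>\<^bsub>?Q\<^esub> u \<otimes>\<^bsub>?Q\<^esub> (K #> (inv y \<otimes> inv x \<otimes> y \<otimes> x))"
          using x y by (simp add: K.rcos_sum)
        ultimately have eq: "u \<otimes>\<^bsub>?Q\<^esub> g = g \<otimes>\<^bsub>?Q\<^esub> u \<otimes>\<^bsub>?Q\<^esub> (K #> (inv y \<otimes> inv x \<otimes> y \<otimes> x))"
          using x y by (simp add: K.rcos_sum)
        have vQ: "v \<in> carrier ?Q" using guv(3) Q.normal_subset_carrier[OF V] by blast
        have "conj_by ?Q u (conj_by ?Q g v) = conj_by ?Q (u \<otimes>\<^bsub>?Q\<^esub> g) v"
          by (rule Q.conj_by_comp[OF guv(2,1) vQ, symmetric])
        also have "\<dots> = conj_by ?Q (g \<otimes>\<^bsub>?Q\<^esub> u) (conj_by ?Q (K #> (inv y \<otimes> inv x \<otimes> y \<otimes> x)) v)"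
          unfolding eq by (rule Q.conj_by_comp) (use guv vQ mem x y in \<open>auto simp del: mult_FactGroup\<close>)
        also have "\<dots> = conj_by ?Q (g \<otimes>\<^bsub>?Q\<^esub> u) v"
          using Cact[OF Ccomm[OF x(1) y(1)] guv(3)] by simp
        also have "\<dots> = conj_by ?Q g (conj_by ?Q u v)" by (rule Q.conj_by_comp[OF guv(1,2) vQ])
        finally show ?thesis by simp
      qed
    qed
    then show ?thesis using cV by simp
  qed
qed

end

section \<open>\<open>p\<close>-supersolvable normal subgroups\<close>

context fin_grp
begin

text \<open>Let \<open>C\<close> centralize the chief factors of \<open>M\<close> of order divisible
  by \<open>p\<close>. As \<open>M/C\<close> has exponent dividing \<open>p - 1\<close>, all
  \<open>p\<close>-elements of \<open>M\<close> lie in \<open>C\<close>. The subgroup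
  \<open>C0\<close> they generate satisfies Frobenius' condition by stability of a chief series of
  \<open>M\<close>, so it is the product of its normal \<open>p\<close>-complement and a Sylow
  subgroup of \<open>M\<close>.\<close>

lemma p_supersolvable_imp_normal_p_nilpotent:
  assumes M: "M \<lhd> G" and ss: "p_supersolvable p (G\<lparr>carrier := M\<rparr>)"
  shows "\<exists>N P. N \<lhd> G \<and> \<not> p dvd card N \<and> p_subgroup p G P \<and> P \<subseteq> M \<and>
    \<not> p dvd factor_order G M P \<and> N <#> P \<lhd> G"
proof -
  let ?M = "G\<lparr>carrier := M\<rparr>"
  have sM: "subgroup M G" by (rule normalD(1)[OF M])
  interpret M: fin_grp ?M p by (rule fin_grp_subgroup[OF sM])
  have MG: "x \<in> M \<Longrightarrow> x \<in> carrier G" for x using sM subgroup.mem_carrier by metis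
  define R where "R = (\<lambda>H K. p dvd factor_order ?M H K)"
  have ord: "factor_order ?M H K = p" if "chief_factor ?M H K" "R H K" for H K
    using ss that by (simp add: p_supersolvable_def R_def)
  define C where "C = chief_centralizer ?M R"
  have sCM: "subgroup C ?M" unfolding C_def by (rule M.normalD(1)[OF M.normal_chief_centralizer])
  then have sC: "subgroup C G" "C \<subseteq> M" using subgroup_of_subgroup_iff[OF sM] by auto
  have p_elt_C: "x \<in> C" if x: "x \<in> M" "x [^] (p ^ k) = \<one>" for x k
  proof (rule M.pow_coprime_mem[OF sCM])
    show "x \<in> carrier ?M" using x by simp
    show "x [^]\<^bsub>?M\<^esub> (p - 1) \<in> C"
      unfolding C_def by (rule M.chief_centralizer_order_p(1)[OF ord]) (use x in auto)
    show "x [^]\<^bsub>?M\<^esub> (p ^ k) \<in> C"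
      using x(2) subgroup.one_closed[OF sC(1)] by (simp add: nat_pow_consistent[symmetric])
    show "coprime (p - 1) (p ^ k)" using coprime_diff_one_left_nat p_gt_1 by simp
  qed
  \<comment> \<open>The set of \<open>p\<close>-elements of \<open>M\<close> is invariant under
    conjugation in \<open>G\<close>, which makes \<open>C0\<close> normal in \<open>G\<close> and
    not only in \<open>M\<close>.\<close>
  define gens where "gens = {x \<in> M. \<exists>k. x [^] (p ^ k) = \<one>}"
  define C0 where "C0 = generate G gens"
  have gG: "gens \<subseteq> carrier G" using MG by (auto simp: gens_def)
  have nC0: "C0 \<lhd> G"
    unfolding C0_def
  proof (rule normal_generateI[OF gG])
    fix x g assume "x \<in> gens" and g: "g \<in> carrier G"
    then obtain k where x: "x \<in> M" "x [^] (p ^ k) = \<one>" by (auto simp: gens_def)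
    then have "conj_by G g x [^] (p ^ k) = \<one>" using conj_by_pow[OF g MG, of x "p ^ k"] g by simp
    then show "g \<otimes> x \<otimes> inv g \<in> gens"
      using normalD(2)[OF M g x(1)] by (auto simp: gens_def conj_by_def)
  qed
  have sC0: "subgroup C0 G" by (rule normalD(1)[OF nC0])
  have C0C: "C0 \<subseteq> C"
    unfolding C0_def by (rule generate_subgroup_incl[OF _ sC(1)]) (use p_elt_C in \<open>auto simp: gens_def\<close>)
  have gC0: "gens \<subseteq> C0" unfolding C0_def by (auto intro: generate.incl)
  let ?L = "G\<lparr>carrier := C0\<rparr>"
  interpret L: fin_grp ?L p by (rule fin_grp_subgroup[OF sC0])
  have "p_regular_act_trivially p ?L"
    unfolding p_regular_act_trivially_def
  proof (intro allI impI ballI, elim conjE)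
    fix D x d
    assume "p_subgroup p ?L D" "p_regular p ?L x" and inv: "\<forall>d\<in>D. conj_by ?L x d \<in> D" and d: "d \<in> D"
    then have D: "p_subgroup p G D" "D \<subseteq> C0" and x: "p_regular p G x" "x \<in> C0"
      using p_subgroup_of_subgroup[OF sC0] p_regular_of_subgroup[OF sC0] by auto
    have xM: "x \<in> M" "x \<in> C" using x(2) C0C sC by auto
    have DM: "D \<subseteq> M" using D(2) C0C sC by auto
    have "conj_by ?M x d = d"
    proof (rule M.p_regular_centralizes_series[OF _ _ _ M.normal_self _ d])
      show "p_subgroup p ?M D" using p_subgroup_of_subgroup[OF sM] D(1) DM by simp
      show "p_regular p ?M x" using p_regular_of_subgroup[OF sM] x(1) xM(1) by simp
      show "conj_by ?M x e \<in> D" if "e \<in> D" for e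
        using inv that conj_by_of_subgroup[OF sC0 x(2)] conj_by_of_subgroup[OF sM xM(1)] by simp
      show "d \<in> carrier ?M" using d DM by auto
      show "conj_by ?M x h \<otimes>\<^bsub>?M\<^esub> inv\<^bsub>?M\<^esub> h \<in> K"
        if "chief_factor ?M H K" "p dvd factor_order ?M H K" "h \<in> H" for H K h
        using xM(2) that unfolding C_def chief_centralizer_def factor_centralizer_def R_def by blast
    qed
    then show "conj_by ?L x d = d"
      using conj_by_of_subgroup[OF sC0 x(2)] conj_by_of_subgroup[OF sM xM(1)] by simp
  qed
  note comp = normal_p_complement_exists[OF L.fin_grp_axioms this]
  define N where "N = {x. p_regular p ?L x}"
  have Nreg: "x \<in> N \<longleftrightarrow> p_regular p G x \<and> x \<in> C0" for x
    using p_regular_of_subgroup[OF sC0] by (simp add: N_def)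
  have nNL: "N \<lhd> ?L" using comp by (simp add: N_def)
  have sN: "subgroup N G" "N \<subseteq> C0" using nNL by (simp_all add: normal_of_subgroup_iff[OF sC0])
  have nN: "N \<lhd> G"
    unfolding normal_iff_conj_by
  proof (intro conjI ballI, rule sN(1))
    fix g x assume "g \<in> carrier G" "x \<in> N"
    then show "conj_by G g x \<in> N"
      using p_regular_conj_by[of x g] normalD(2)[OF nC0, of g x] Nreg by simp
  qed
  have pN: "\<not> p dvd card N" using comp by (simp add: N_def)
  obtain k where k: "card C0 = card N * p ^ k" using comp by (auto simp: N_def)
  obtain S where S: "sylow_subgroup p ?M S" using M.sylow_subgroup_exists by blast
  have Sp: "p_subgroup p G S" "S \<subseteq> M"
    using S p_subgroup_of_subgroup[OF sM] by (auto simp: sylow_subgroup_def)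
  have sS: "subgroup S G" using Sp by (simp add: p_subgroup_def)
  have idx: "\<not> p dvd factor_order G M S"
    using S by (simp add: sylow_subgroup_def factor_order_def order_def FactGroup_def)
  obtain s where s: "card S = p ^ s" using Sp by (auto simp: p_subgroup_def)
  have SC0: "S \<subseteq> C0" using gC0 Sp p_subgroup_pow[OF Sp(1)] by (auto simp: gens_def)
  have C0M: "C0 \<subseteq> M" using C0C sC by blast
  \<comment> \<open>\<open>C0\<close> contains the Sylow subgroup \<open>S\<close> of
    \<open>M\<close>, so the \<open>p\<close>-part of its order is \<open>card S\<close>; the two
    inequalities compare the exponents.\<close>
  have "s \<le> k"
  proof -
    have "p ^ s dvd card N * p ^ k" using lagrange_subgroups[OF sS sC0 SC0] s k by simp
    moreover have "coprime (p ^ s) (card N)" using pN prime_p by (simp add: prime_imp_coprime)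
    ultimately have "p ^ s dvd p ^ k" using coprime_dvd_mult_right_iff by blast
    then show ?thesis using p_gt_1 by (simp add: power_dvd_imp_le)
  qed
  moreover have "k \<le> s"
  proof -
    have "card C0 dvd card M" by (rule lagrange_subgroups[OF sC0 sM C0M])
    then have "p ^ k dvd factor_order G M S * p ^ s"
      using factor_order_mult_card[OF sM sS Sp(2)] s k by (metis dvd_mult_right)
    moreover have "coprime (p ^ k) (factor_order G M S)" using idx prime_p by (simp add: prime_imp_coprime)
    ultimately have "p ^ k dvd p ^ s" using coprime_dvd_mult_right_iff by blast
    then show ?thesis using p_gt_1 by (simp add: power_dvd_imp_le)
  qed
  ultimately have cC0: "card C0 = card N * card S" using k s by simp
  have "N \<inter> S \<subseteq> {\<one>}" using p_subgroup_p_regular[OF Sp(1)] Nreg by blast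
  then have "N \<inter> S = {\<one>}" using subgroup.one_closed[OF sS] subgroup.one_closed[OF sN(1)] by blast
  then have "card (N <#> S) = card C0" using card_set_mult[OF nN sS] cC0 by simp
  moreover have "N <#> S \<subseteq> C0" by (rule set_mult_in_subgroup[OF sC0 sN(2) SC0])
  ultimately have "N <#> S = C0" using card_subset_eq[OF subgroup_finite[OF sC0]] by blast
  then show ?thesis using nN pN Sp idx nC0 by blast
qed

text \<open>The order of \<open>N <#> P\<close> makes \<open>P\<close> a Sylow subgroup of it. The
  conjugate of \<open>P\<close> by \<open>g\<close> is another one, so an element
  \<open>n \<otimes> q\<close> of the product does the same to \<open>P\<close> as \<open>g\<close>;
  since \<open>q\<close> normalizes \<open>P\<close>, so does
  \<open>inv n \<otimes> g\<close>.\<close>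

lemma frattini:
  assumes N: "N \<lhd> G" "\<not> p dvd card N" and P: "p_subgroup p G P" and NP: "N <#> P \<lhd> G"
    and g: "g \<in> carrier G"
  shows "\<exists>n\<in>N. \<exists>l\<in>carrier G. conj_by G l ` P = P \<and> g = n \<otimes> l"
proof -
  define B where "B = N <#> P"
  have sB: "subgroup B G" and nB: "B \<lhd> G" using normalD(1)[OF NP] NP by (auto simp: B_def)
  have sN: "subgroup N G" by (rule normalD(1)[OF N(1)])
  have sP: "subgroup P G" using P by (simp add: p_subgroup_def)
  have NG: "x \<in> N \<Longrightarrow> x \<in> carrier G" for x using sN subgroup.mem_carrier by metis
  have PG: "P \<subseteq> carrier G" by (rule subgroup.subset[OF sP])
  have PB: "P \<subseteq> B" unfolding B_def by (rule subset_set_mult_right[OF sN PG])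
  let ?B = "G\<lparr>carrier := B\<rparr>"
  interpret B: fin_grp ?B p by (rule fin_grp_subgroup[OF sB])
  have "N \<inter> P = {\<one>}"
  proof -
    have "coprime (card N) p" using N(2) prime_p by (simp add: coprime_commute prime_imp_coprime)
    then show ?thesis
      using p_subgroup_p_regular[OF P] p_regular_of_order[OF sN] subgroup.one_closed[OF sN] subgroup.one_closed[OF sP]
      by blast
  qed
  then have cB: "card N * card P = card B" using card_set_mult[OF N(1) sP] by (simp add: B_def)
  have syl: "sylow_subgroup p ?B Q" if Q: "p_subgroup p G Q" "Q \<subseteq> B" "card Q = card P" for Q
  proof -
    have sQ: "subgroup Q G" using Q by (simp add: p_subgroup_def)
    have "factor_order G B Q = card N" by (rule factor_order_unique[OF sB sQ Q(2)]) (simp add: Q(3) cB)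
    then have "\<not> p dvd card (rcosets\<^bsub>?B\<^esub> Q)" using N(2) by (simp add: factor_order_def order_def FactGroup_def)
    then show ?thesis using Q p_subgroup_of_subgroup[OF sB] by (simp add: sylow_subgroup_def)
  qed
  have gP: "conj_by G g ` P \<subseteq> B" using PB normalD(2)[OF nB g] by blast
  obtain b where b: "b \<in> B" "conj_by G g ` P = conj_by ?B b ` P"
    using B.sylow_subgroups_conj[OF syl[OF P PB refl] syl[OF p_subgroup_conj_by[OF P g] gP subgroup_conj_by_image(2)[OF g sP]]]
    by auto
  then obtain n q where nq: "n \<in> N" "q \<in> P" "b = n \<otimes> q" by (auto simp: B_def set_mult_def)
  have nG: "n \<in> carrier G" by (rule NG[OF nq(1)])
  have "conj_by G g ` P = conj_by G b ` P" using b conj_by_of_subgroup[OF sB b(1)] by simp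
  also have "\<dots> = conj_by G n ` conj_by G q ` P"
    using conj_by_set_comp[OF nG _ PG, of q] nq PG by auto
  also have "\<dots> = conj_by G n ` P" using conj_by_self_image[OF sP nq(2)] by simp
  finally have eq: "conj_by G g ` P = conj_by G n ` P" .
  define l where "l = inv n \<otimes> g"
  have l: "l \<in> carrier G" "g = n \<otimes> l" using nG g by (simp_all add: l_def mult_inv_cancel)
  have "conj_by G l ` P = conj_by G (inv n) ` conj_by G n ` P"
    using conj_by_set_comp[OF _ g PG, of "inv n"] nG eq by (simp add: l_def)
  also have "\<dots> = id ` P" unfolding image_image by (rule image_cong) (use nG PG in \<open>simp_all add: subset_iff\<close>)
  finally show ?thesis using l nq(1) by auto
qed

text \<open>Chief factors below \<open>N\<close> have order prime to \<open>p\<close>. Above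
  \<open>N\<close>, intersection with \<open>L\<close> has multiplication by \<open>N\<close> as its
  inverse and takes chief factors of \<open>G\<close> to chief factors of \<open>L\<close> of the
  same order.\<close>

lemma p_supersolvable_of_supplement:
  assumes N: "N \<lhd> G" "\<not> p dvd card N" and L: "subgroup L G"
    and fac: "\<And>g. g \<in> carrier G \<Longrightarrow> \<exists>n\<in>N. \<exists>l\<in>L. g = n \<otimes> l"
    and ss: "p_supersolvable p (G\<lparr>carrier := L\<rparr>)"
  shows "p_supersolvable p G"
proof (rule p_supersolvable_normal_series[OF N(1)])
  have sN: "subgroup N G" by (rule normalD(1)[OF N(1)])
  have LG: "l \<in> L \<Longrightarrow> l \<in> carrier G" for l using L subgroup.mem_carrier by metis
  have NG: "l \<in> N \<Longrightarrow> l \<in> carrier G" for l using sN subgroup.mem_carrier by metis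
  interpret L: fin_grp "G\<lparr>carrier := L\<rparr>" p by (rule fin_grp_subgroup[OF L])
  show "factor_order G H K = p"
    if HK: "chief_factor G H K" and HN: "H \<subseteq> N" and dv: "p dvd factor_order G H K" for H K
  proof -
    note c = chief_factorD(3-5)[OF HK]
    have "factor_order G H K dvd card H" by (rule factor_order_dvd) (use c in auto)
    also have "card H dvd card N" by (rule lagrange_subgroups[OF c(2) sN HN])
    finally show ?thesis using dv N(2) dvd_trans by blast
  qed
  show "factor_order G H K = p"
    if HK: "chief_factor G H K" and NK: "N \<subseteq> K" and dv: "p dvd factor_order G H K" for H K
  proof -
    note nH = chief_factorD(1)[OF HK] and nK = chief_factorD(2)[OF HK] and KH = chief_factorD(3)[OF HK]
      and sH = chief_factorD(4)[OF HK] and sK = chief_factorD(5)[OF HK]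
    have NLG: "N <#> L = carrier G"
    proof
      show "N <#> L \<subseteq> carrier G" using set_mult_closed subgroup.subset sN L by blast
      show "carrier G \<subseteq> N <#> L" using fac by (force simp: set_mult_def)
    qed
    have dec: "Y = N <#> (L \<inter> Y)" if "subgroup Y G" "N \<subseteq> Y" for Y
      using set_mult_Int_modular[OF that subgroup.subset[OF L]] NLG subgroup.subset[OF that(1)] by auto
    have decH: "H = N <#> (L \<inter> H)" and decK: "K = N <#> (L \<inter> K)"
      using dec[OF sH] dec[OF sK] NK KH by blast+
    have sHL: "subgroup (L \<inter> H) G" and sKL: "subgroup (L \<inter> K) G"
      using subgroups_Inter_pair L sH sK by blast+
    have nL: "L \<inter> Y \<lhd> G\<lparr>carrier := L\<rparr>" if "Y \<lhd> G" for Y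
      unfolding normal_of_subgroup_iff[OF L]
      using subgroups_Inter_pair[OF L normalD(1)[OF that]] conj_by_subgroup[OF L] normalD(2)[OF that LG] by blast
    have "chief_factor (G\<lparr>carrier := L\<rparr>) (L \<inter> H) (L \<inter> K)"
      unfolding chief_factor_def
    proof (intro conjI allI impI)
      show "L \<inter> H \<lhd> G\<lparr>carrier := L\<rparr>" "L \<inter> K \<lhd> G\<lparr>carrier := L\<rparr>" using nL nH nK by auto
      have "L \<inter> K \<noteq> L \<inter> H" using decH decK KH by (metis psubset_eq)
      then show "L \<inter> K \<subset> L \<inter> H" using KH by blast
      fix Y assume "Y \<lhd> G\<lparr>carrier := L\<rparr> \<and> L \<inter> K \<subseteq> Y \<and> Y \<subseteq> L \<inter> H"
      then have Y: "subgroup Y G" "Y \<subseteq> L" "L \<inter> K \<subseteq> Y" "Y \<subseteq> L \<inter> H"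
        and Yn: "\<And>l y. l \<in> L \<Longrightarrow> y \<in> Y \<Longrightarrow> conj_by G l y \<in> Y"
        using normal_of_subgroup_iff[OF L] by auto
      have YG: "y \<in> Y \<Longrightarrow> y \<in> carrier G" for y using Y(2) LG by blast
      have "N <#> Y \<lhd> G"
        unfolding normal_iff_conj_by
      proof (intro conjI ballI)
        show "subgroup (N <#> Y) G" by (rule set_mult_subgroup[OF N(1) Y(1)])
        fix g z assume g: "g \<in> carrier G" and "z \<in> N <#> Y"
        then obtain m y where m: "m \<in> N" and y: "y \<in> Y" and z: "z = m \<otimes> y" by (auto simp: set_mult_def)
        obtain n l where n: "n \<in> N" and l: "l \<in> L" and gnl: "g = n \<otimes> l" using fac[OF g] by blast
        define y' where "y' = conj_by G l y"
        have y': "y' \<in> Y" unfolding y'_def by (rule Yn[OF l y])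
        have cl: "n \<in> carrier G" "l \<in> carrier G" "m \<in> carrier G" "y \<in> carrier G"
          using NG LG YG n l m y by auto
        \<comment> \<open>Moving \<open>inv n\<close> to the left past \<open>y'\<close> conjugates
          it by \<open>y'\<close>, so all contributions from \<open>N\<close> collect in front of
          \<open>y'\<close>.\<close>
        have "conj_by G g z = n \<otimes> conj_by G l m \<otimes> conj_by G y' (inv n) \<otimes> y'"
          using cl by (simp add: gnl z y'_def conj_by_def grp_simps)
        moreover have "n \<otimes> conj_by G l m \<otimes> conj_by G y' (inv n) \<in> N"
          using n m normalD(2)[OF N(1)] LG[OF l] YG[OF y'] sN
          by (simp add: subgroup.m_closed subgroup.m_inv_closed)
        ultimately show "conj_by G g z \<in> N <#> Y" using y' by (auto simp: set_mult_def)
      qed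
      moreover have "K \<subseteq> N <#> Y" by (subst decK) (rule mono_set_mult[OF order_refl Y(3)])
      moreover have "N <#> Y \<subseteq> H" by (rule set_mult_in_subgroup[OF sH]) (use NK KH Y(4) in auto)
      ultimately consider "N <#> Y = K" | "N <#> Y = H" using chief_factorD(6)[OF HK, of "N <#> Y"] by blast
      moreover have "L \<inter> (N <#> Y) = Y"
      proof
        show "Y \<subseteq> L \<inter> (N <#> Y)" using Y(2) subset_set_mult_right[OF sN, of Y] YG by blast
        show "L \<inter> (N <#> Y) \<subseteq> Y"
        proof
          fix z assume z: "z \<in> L \<inter> (N <#> Y)"
          then obtain m y where m: "m \<in> N" and y: "y \<in> Y" and zm: "z = m \<otimes> y" by (auto simp: set_mult_def)
          have "m = z \<otimes> inv y" using m y NG YG by (simp add: zm grp_simps)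
          also have "\<dots> \<in> L" using z y Y(2) L by (meson IntD1 subgroup.m_closed subgroup.m_inv_closed subsetD)
          finally have "m \<in> Y" using m NK Y(3) by blast
          then show "z \<in> Y" using zm y Y(1) by (simp add: subgroup.m_closed)
        qed
      qed
      ultimately show "Y = L \<inter> K \<or> Y = L \<inter> H" by auto
    qed
    moreover have "factor_order (G\<lparr>carrier := L\<rparr>) (L \<inter> H) (L \<inter> K) = factor_order G H K"
    proof -
      have sub: "L \<inter> K \<subseteq> L \<inter> H" using KH by blast
      have I: "N \<inter> (L \<inter> H) = N \<inter> L" "N \<inter> (L \<inter> K) = N \<inter> L" using NK KH by auto
      have cH: "card H * card (N \<inter> L) = card N * card (L \<inter> H)"
        using card_set_mult[OF N(1) sHL] unfolding decH[symmetric] I .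
      have cK: "card K * card (N \<inter> L) = card N * card (L \<inter> K)"
        using card_set_mult[OF N(1) sKL] unfolding decK[symmetric] I .
      have "factor_order G H K * card K = card H" by (rule factor_order_mult_card[OF sH sK]) (use KH in blast)
      then have "card N * (factor_order G H K * card (L \<inter> K)) = card N * card (L \<inter> H)"
        using cH cK by (metis mult.assoc mult.left_commute)
      then have "factor_order G H K * card (L \<inter> K) = card (L \<inter> H)"
        using subgroup_card_pos[OF sN] by simp
      then have "factor_order G (L \<inter> H) (L \<inter> K) = factor_order G H K"
        by (rule factor_order_unique[OF sHL sKL sub])
      then show ?thesis by (simp add: factor_order_def)
    qed
    ultimately show ?thesis using ss dv unfolding p_supersolvable_def by metis
  qed
qed

end

section \<open>Groups with covering elements of small order\<close>

context fin_grp
begin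

lemma chief_factor_order_dvd_index:
  assumes "chief_factor G H K" "subgroup M G" "M \<subseteq> K"
  shows "factor_order G H K dvd card (rcosets M)"
proof -
  note c = chief_factorD(3-5)[OF assms(1)]
  have "card (rcosets K) = card (rcosets H) * factor_order G H K"
    by (rule index_factor_order) (use c in auto)
  then show ?thesis using index_dvd_index[OF c(3) assms(2,3)] by (metis dvd_mult_right)
qed

end

text \<open>What the induction knows about \<open>G\<close>: the hypothesis on small cyclic
  subgroups in the form of covering, and the conclusion for proper subgroups.\<close>

locale covering_grp = fin_grp +
  assumes covering: "\<And>x H K. x \<in> carrier G \<Longrightarrow> x [^] p_exponent p = \<one> \<Longrightarrow> chief_factor G H K \<Longrightarrow>
      p dvd factor_order G H K \<Longrightarrow> x \<in> H \<Longrightarrow> x \<notin> K \<Longrightarrow> H = K <#> generate G {x}"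
    and proper_p_supersolvable: "\<And>L. subgroup L G \<Longrightarrow> L \<noteq> carrier G \<Longrightarrow> p_supersolvable p (G\<lparr>carrier := L\<rparr>)"
begin

text \<open>A Sylow subgroup \<open>P\<close> of \<open>M\<close> has a normal product \<open>N <#> P\<close> with a normal \<open>p'\<close>-subgroup \<open>N\<close>, so
  \<open>G\<close> is the product of \<open>N\<close> and the normalizer of \<open>P\<close>, and the latter is \<open>p\<close>-supersolvable if proper.\<close>

lemma normal_sylow_of_proper_normal:
  assumes M: "M \<lhd> G" "M \<noteq> carrier G"
  shows "p_supersolvable p G \<or>
    (\<exists>P. P \<lhd> G \<and> p_subgroup p G P \<and> P \<subseteq> M \<and> \<not> p dvd factor_order G M P)"
proof -
  obtain N P where N: "N \<lhd> G" "\<not> p dvd card N" and P: "p_subgroup p G P" "P \<subseteq> M"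
    "\<not> p dvd factor_order G M P" and NP: "N <#> P \<lhd> G"
    using p_supersolvable_imp_normal_p_nilpotent[OF M(1) proper_p_supersolvable[OF normalD(1)[OF M(1)] M(2)]]
    by blast
  have sP: "subgroup P G" using P by (simp add: p_subgroup_def)
  define L where "L = {g \<in> carrier G. conj_by G g ` P = P}"
  have sL: "subgroup L G" unfolding L_def by (rule subgroup_normalizer[OF subgroup.subset[OF sP]])
  show ?thesis
  proof (cases "L = carrier G")
    case True
    then have "conj_by G g ` P = P" if "g \<in> carrier G" for g using that by (auto simp: L_def)
    then have "P \<lhd> G" using sP by (auto simp: normal_iff_conj_by)
    then show ?thesis using P by blast
  next
    case False
    have "p_supersolvable p G"
    proof (rule p_supersolvable_of_supplement[OF N sL _ proper_p_supersolvable[OF sL False]])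
      show "\<exists>n\<in>N. \<exists>l\<in>L. g = n \<otimes> l" if "g \<in> carrier G" for g
        using frattini[OF N P(1) NP that] by (auto simp: L_def)
    qed
    then show ?thesis ..
  qed
qed

text \<open>With \<open>P\<close> the normal Sylow subgroup of \<open>M\<close>, chief factors below
  \<open>P\<close> have order \<open>p\<close> by \<open>chief_factor_order_p\<close>, those between
  \<open>P\<close> and \<open>M\<close> have order dividing the index of \<open>P\<close> in
  \<open>M\<close>, which is prime to \<open>p\<close>, and those above \<open>M\<close> are covered
  by the hypothesis.\<close>

lemma p_supersolvable_of_normal:
  assumes M: "M \<lhd> G" "M \<noteq> carrier G"
    and above: "\<And>H K. chief_factor G H K \<Longrightarrow> M \<subseteq> K \<Longrightarrow> p dvd factor_order G H K \<Longrightarrow> factor_order G H K = p"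
  shows "p_supersolvable p G"
proof (rule disjE[OF normal_sylow_of_proper_normal[OF M]])
  assume "\<exists>P. P \<lhd> G \<and> p_subgroup p G P \<and> P \<subseteq> M \<and> \<not> p dvd factor_order G M P"
  then obtain P where P: "P \<lhd> G" "p_subgroup p G P" "P \<subseteq> M" "\<not> p dvd factor_order G M P" by blast
  show ?thesis
  proof (rule p_supersolvable_normal_series[OF P(1)])
    show "factor_order G H K = p" if HK: "chief_factor G H K" and "H \<subseteq> P" for H K
      by (rule chief_factor_order_p[OF covering HK p_subgroup_subset[OF P(2) chief_factorD(4)[OF HK] \<open>H \<subseteq> P\<close>]])
    show "factor_order G H K = p"
      if HK: "chief_factor G H K" and PK: "P \<subseteq> K" and dv: "p dvd factor_order G H K" for H K
    proof (cases "M \<inter> H \<subseteq> K")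
      case True
      note c = chief_factor_set_mult[OF HK M(1) True]
      have "M \<subseteq> M <#> K"
        by (rule subset_set_mult_left[OF chief_factorD(5)[OF HK] normal_subset_carrier[OF M(1)]])
      then show ?thesis using above[OF c(1)] c(2) dv by simp
    next
      case False
      note c = chief_factor_Int[OF HK M(1) False]
      note d = chief_factorD(3-5)[OF c(1)]
      note sM = normalD(1)[OF M(1)] and sP = normalD(1)[OF P(1)]
      have "factor_order G (M \<inter> H) (M \<inter> K) dvd factor_order G M P"
      proof -
        have s1: "M \<inter> H \<subseteq> M" and s2: "M \<inter> K \<subseteq> M \<inter> H" and s3: "P \<subseteq> M \<inter> K" using d P(3) PK by auto
        have e1: "factor_order G M (M \<inter> H) * card (M \<inter> H) = card M" by (rule factor_order_mult_card[OF sM d(2) s1])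
        have e2: "factor_order G (M \<inter> H) (M \<inter> K) * card (M \<inter> K) = card (M \<inter> H)"
          by (rule factor_order_mult_card[OF d(2,3) s2])
        have e3: "factor_order G (M \<inter> K) P * card P = card (M \<inter> K)" by (rule factor_order_mult_card[OF d(3) sP s3])
        have "factor_order G (M \<inter> H) (M \<inter> K) * (factor_order G M (M \<inter> H) * factor_order G (M \<inter> K) P) * card P
          = factor_order G M (M \<inter> H) * (factor_order G (M \<inter> H) (M \<inter> K) * (factor_order G (M \<inter> K) P * card P))"
          by (simp add: ac_simps)
        also have "\<dots> = card M" by (simp only: e1 e2 e3)
        finally have "factor_order G M P
          = factor_order G (M \<inter> H) (M \<inter> K) * (factor_order G M (M \<inter> H) * factor_order G (M \<inter> K) P)"
          by (rule factor_order_unique[OF sM sP P(3)])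
        then show ?thesis by simp
      qed
      then show ?thesis using P(4) c(2) dv dvd_trans by metis
    qed
  qed
qed

lemma p_supersolvable_of_index:
  assumes M: "M \<lhd> G" "M \<noteq> carrier G" and idx: "\<not> p dvd card (rcosets M) \<or> card (rcosets M) = p"
  shows "p_supersolvable p G"
proof (rule p_supersolvable_of_normal[OF M])
  fix H K assume HK: "chief_factor G H K" and MK: "M \<subseteq> K" and dv: "p dvd factor_order G H K"
  have "factor_order G H K dvd card (rcosets M)"
    by (rule chief_factor_order_dvd_index[OF HK normalD(1)[OF M(1)] MK])
  then show "factor_order G H K = p" using idx dv by (metis dvd_antisym dvd_trans)
qed

text \<open>An element of small order outside \<open>M\<close> generates \<open>G\<close> modulo
  \<open>M\<close>; if its \<open>p\<close>-th power lies in \<open>M\<close>, the index is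
  \<open>p\<close>, which is excluded.\<close>

lemma small_elements_in_maximal_normal:
  assumes M: "chief_factor G (carrier G) M" and f: "p dvd factor_order G (carrier G) M"
    "factor_order G (carrier G) M \<noteq> p"
    and x: "x \<in> carrier G" "x [^] p_exponent p = \<one>"
  shows "x \<in> M"
proof (rule ccontr)
  assume xM: "x \<notin> M"
  note sM = chief_factorD(5)[OF M]
  have bad: False if y: "y \<in> carrier G" "y [^] p_exponent p = \<one>" "y \<notin> M" "y [^] p \<in> M" for y
    using factor_order_cyclic[OF subgroup_self sM subgroup.subset[OF sM] y(1,4) covering[OF y(1,2) M f(1) y(1,3)] f(1)]
      f(2) by blast
  have xp: "x [^] p \<notin> M" using bad[OF x xM] by blast
  \<comment> \<open>The remaining case is an element of order 4 whose square is outside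
    \<open>M\<close>. The square is again of small order, and its own square is trivial.\<close>
  then have "p = 2" using x(2) subgroup.one_closed[OF sM] by (auto simp: p_exponent_def split: if_splits)
  then have four: "(x [^] p) [^] p = \<one>" using x by (simp add: p_exponent_def nat_pow_pow)
  then have "(x [^] p) [^] p_exponent p = \<one>"
    using x(1) p_dvd_p_exponent by (metis dvdE nat_pow_closed nat_pow_one nat_pow_pow)
  then show False using bad[OF _ _ xp] four x(1) subgroup.one_closed[OF sM] by simp
qed

theorem p_supersolvable: "p_supersolvable p G"
proof (cases "p dvd card (carrier G)")
  case False
  show ?thesis
    unfolding p_supersolvable_def
  proof (intro conjI allI impI, rule is_group, rule fin, elim conjE)
    fix H K assume HK: "chief_factor G H K" and dv: "p dvd factor_order G H K"
    note c = chief_factorD(3-5)[OF HK]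
    have "factor_order G H K dvd card H" by (rule factor_order_dvd) (use c in auto)
    then have "p dvd card (carrier G)"
      using dv lagrange_subgroups[OF c(2) subgroup_self subgroup.subset[OF c(2)]] by (meson dvd_trans)
    then show "factor_order G H K = p" using False by blast
  qed
next
  case True
  then have "carrier G \<noteq> {\<one>}" using p_gt_1 by auto
  then have "{\<one>} \<subset> carrier G" by blast
  then obtain M where M: "chief_factor G (carrier G) M"
    using chief_factor_below[OF normal_self one_is_normal] by blast
  note nM = chief_factorD(2)[OF M] and sM = chief_factorD(5)[OF M]
  have M': "M \<noteq> carrier G" using chief_factorD(3)[OF M] by blast
  have idxM: "card (rcosets M) = factor_order G (carrier G) M"
    by (simp add: factor_order_def order_def FactGroup_def)
  show ?thesis
  proof (cases "\<not> p dvd card (rcosets M) \<or> card (rcosets M) = p")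
    case True
    then show ?thesis by (rule p_supersolvable_of_index[OF nM M'])
  next
    case False
    then have f: "p dvd factor_order G (carrier G) M" "factor_order G (carrier G) M \<noteq> p"
      using idxM by auto
    show ?thesis
    proof (rule disjE[OF normal_sylow_of_proper_normal[OF nM M']])
      assume "\<exists>P. P \<lhd> G \<and> p_subgroup p G P \<and> P \<subseteq> M \<and> \<not> p dvd factor_order G M P"
      then obtain P where P: "P \<lhd> G" "p_subgroup p G P" "P \<subseteq> M" "\<not> p dvd factor_order G M P" by blast
      \<comment> \<open>Such an \<open>x\<close> lies in \<open>M\<close>, and its image in
        \<open>M/P\<close> has order prime to \<open>p\<close>.\<close>
      have small: "x \<in> P" if x: "x \<in> carrier G" "x [^] p_exponent p = \<one>" for x
      proof (rule pow_coprime_mem[OF normalD(1)[OF P(1)] x(1)])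
        have "x \<in> M" by (rule small_elements_in_maximal_normal[OF M f x])
        then show "x [^] factor_order G M P \<in> P" by (rule pow_factor_order_mem[OF sM P(1,3)])
        show "x [^] p_exponent p \<in> P" using x(2) subgroup.one_closed[OF normalD(1)[OF P(1)]] by simp
        have "coprime (factor_order G M P) p" using P(4) prime_p by (simp add: coprime_commute prime_imp_coprime)
        then have "coprime (factor_order G M P) (p ^ 2)" by simp
        then show "coprime (factor_order G M P) (p_exponent p)"
          using \<open>coprime (factor_order G M P) p\<close> by (cases "p = 2") (simp_all add: p_exponent_def)
      qed
      show ?thesis
      \<comment> \<open>A factor of order \<open>p\<close> below \<open>P\<close> that
        \<open>G\<close> does not centralize has a proper normal centralizer. The quotient by it has
        exponent dividing \<open>p - 1\<close>, so it contains a Sylow \<open>p\<close>-subgroup and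
        has index prime to \<open>p\<close>. Otherwise \<open>G\<close> centralizes all these
        factors, and \<open>p\<close>-regular elements centralize \<open>P\<close>.\<close>
      proof (cases "\<exists>H K. chief_factor G H K \<and> H \<subseteq> P \<and> factor_centralizer G H K \<noteq> carrier G")
        case True
        then obtain H K where HK: "chief_factor G H K" and HP: "H \<subseteq> P"
          and ne: "factor_centralizer G H K \<noteq> carrier G" by blast
        let ?E = "factor_centralizer G H K"
        note c = chief_factorD(1,2,3)[OF HK]
        have fo: "factor_order G H K = p"
          by (rule chief_factor_order_p[OF covering HK p_subgroup_subset[OF P(2) chief_factorD(4)[OF HK] HP]])
        have nE: "?E \<lhd> G" by (rule normal_factor_centralizer[OF c(1,2)])
        obtain S where S: "sylow_subgroup p G S" using sylow_subgroup_exists by blast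
        have Sp: "p_subgroup p G S" "subgroup S G" using S by (auto simp: sylow_subgroup_def p_subgroup_def)
        have "S \<subseteq> ?E"
        proof
          fix s assume s: "s \<in> S"
          have sG: "s \<in> carrier G" using s Sp(2) subgroup.mem_carrier by metis
          obtain k where k: "s [^] (p ^ k) = \<one>" using p_subgroup_pow[OF Sp(1) s] by blast
          have "s [^] (p - 1) \<in> ?E"
            by (rule order_p_factor_centralizer(1)[OF c(1,2) _ fo sG sG]) (use c in blast)
          moreover have "s [^] (p ^ k) \<in> ?E" using k subgroup.one_closed[OF normalD(1)[OF nE]] by simp
          moreover have "coprime (p - 1) (p ^ k)" using coprime_diff_one_left_nat p_gt_1 by simp
          ultimately show "s \<in> ?E" by (rule pow_coprime_mem[OF normalD(1)[OF nE] sG])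
        qed
        then have "\<not> p dvd card (rcosets ?E)" by (rule sylow_overgroup_index[OF S normalD(1)[OF nE]])
        then show ?thesis using p_supersolvable_of_index[OF nE ne] by blast
      next
        case False
        have fixP: "conj_by G x d = d" if x: "p_regular p G x" and d: "d \<in> P" for x d
        proof (rule p_regular_centralizes_series[OF P(2) x _ P(1) _ d d])
          have xG: "x \<in> carrier G" using x by (simp add: p_regular_def)
          show "conj_by G x e \<in> P" if "e \<in> P" for e by (rule normalD(2)[OF P(1) xG that])
          show "conj_by G x h \<otimes> inv h \<in> K" if "chief_factor G H K" "H \<subseteq> P" "h \<in> H" for H K h
          proof -
            have "x \<in> factor_centralizer G H K" using False that(1,2) xG by blast
            then show ?thesis using that(3) by (simp add: factor_centralizer_def)
          qed
        qed
        have "p_regular_act_trivially p G"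
          unfolding p_regular_act_trivially_def
        proof (intro allI impI ballI, elim conjE)
          fix D x d
          assume D: "p_subgroup p G D" and x: "p_regular p G x" and inv: "\<forall>d\<in>D. conj_by G x d \<in> D" and d: "d \<in> D"
          show "conj_by G x d = d"
          proof (rule p_regular_centralizes_p_subgroup[OF D x _ _ d])
            show "conj_by G x e = e" if "e \<in> D" "e [^] p_exponent p = \<one>" for e
            proof -
              have "subgroup D G" using D by (simp add: p_subgroup_def)
              then have "e \<in> P" using small that subgroup.mem_carrier by metis
              then show ?thesis by (rule fixP[OF x])
            qed
          qed (use inv in blast)
        qed
        then obtain U where U: "U \<lhd> G" "card (carrier G) = p * card U"
          using normal_index_p_exists[OF _ True] by blast
        have sU: "subgroup U G" by (rule normalD(1)[OF U(1)])
        have "U \<noteq> carrier G" using U(2) subgroup_card_pos[OF sU] p_gt_1 by auto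
        moreover have "card (rcosets U) = p"
          using lagrange'[OF sU] U(2) subgroup_card_pos[OF sU] by simp
        ultimately show ?thesis using p_supersolvable_of_index[OF U(1)] by blast
      qed
    qed
  qed
qed

end

section \<open>From strong \<open>p\<close>-CAP-subgroups to covering, and the induction\<close>

context fin_grp
begin

text \<open>The subgroup generated by \<open>x\<close> has order \<open>p\<close>, or 4 if
  \<open>p = 2\<close>, so it covers or avoids \<open>H/K\<close>. It cannot avoid, as
  \<open>x\<close> is in \<open>H\<close> but not in \<open>K\<close>; and since it lies in
  \<open>H\<close>, covering means that it generates \<open>H\<close> modulo
  \<open>K\<close>.\<close>

lemma covers_of_strong_p_CAP:
  assumes cap: "\<And>A. subgroup A G \<Longrightarrow> cyclic_group (G\<lparr>carrier := A\<rparr>) \<Longrightarrow> card A = p \<Longrightarrow>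
      strong_p_CAP_subgroup p G A"
    and cap4: "\<And>A. p = 2 \<Longrightarrow> subgroup A G \<Longrightarrow> cyclic_group (G\<lparr>carrier := A\<rparr>) \<Longrightarrow> card A = 4 \<Longrightarrow>
      strong_p_CAP_subgroup p G A"
    and x: "x \<in> carrier G" "x [^] p_exponent p = \<one>" and HK: "chief_factor G H K"
    and dv: "p dvd factor_order G H K" and xH: "x \<in> H" "x \<notin> K"
  shows "H = K <#> generate G {x}"
proof -
  define A where "A = generate G {x}"
  note sH = chief_factorD(4)[OF HK] and sK = chief_factorD(5)[OF HK]
  have sA: "subgroup A G" unfolding A_def by (rule generate_is_subgroup) (use x in simp)
  have AH: "A \<subseteq> H" unfolding A_def by (rule generate_subgroup_incl[OF _ sH]) (use xH in simp)
  have xA: "x \<in> A" unfolding A_def by (auto intro: generate.incl)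
  have cA: "card A = ord x" using generate_pow_card[OF x(1)] by (simp add: A_def)
  have "x \<noteq> \<one>" using xH subgroup.one_closed[OF sK] by blast
  then have "ord x \<noteq> 1" using x(1) ord_eq_1 by blast
  moreover have "ord x dvd p_exponent p" using pow_eq_id[OF x(1)] x(2) by simp
  ultimately have card: "card A = p \<or> p = 2 \<and> card A = 4"
  proof (cases "p = 2")
    case True
    then have dv4: "ord x dvd 4" using \<open>ord x dvd p_exponent p\<close> by (simp add: p_exponent_def)
    then have "ord x \<le> 4" by (simp add: dvd_imp_le)
    then have "ord x = 0 \<or> ord x = 1 \<or> ord x = 2 \<or> ord x = 3 \<or> ord x = 4" by auto
    then show ?thesis using dv4 \<open>ord x \<noteq> 1\<close> cA True by auto
  next
    case False
    then have "ord x dvd p" using \<open>ord x dvd p_exponent p\<close> by (simp add: p_exponent_def)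
    then show ?thesis using \<open>ord x \<noteq> 1\<close> prime_p prime_nat_iff cA by blast
  qed
  interpret A: group "G\<lparr>carrier := A\<rparr>" by (rule subgroup_imp_group[OF sA])
  have "cyclic_group (G\<lparr>carrier := A\<rparr>)"
    unfolding A.cyclic_group
  proof (intro bexI)
    have "A = range (\<lambda>i::int. x [^] i)" using generate_pow[OF x(1)] by (auto simp: A_def)
    then show "carrier (G\<lparr>carrier := A\<rparr>) = range (\<lambda>i::int. x [^]\<^bsub>G\<lparr>carrier := A\<rparr>\<^esub> i)"
      using int_pow_consistent[OF sA xA] by simp
  qed (use xA in simp)
  then have "strong_p_CAP_subgroup p G A" using card cap[OF sA] cap4[OF _ sA] by blast
  \<comment> \<open>The overgroup in the definition of strong is taken to be \<open>G\<close>
    itself.\<close>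
  then have "p_CAP_subgroup p G A"
    using subgroup_self subgroup.subset[OF sA] unfolding strong_p_CAP_subgroup_def by fastforce
  then have "covers G A H K \<or> avoids A H K" using HK dv by (simp add: p_CAP_subgroup_def)
  moreover have "\<not> avoids A H K" using xA xH by (auto simp: avoids_def)
  ultimately have "H <#> A = K <#> A" by (simp add: covers_def)
  moreover have "H <#> A = H"
  proof
    show "H <#> A \<subseteq> H" by (rule set_mult_in_subgroup[OF sH order_refl AH])
    show "H \<subseteq> H <#> A" by (rule subset_set_mult_left[OF sA subgroup.subset[OF sH]])
  qed
  ultimately show ?thesis by (simp add: A_def)
qed

lemma strong_p_CAP_subgroup_restrict:
  assumes "strong_p_CAP_subgroup p G A" "subgroup L G" "A \<subseteq> L"
  shows "strong_p_CAP_subgroup p (G\<lparr>carrier := L\<rparr>) A"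
  using assms by (auto simp: strong_p_CAP_subgroup_def subgroup_of_subgroup_iff)

end

theorem theorem3p1:
  fixes G :: "('a, 'b) monoid_scheme" and p :: nat
  assumes "Factorial_Ring.prime p"
    and "group G"
    and "finite (carrier G)"
    and "\<And>A. subgroup A G \<Longrightarrow> cyclic_group (G\<lparr>carrier := A\<rparr>) \<Longrightarrow> card A = p \<Longrightarrow>
           strong_p_CAP_subgroup p G A"
    and "\<And>A. p = 2 \<Longrightarrow> subgroup A G \<Longrightarrow> cyclic_group (G\<lparr>carrier := A\<rparr>) \<Longrightarrow> card A = 4 \<Longrightarrow>
           strong_p_CAP_subgroup p G A"
  shows "p_supersolvable p G"
  using assms(2-)
proof (induction "card (carrier G)" arbitrary: G rule: less_induct)
  case (less G)
  interpret fin_grp G p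
    using less.prems(1,2) assms(1) by (simp add: fin_grp_def fin_grp_axioms_def)
  have "covering_grp G p"
  proof (intro covering_grp.intro covering_grp_axioms.intro fin_grp_axioms)
    show "H = K <#>\<^bsub>G\<^esub> generate G {x}"
      if "x \<in> carrier G" "x [^]\<^bsub>G\<^esub> p_exponent p = \<one>\<^bsub>G\<^esub>" "chief_factor G H K" "p dvd factor_order G H K"
        "x \<in> H" "x \<notin> K" for x H K
      by (rule covers_of_strong_p_CAP[OF less.prems(3,4) that])
    fix L assume L: "subgroup L G" "L \<noteq> carrier G"
    show "p_supersolvable p (G\<lparr>carrier := L\<rparr>)"
    proof (rule less.hyps)
      have "L \<subset> carrier G" using L subgroup.subset by blast
      then show "card (carrier (G\<lparr>carrier := L\<rparr>)) < card (carrier G)" by (simp add: psubset_card_mono)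
      show "group (G\<lparr>carrier := L\<rparr>)" by (rule subgroup_imp_group[OF L(1)])
      show "finite (carrier (G\<lparr>carrier := L\<rparr>))" using L(1) by simp
      \<comment> \<open>Updating the carrier twice leaves the second update, so \<open>A\<close> is
        the same cyclic group inside \<open>L\<close> as inside \<open>G\<close>.\<close>
      show "strong_p_CAP_subgroup p (G\<lparr>carrier := L\<rparr>) A"
        if "subgroup A (G\<lparr>carrier := L\<rparr>)" "cyclic_group (G\<lparr>carrier := L, carrier := A\<rparr>)" "card A = p" for A
        using that less.prems(3)[of A] strong_p_CAP_subgroup_restrict[OF _ L(1)] subgroup_of_subgroup_iff[OF L(1)]
        by simp
      show "strong_p_CAP_subgroup p (G\<lparr>carrier := L\<rparr>) A"
        if "p = 2" "subgroup A (G\<lparr>carrier := L\<rparr>)" "cyclic_group (G\<lparr>carrier := L, carrier := A\<rparr>)" "card A = 4" for A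
        using that less.prems(4)[of A] strong_p_CAP_subgroup_restrict[OF _ L(1)] subgroup_of_subgroup_iff[OF L(1)]
        by simp
    qed
  qed
  then show ?case by (rule covering_grp.p_supersolvable)
qed

end
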